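(* Let $G=(V,E)$ be a DAG on $p\ge 2$ nodes with topologically ordered vertices. Let $$\kappa=\max_{i,j\in V,\ i\neq j,\ S\subset V\setminus\{i,j\}}\ \max_{(a_{st})\in[-1,1]^{|E|}}\operatorname{var}(X_i\mid X_S),$$ and let $C(|E|)>0$ be the constant from Crofton's formula in dimension $|E|$. Then there exist, for all $i\neq j$ in $V$ and $S\subset V\setminus\{i,j\}$, positive constants $c_{ij\mid S},k_{ij\mid S}$, not depending on $\lambda$, satisfying the Lojasiewicz inequality $$\operatorname{dist}\big(a,V_{ij\mid S}\big)\le c_{ij\mid S}\,\big|\operatorname{cov}(X_i,X_j\mid X_S)(a)\big|^{k_{ij\mid S}}\qquad\text{for all } a\in[-1,1]^{|E|},$$ such that with $c=\max_{i\ne j,S}c_{ij\mid S}$ and $k=\min_{i\neq j,S}k_{ij\mid S}$ one has, for every $\lambda\in(0,1)$, $$\frac{\operatorname{vol}(\mathcal{N}^{(2)}_{G,\lambda})}{2^{|E|}}\le\frac{\operatorname{vol}(\mathcal{N}^{(1)}_{G,\lambda})}{2^{|E|}}\le\frac{\operatorname{vol}(\mathcal{M}_{G,\lambda})}{2^{|E|}}\le\frac{C(|E|)\,c\,\kappa^{k}\lambda^{k}}{2^{|E|/2}}\sum_{i,j\in V,\, i\neq j}\ \sum_{S\subset V\setminus\{i,j\}}\deg\big(\operatorname{cov}(X_i,X_j\mid X_S)\big).$$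
   Context: Model. $G=(V,E)$ is a directed acyclic graph (DAG) with $V=\{1,\dots,p\}$, topologically ordered, i.e. $i<j$ for all $(i,j)\in E$ (an edge $(i,j)$ means $i\to j$). For a parameter vector $a=(a_{ij})_{(i,j)\in E}\in[-1,1]^{|E|}$, let $A\in\mathbb{R}^{p\times p}$ be the strictly upper triangular matrix with $A_{ij}=a_{ij}$ for $(i,j)\in E$ and $A_{ij}=0$ otherwise. The random vector $X=(X_1,\dots,X_p)$ is defined by $X_j=\sum_{i<j}A_{ij}X_i+\varepsilon_j$ with $\varepsilon\sim\mathcal N(0,I)$, so $X\sim\mathcal N(0,K^{-1})$ with $K=(I-A)(I-A)^T$. Conditional covariances and variances $\operatorname{cov}(X_i,X_j\mid X_S)$, $\operatorname{var}(X_i\mid X_S)$ are those of this Gaussian vector, and are functions of $a$. d-separation. Nodes $i\ne j$ are $d$-separated given $S\subset V\setminus\{i,j\}$ if every path between $i$ and $j$ in the skeleton of $G$ contains a noncollider (with respect to the path) that is in $S$, or a collider (node at which both path edges point into it) that is neither in $S$ nor an ancestor of a node in $S$. The skeleton is the underlying undirected graph; $i,j$ are adjacent if joined by an edge in the skeleton; $(i,j,k)$ is an unshielded triple if $i$ and $j$ are both adjacent to $k$ but $i$ and $j$ are not adjacent. $\deg(G)$ is the maximal degree (indegree plus outdegree) of nodes in $G$. Sets. For $i\neq j$ and $S\subset V\setminus\{i,j\}$, $$\mathcal P^{\lambda}_{ij\mid S}=\big\{a\in[-1,1]^{|E|}:\ |\operatorname{cov}(X_i,X_j\mid X_S)|\le\lambda\sqrt{\operatorname{var}(X_i\mid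 X_S)\operatorname{var}(X_j\mid X_S)}\big\}.$$ $\mathcal M_{G,\lambda}$ is the union of $\mathcal P^\lambda_{ij\mid S}$ over all $i\ne j$, $S\subset V\setminus\{i,j\}$ such that $i$ and $j$ are not $d$-separated given $S$. $\mathcal N^{(1)}_{G,\lambda}$ is the union of $\mathcal P^\lambda_{ij\mid S}$ over all triples $(i,j,S)$ with $S\subset V\setminus\{i,j\}$, $|S|\le\deg(G)$, such that either $(i,j)\in E$, or $i,j$ are not adjacent, are not $d$-separated given $S$, and there is $k\in V$ making $(i,j,k)$ an unshielded triple. $\mathcal N^{(2)}_{G,\lambda}$ is the union of $\mathcal P^\lambda_{ij\mid S}$ over all $(i,j,S)$ with $(i,j)\in E$, $S\subset V\setminus\{i,j\}$, $|S|\le\deg(G)$. $\operatorname{vol}$ is Lebesgue measure on $\mathbb{R}^{|E|}$. Further notation. $V_{ij\mid S}=\{a\in[-1,1]^{|E|}:\operatorname{cov}(X_i,X_j\mid X_S)=0\}$, and $\operatorname{dist}$ is Euclidean distance. $\deg(\operatorname{cov}(X_i,X_j\mid X_S))$ is the degree, in the variables $a$, of the polynomial $$P_{ij\mid S}=\det(K_{Q^cQ^c})K_{ij}-K_{iQ^c}C(K_{Q^cQ^c})K_{Q^cj},\qquad Q=S\cup\{i,j\},\ Q^c=V\setminus Q,$$ ($P_{ij\mid S}=K_{ij}$ if $Q^c=\emptyset$), where $C(\cdot)$ is the cofactor matrix; its zero set is that of $\operatorname{cov}(X_i,X_j\mid X_S)$, and the zero polynomial is assigned degree $0$. Crofton's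 formula. $C(m)$ is a positive constant depending only on $m$ such that the volume (surface area) of any real algebraic hypersurface of degree $d$ in the unit $m$-ball is at most $C(m)d$; it satisfies $\binom{m+d}{d}-1\le C(m)d^m$. *)

theory Defs
  imports
    "HOL-Probability.Probability"
    "HOL-Library.Poly_Mapping"
    "Jordan_Normal_Form.Determinant"
    "Jordan_Normal_Form.DL_Submatrix"
begin

text \<open>
  The vertex set is \<open>V = {..<p}\<close>: vertices are numbered from \<open>0\<close> instead of \<open>1\<close>, to agree
  with the matrix indices of \<open>Jordan_Normal_Form\<close>. Points of \<open>\<real>\<^sup>I\<close> for a finite index set \<open>I\<close>
  are extensional functions, i.e. elements of \<open>I \<rightarrow>\<^sub>E UNIV\<close>.
\<close>

section \<open>Directed acyclic graphs and d-separation\<close>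

text \<open>Since every edge increases the vertex number, acyclicity is automatic.\<close>

definition ordered_dag :: "nat \<Rightarrow> (nat \<times> nat) set \<Rightarrow> bool" where
  "ordered_dag p E \<longleftrightarrow> (\<forall>(i, j) \<in> E. i < j \<and> j < p)"

definition adjacent :: "(nat \<times> nat) set \<Rightarrow> nat \<Rightarrow> nat \<Rightarrow> bool" where
  "adjacent E i j \<longleftrightarrow> (i, j) \<in> E \<or> (j, i) \<in> E"

definition unshielded_triple :: "(nat \<times> nat) set \<Rightarrow> nat \<Rightarrow> nat \<Rightarrow> nat \<Rightarrow> bool" where
  "unshielded_triple E i j k \<longleftrightarrow> adjacent E i k \<and> adjacent E j k \<and> \<not> adjacent E i j"

definition max_degree :: "nat \<Rightarrow> (nat \<times> nat) set \<Rightarrow> nat" where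
  "max_degree p E = Max ((\<lambda>v. card {u. (u, v) \<in> E} + card {w. (v, w) \<in> E}) ` {..<p})"

definition skeleton_path :: "(nat \<times> nat) set \<Rightarrow> nat \<Rightarrow> nat \<Rightarrow> nat list \<Rightarrow> bool" where
  "skeleton_path E i j xs \<longleftrightarrow>
     xs \<noteq> [] \<and> hd xs = i \<and> last xs = j \<and> distinct xs \<and>
     (\<forall>n. Suc n < length xs \<longrightarrow> adjacent E (xs ! n) (xs ! Suc n))"

definition collider_at :: "(nat \<times> nat) set \<Rightarrow> nat list \<Rightarrow> nat \<Rightarrow> bool" where
  "collider_at E xs n \<longleftrightarrow> (xs ! (n - 1), xs ! n) \<in> E \<and> (xs ! (n + 1), xs ! n) \<in> E"

text \<open>
  Only interior positions \<open>n\<close> of the path are inspected; the end points \<open>i\<close>, \<open>j\<close> are not in \<open>S\<close>,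
  so they can never block a path.
\<close>

definition d_separated :: "(nat \<times> nat) set \<Rightarrow> nat \<Rightarrow> nat \<Rightarrow> nat set \<Rightarrow> bool" where
  "d_separated E i j S \<longleftrightarrow>
     (\<forall>xs. skeleton_path E i j xs \<longrightarrow>
       (\<exists>n. 0 < n \<and> n + 1 < length xs \<and>
          ((\<not> collider_at E xs n \<and> xs ! n \<in> S) \<or>
           (collider_at E xs n \<and> xs ! n \<notin> S \<and> (\<forall>s\<in>S. (xs ! n, s) \<notin> E\<^sup>+)))))"

definition triples :: "nat \<Rightarrow> (nat \<times> nat \<times> nat set) set" where
  "triples p = {(i, j, S). i < p \<and> j < p \<and> i \<noteq> j \<and> S \<subseteq> {..<p} - {i, j}}"


section \<open>The Gaussian structural equation model\<close>

definition edge_coeff ::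
    "(nat \<times> nat) set \<Rightarrow> (nat \<times> nat \<Rightarrow> 'a::zero) \<Rightarrow> nat \<Rightarrow> nat \<Rightarrow> 'a" where
  "edge_coeff E a i j = (if (i, j) \<in> E then a (i, j) else 0)"

definition noise :: "nat \<Rightarrow> (nat \<Rightarrow> real) measure" where
  "noise p = PiM {..<p} (\<lambda>_. density lborel (\<lambda>x. ennreal (std_normal_density x)))"

text \<open>\<open>sem_var E a j\<close> is the random variable \<open>X\<^sub>j\<close> on \<open>noise p\<close>, for \<open>j < p\<close>.\<close>

function sem_var ::
    "(nat \<times> nat) set \<Rightarrow> (nat \<times> nat \<Rightarrow> real) \<Rightarrow> nat \<Rightarrow> (nat \<Rightarrow> real) \<Rightarrow> real" where
  "sem_var E a j \<epsilon> = (\<Sum>i\<in>{..<j}. edge_coeff E a i j * sem_var E a i \<epsilon>) + \<epsilon> j"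
  by pat_completeness auto
termination
  by (relation "Wellfounded.measure (\<lambda>(E, a, j, \<epsilon>). j)") auto

declare sem_var.simps [simp del]

definition sigma_of ::
    "nat \<Rightarrow> (nat \<times> nat) set \<Rightarrow> (nat \<times> nat \<Rightarrow> real) \<Rightarrow> nat set \<Rightarrow> (nat \<Rightarrow> real) measure" where
  "sigma_of p E a S =
     vimage_algebra (space (noise p)) (\<lambda>\<epsilon>. \<lambda>s\<in>S. sem_var E a s \<epsilon>) (PiM S (\<lambda>_. borel))"

definition cexp ::
    "nat \<Rightarrow> (nat \<times> nat) set \<Rightarrow> (nat \<times> nat \<Rightarrow> real) \<Rightarrow> nat set \<Rightarrow>
       ((nat \<Rightarrow> real) \<Rightarrow> real) \<Rightarrow> (nat \<Rightarrow> real) \<Rightarrow> real" where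
  "cexp p E a S = real_cond_exp (noise p) (sigma_of p E a S)"

text \<open>
  The conditional covariance given \<open>X\<^sub>S\<close> is a random variable; as \<open>X\<close> is Gaussian it is almost
  surely constant, and \<open>cov(X\<^sub>i, X\<^sub>j | X\<^sub>S)\<close> denotes that constant.
\<close>

definition cond_cov ::
    "nat \<Rightarrow> (nat \<times> nat) set \<Rightarrow> nat \<Rightarrow> nat \<Rightarrow> nat set \<Rightarrow> (nat \<times> nat \<Rightarrow> real) \<Rightarrow> real" where
  "cond_cov p E i j S a =
     (THE v. AE \<epsilon> in noise p.
        cexp p E a S
          (\<lambda>\<omega>. (sem_var E a i \<omega> - cexp p E a S (sem_var E a i) \<omega>) *
               (sem_var E a j \<omega> - cexp p E a S (sem_var E a j) \<omega>)) \<epsilon> = v)"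

definition cond_var ::
    "nat \<Rightarrow> (nat \<times> nat) set \<Rightarrow> nat \<Rightarrow> nat set \<Rightarrow> (nat \<times> nat \<Rightarrow> real) \<Rightarrow> real" where
  "cond_var p E i S a = cond_cov p E i i S a"


section \<open>The parameter cube and the unfaithful sets\<close>

definition cube :: "(nat \<times> nat) set \<Rightarrow> (nat \<times> nat \<Rightarrow> real) set" where
  "cube E = E \<rightarrow>\<^sub>E {-1..1}"

definition vol :: "(nat \<times> nat) set \<Rightarrow> (nat \<times> nat \<Rightarrow> real) set \<Rightarrow> real" where
  "vol E A = measure (PiM E (\<lambda>_. lborel)) A"

definition P_set ::
    "nat \<Rightarrow> (nat \<times> nat) set \<Rightarrow> real \<Rightarrow> nat \<Rightarrow> nat \<Rightarrow> nat set \<Rightarrow> (nat \<times> nat \<Rightarrow> real) set" where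
  "P_set p E l i j S =
     {a \<in> cube E. \<bar>cond_cov p E i j S a\<bar> \<le> l * sqrt (cond_var p E i S a * cond_var p E j S a)}"

definition M_set :: "nat \<Rightarrow> (nat \<times> nat) set \<Rightarrow> real \<Rightarrow> (nat \<times> nat \<Rightarrow> real) set" where
  "M_set p E l =
     (\<Union>(i, j, S) \<in> {(i, j, S) \<in> triples p. \<not> d_separated E i j S}. P_set p E l i j S)"

definition N1_set :: "nat \<Rightarrow> (nat \<times> nat) set \<Rightarrow> real \<Rightarrow> (nat \<times> nat \<Rightarrow> real) set" where
  "N1_set p E l =
     (\<Union>(i, j, S) \<in> {(i, j, S) \<in> triples p. card S \<le> max_degree p E \<and>
          ((i, j) \<in> E \<or>
           (\<not> adjacent E i j \<and> \<not> d_separated E i j S \<and> (\<exists>k<p. unshielded_triple E i j k)))}.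
        P_set p E l i j S)"

definition N2_set :: "nat \<Rightarrow> (nat \<times> nat) set \<Rightarrow> real \<Rightarrow> (nat \<times> nat \<Rightarrow> real) set" where
  "N2_set p E l =
     (\<Union>(i, j, S) \<in> {(i, j, S) \<in> triples p. card S \<le> max_degree p E \<and> (i, j) \<in> E}.
        P_set p E l i j S)"

definition V_set ::
    "nat \<Rightarrow> (nat \<times> nat) set \<Rightarrow> nat \<Rightarrow> nat \<Rightarrow> nat set \<Rightarrow> (nat \<times> nat \<Rightarrow> real) set" where
  "V_set p E i j S = {a \<in> cube E. cond_cov p E i j S a = 0}"

definition kappa :: "nat \<Rightarrow> (nat \<times> nat) set \<Rightarrow> real" where
  "kappa p E = Max ((\<lambda>(i, j, S). SUP a\<in>cube E. cond_var p E i S a) ` triples p)"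

definition euclid_dist :: "'v set \<Rightarrow> ('v \<Rightarrow> real) \<Rightarrow> ('v \<Rightarrow> real) \<Rightarrow> real" where
  "euclid_dist I x y = L2_set (\<lambda>e. x e - y e) I"

definition euclid_infdist :: "'v set \<Rightarrow> ('v \<Rightarrow> real) \<Rightarrow> ('v \<Rightarrow> real) set \<Rightarrow> real" where
  "euclid_infdist I x A = (INF y\<in>A. euclid_dist I x y)"


section \<open>Multivariate polynomials and the polynomials defining the conditional covariances\<close>

text \<open>Real polynomials in variables indexed by \<open>'v\<close>: finitely supported maps from monomials
  (exponent vectors) to coefficients, with convolution product.\<close>

type_synonym 'v mpoly_real = "('v \<Rightarrow>\<^sub>0 nat) \<Rightarrow>\<^sub>0 real"

definition mvar :: "'v \<Rightarrow> 'v mpoly_real" where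
  "mvar x = Poly_Mapping.single (Poly_Mapping.single x 1) 1"

definition monom_degree :: "('v \<Rightarrow>\<^sub>0 nat) \<Rightarrow> nat" where
  "monom_degree m = (\<Sum>x\<in>Poly_Mapping.keys m. Poly_Mapping.lookup m x)"

definition total_degree :: "'v mpoly_real \<Rightarrow> nat" where
  "total_degree f = (if f = 0 then 0 else Max (monom_degree ` Poly_Mapping.keys f))"

definition mvars :: "'v mpoly_real \<Rightarrow> 'v set" where
  "mvars f = (\<Union>m\<in>Poly_Mapping.keys f. Poly_Mapping.keys m)"

definition meval :: "'v mpoly_real \<Rightarrow> ('v \<Rightarrow> real) \<Rightarrow> real" where
  "meval f x = (\<Sum>m\<in>Poly_Mapping.keys f. Poly_Mapping.lookup f m *
      (\<Prod>v\<in>Poly_Mapping.keys m. x v ^ Poly_Mapping.lookup m v))"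

definition A_mat ::
    "nat \<Rightarrow> (nat \<times> nat) set \<Rightarrow> (nat \<times> nat \<Rightarrow> 'a::comm_ring_1) \<Rightarrow> 'a mat" where
  "A_mat p E a = mat p p (\<lambda>(i, j). edge_coeff E a i j)"

definition K_mat ::
    "nat \<Rightarrow> (nat \<times> nat) set \<Rightarrow> (nat \<times> nat \<Rightarrow> 'a::comm_ring_1) \<Rightarrow> 'a mat" where
  "K_mat p E a = (1\<^sub>m p - A_mat p E a) * transpose_mat (1\<^sub>m p - A_mat p E a)"

definition cofactor_mat :: "'a::comm_ring_1 mat \<Rightarrow> 'a mat" where
  "cofactor_mat B = mat (dim_row B) (dim_col B) (\<lambda>(r, s). cofactor B r s)"

text \<open>
  If \<open>Q\<^sup>c\<close> is empty, the determinant of the empty matrix is \<open>1\<close> and the matrix product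
  below is \<open>0\<close>, so that \<open>cov_poly p E i j S\<close> is \<open>K\<^sub>i\<^sub>j\<close>, as it should be.
\<close>

definition cov_poly ::
    "nat \<Rightarrow> (nat \<times> nat) set \<Rightarrow> nat \<Rightarrow> nat \<Rightarrow> nat set \<Rightarrow> (nat \<times> nat) mpoly_real" where
  "cov_poly p E i j S =
     (let K = K_mat p E mvar; Qc = {..<p} - (S \<union> {i, j}) in
        Determinant.det (submatrix K Qc Qc) * (K $$ (i, j)) -
        (submatrix K {i} Qc * cofactor_mat (submatrix K Qc Qc) * submatrix K Qc {j}) $$ (0, 0))"


section \<open>Crofton constants\<close>

definition euclid_diam :: "'v set \<Rightarrow> ('v \<Rightarrow> real) set \<Rightarrow> real" where
  "euclid_diam I U = (SUP (x, y)\<in>U \<times> U. euclid_dist I x y)"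

text \<open>
  The \<open>s\<close>-dimensional Hausdorff (outer) measure on \<open>\<real>\<^sup>I\<close>, normalised to be surface area. The empty
  set needs its own case in the gauge, because \<open>0 ^ 0 = 1\<close> would otherwise make it count when
  \<open>s = 0\<close>.
\<close>

definition hausdorff_gauge :: "'v set \<Rightarrow> nat \<Rightarrow> ('v \<Rightarrow> real) set \<Rightarrow> ennreal" where
  "hausdorff_gauge I s U =
     (if U = {} then 0 else ennreal (unit_ball_vol (real s) * (euclid_diam I U / 2) ^ s))"

definition hausdorff_measure :: "'v set \<Rightarrow> nat \<Rightarrow> ('v \<Rightarrow> real) set \<Rightarrow> ennreal" where
  "hausdorff_measure I s A =
     (SUP \<delta>\<in>{0<..}.
        INF U\<in>{U :: nat \<Rightarrow> ('v \<Rightarrow> real) set.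
                A \<subseteq> (\<Union>n. U n) \<and>
                (\<forall>n. U n \<subseteq> I \<rightarrow>\<^sub>E UNIV \<and> (\<forall>x\<in>U n. \<forall>y\<in>U n. euclid_dist I x y \<le> \<delta>))}.
          suminf (\<lambda>n. hausdorff_gauge I s (U n)))"

definition unit_ball :: "nat \<Rightarrow> (nat \<Rightarrow> real) set" where
  "unit_ball m = {x \<in> {..<m} \<rightarrow>\<^sub>E UNIV. euclid_dist {..<m} x (\<lambda>_. 0) \<le> 1}"

text \<open>
  For \<open>m = 0\<close> there are no polynomials of positive degree, so the surface area bound is vacuous
  and the truncated subtraction \<open>m - 1\<close> is harmless.
\<close>

definition crofton_constant :: "nat \<Rightarrow> real \<Rightarrow> bool" where
  "crofton_constant m C \<longleftrightarrow>
     C > 0 \<and>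
     (\<forall>f :: nat mpoly_real. mvars f \<subseteq> {..<m} \<longrightarrow> total_degree f \<ge> 1 \<longrightarrow>
        hausdorff_measure {..<m} (m - 1) {x \<in> unit_ball m. meval f x = 0}
          \<le> ennreal (C * real (total_degree f))) \<and>
     (\<forall>d. real ((m + d) choose d) - 1 \<le> C * real d ^ m)"

end

theory Submission
  imports Defs "HOL-Computational_Algebra.Fundamental_Theorem_Algebra"
begin

text \<open>
  If \<open>K\<^sub>S\<close> is the precision matrix with the rows and columns in \<open>S\<close> removed, then the conditional
  covariance is the \<open>(i, j)\<close> entry of its inverse, hence a quotient \<open>N / D\<close> of polynomials in the
  edge weights with \<open>D\<close> nowhere zero: the residuals of \<open>X\<^sub>i\<close> and \<open>X\<^sub>j\<close> are linear forms
  \<open>\<langle>h, \<epsilon>\<rangle>\<close> along directions \<open>h\<close> in which \<open>X\<^sub>S\<close> is constant, and by the Cameron-Martin formula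
  such forms behave as if independent of \<open>X\<^sub>S\<close>.

  The inverse of \<open>K\<^sub>S\<close> is a signed sum over d-connecting walks in which every visit of \<open>S\<close> is a
  collider. All terms become positive if the weights into \<open>S\<close> are multiplied by the imaginary unit,
  so \<open>N\<close> is not the zero polynomial when \<open>i\<close> and \<open>j\<close> are d-connected.

  Since the exponent may be chosen small, no surface area bound is needed: the sublevel set
  \<open>{|N| \<le> \<lambda>}\<close> of a nonzero polynomial on the cube has volume \<open>O(\<lambda>\<^sup>k)\<close> for some \<open>k > 0\<close>, by
  Fubini and factorisation of univariate polynomials. The Lojasiewicz inequality is obtained by
  contradiction. A sequence of counterexamples is a point with coordinates in an ultrapower of the
  reals. It satisfies \<open>N = 0\<close> modulo the ideal of elements smaller than every power of an
  infinitesimal \<open>\<eta>\<close>, and lifting the residue field of the convex subring generated by \<open>1/\<eta>\<close> by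
  Hensel's lemma yields a nearby exact zero.
\<close>

section \<open>Polynomial functions and their sublevel sets\<close>

text \<open>The claim leaves \<open>c\<close> and \<open>k\<close> to be chosen, and both
  inequalities become weaker when \<open>c\<close> grows and, for a base in [0, 1], when
  \<open>k\<close> shrinks. So one pair can serve all triples, and the maximum and minimum over the
  triples are those of constant families. The order of choice matters: \<open>k\<close> is fixed by
  the worst of the volume and Lojasiewicz exponents, and only then is \<open>c\<close> enlarged to
  absorb kappa^k, the power of 2, \<open>C\<close> and the number of triples. This requires that the
  degree sum cannot vanish unless M is empty: a d-connected pair yields an edge s -> t, and
  conditioning on all other nodes gives the polynomial K_st, which contains the monomial a_st. The
  delicate point of the Lojasiewicz inequality is that the nearby zero must lie in the cube again.
  The lifted coordinates lie in a ring without nonzero negligible elements, and in such a ring a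
  closed inequality survives a negligible correction.\<close>

abbreviation lborel_on :: "'v set \<Rightarrow> ('v \<Rightarrow> real) measure" where
  "lborel_on I \<equiv> PiM I (\<lambda>_. lborel)"

lemma poly_sum_le:
  fixes p :: "real poly"
  assumes "degree p \<le> d"
  shows "poly p t = (\<Sum>i\<le>d. coeff p i * t ^ i)"
  unfolding poly_altdef using assms
  by (intro sum.mono_neutral_left) (auto simp: coeff_eq_0)

text \<open>Generating polynomial functions by closure rules makes boundedness, measurability and
  dependence on the coordinates in \<open>I\<close> alone plain inductions. Formal polynomials are
  needed only where a degree is read off.\<close>

inductive polyfun :: "'v set \<Rightarrow> (('v \<Rightarrow> real) \<Rightarrow> real) \<Rightarrow> bool" for I where
  polyfun_const: "polyfun I (\<lambda>_. c)"
| polyfun_var: "v \<in> I \<Longrightarrow> polyfun I (\<lambda>x. x v)"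
| polyfun_add: "polyfun I f \<Longrightarrow> polyfun I g \<Longrightarrow> polyfun I (\<lambda>x. f x + g x)"
| polyfun_mult: "polyfun I f \<Longrightarrow> polyfun I g \<Longrightarrow> polyfun I (\<lambda>x. f x * g x)"

lemma polyfun_minus: "polyfun I f \<Longrightarrow> polyfun I (\<lambda>x. - f x)"
  using polyfun_mult[OF polyfun_const[of I "-1"], of f] by simp

lemma polyfun_diff: "polyfun I f \<Longrightarrow> polyfun I g \<Longrightarrow> polyfun I (\<lambda>x. f x - g x)"
  using polyfun_add[OF _ polyfun_minus, of I f g] by simp

lemma polyfun_sum: "(\<And>i. i \<in> A \<Longrightarrow> polyfun I (f i)) \<Longrightarrow> polyfun I (\<lambda>x. \<Sum>i\<in>A. f i x)"
  by (induction A rule: infinite_finite_induct) (auto intro: polyfun_const polyfun_add)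

lemma polyfun_prod: "(\<And>i. i \<in> A \<Longrightarrow> polyfun I (f i)) \<Longrightarrow> polyfun I (\<lambda>x. \<Prod>i\<in>A. f i x)"
  by (induction A rule: infinite_finite_induct) (auto intro: polyfun_const polyfun_mult)

lemma polyfun_cong_on:
  assumes "polyfun I f" "\<And>v. v \<in> I \<Longrightarrow> x v = y v"
  shows "f x = f y"
  using assms by (induction) auto

lemma polyfun_cube_bounded:
  assumes "polyfun I f"
  shows "\<exists>B\<ge>1. \<forall>x. (\<forall>v\<in>I. \<bar>x v\<bar> \<le> 1) \<longrightarrow> \<bar>f x\<bar> \<le> B"
  using assms
proof induction
  case (polyfun_const c)
  show ?case by (intro exI[of _ "max 1 \<bar>c\<bar>"]) auto
next
  case (polyfun_var v)
  show ?case using polyfun_var by (intro exI[of _ 1]) auto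
next
  case (polyfun_add f g)
  then obtain B B' where B: "B \<ge> 1" "B' \<ge> 1"
    "\<And>x. \<forall>v\<in>I. \<bar>x v\<bar> \<le> 1 \<Longrightarrow> \<bar>f x\<bar> \<le> B"
    "\<And>x. \<forall>v\<in>I. \<bar>x v\<bar> \<le> 1 \<Longrightarrow> \<bar>g x\<bar> \<le> B'" by blast
  have "\<bar>f x + g x\<bar> \<le> B + B'" if "\<forall>v\<in>I. \<bar>x v\<bar> \<le> 1" for x
    using B(3)[OF that] B(4)[OF that] by linarith
  then show ?case using B by (intro exI[of _ "B + B'"]) auto
next
  case (polyfun_mult f g)
  then obtain B B' where B: "B \<ge> 1" "B' \<ge> 1"
    "\<And>x. \<forall>v\<in>I. \<bar>x v\<bar> \<le> 1 \<Longrightarrow> \<bar>f x\<bar> \<le> B"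
    "\<And>x. \<forall>v\<in>I. \<bar>x v\<bar> \<le> 1 \<Longrightarrow> \<bar>g x\<bar> \<le> B'" by blast
  have "\<bar>f x * g x\<bar> \<le> B * B'" if "\<forall>v\<in>I. \<bar>x v\<bar> \<le> 1" for x
    using B(3)[OF that] B(4)[OF that] B(1,2) by (auto simp: abs_mult intro!: mult_mono)
  moreover have "B * B' \<ge> 1" using B(1,2) mult_mono[of 1 B 1 B'] by simp
  ultimately show ?case by blast
qed

lemma polyfun_measurable:
  assumes "polyfun I f"
  shows "f \<in> borel_measurable (lborel_on I)"
  using assms
proof induction
  case (polyfun_var v)
  have "(\<lambda>x. x v) \<in> measurable (lborel_on I) lborel"
    by (rule measurable_component_singleton[OF polyfun_var])
  then show ?case by simp
qed auto

text \<open>A coefficient family is packaged as a real polynomial depending on the other variables,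
  so that products are products of polynomials.\<close>

lemma polyfun_insert_poly:
  assumes "polyfun (insert v I) f"
  shows "\<exists>P :: ('v \<Rightarrow> real) \<Rightarrow> real poly.
    (\<forall>i. polyfun I (\<lambda>x. coeff (P x) i)) \<and> (\<exists>d. \<forall>x. degree (P x) \<le> d) \<and>
    (\<forall>x. f x = poly (P x) (x v))"
  using assms
proof induction
  case (polyfun_const c)
  show ?case
    by (rule exI[of _ "\<lambda>_. [:c:]"]) (auto intro: polyfun.polyfun_const)
next
  case (polyfun_var w)
  show ?case
  proof (cases "w \<in> I")
    case True
    have "polyfun I (\<lambda>x. coeff [:x w:] i)" for i
      using True by (cases i) (auto intro: polyfun.intros)
    then show ?thesis by (intro exI[of _ "\<lambda>x. [:x w:]"]) auto
  next
    case False
    then have "w = v" using polyfun_var by auto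
    then show ?thesis by (intro exI[of _ "\<lambda>x. [:0, 1:]"]) (auto intro: polyfun.polyfun_const)
  qed
next
  case (polyfun_add f g)
  then obtain P Q d e where
    P: "\<And>i. polyfun I (\<lambda>x. coeff (P x) i)" "\<And>x. degree (P x) \<le> d" "\<And>x. f x = poly (P x) (x v)" and
    Q: "\<And>i. polyfun I (\<lambda>x. coeff (Q x) i)" "\<And>x. degree (Q x) \<le> e" "\<And>x. g x = poly (Q x) (x v)"
    by metis
  have "degree (P x + Q x) \<le> max d e" for x
    using P(2)[of x] Q(2)[of x] by (meson degree_add_le max.cobounded1 max.cobounded2 order_trans)
  then show ?case using P Q
    by (intro exI[of _ "\<lambda>x. P x + Q x"]) (auto intro: polyfun.polyfun_add)
next
  case (polyfun_mult f g)
  then obtain P Q d e where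
    P: "\<And>i. polyfun I (\<lambda>x. coeff (P x) i)" "\<And>x. degree (P x) \<le> d" "\<And>x. f x = poly (P x) (x v)" and
    Q: "\<And>i. polyfun I (\<lambda>x. coeff (Q x) i)" "\<And>x. degree (Q x) \<le> e" "\<And>x. g x = poly (Q x) (x v)"
    by metis
  have "degree (P x * Q x) \<le> d + e" for x
    using P(2)[of x] Q(2)[of x] degree_mult_le[of "P x" "Q x"] by linarith
  then show ?case using P Q
    by (intro exI[of _ "\<lambda>x. P x * Q x"])
       (auto simp: coeff_mult intro!: polyfun_sum polyfun.polyfun_mult)
qed

section \<open>Sublevel sets of polynomials in one and several variables\<close>

lemma prod_dist_greater:
  fixes t :: complex
  assumes "\<forall>z\<in>set zs. r < cmod (t - z)" "0 \<le> r" "zs \<noteq> []"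
  shows "r ^ length zs < (\<Prod>z\<leftarrow>zs. cmod (t - z))"
  using assms
proof (induction zs)
  case (Cons z zs)
  show ?case
  proof (cases "zs = []")
    case False
    then have "r ^ length zs < (\<Prod>z\<leftarrow>zs. cmod (t - z))" using Cons by auto
    then show ?thesis using Cons.prems by (auto intro!: mult_strict_mono' )
  qed (use Cons in auto)
qed simp

text \<open>Factor over the complex numbers. If t has distance more than r from every root, then |q
  t| exceeds |lead| * r^d, which is \<delta> for the r chosen here. So the sublevel set is covered
  by at most d intervals of length 2r centred at the real parts of the roots.\<close>

lemma sublevel_real_poly:
  fixes q :: "real poly"
  assumes "0 < \<delta>" "\<delta> < \<bar>lead_coeff q\<bar>"
  shows "emeasure lborel {t. \<bar>poly q t\<bar> \<le> \<delta>}
    \<le> ennreal (2 * degree q * (\<delta> / \<bar>lead_coeff q\<bar>) powr (1 / degree q))"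
proof -
  define c where "c = \<bar>lead_coeff q\<bar>"
  define d where "d = degree q"
  define r where "r = (\<delta> / c) powr (1 / d)"
  have c: "c > 0" "\<delta> < c" using assms by (auto simp: c_def)
  define Q where "Q = map_poly complex_of_real q"
  have degQ: "degree Q = d" unfolding Q_def d_def by (simp add: degree_map_poly)
  have Q0: "Q \<noteq> 0" using c assms unfolding Q_def c_def
    by (metis degree_0 coeff_map_poly of_real_0 of_real_eq_0_iff coeff_0 abs_zero less_irrefl)
  obtain A where A: "size A = degree Q" "Q = Polynomial.smult (lead_coeff Q) (\<Prod>x\<in>#A. [:-x, 1:])"
    using alg_closed_imp_factorization[OF Q0] by blast
  obtain zs where zs: "mset zs = A" using ex_mset by blast
  have len: "length zs = d" using A(1) zs degQ by (metis size_mset)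
  have lc: "cmod (lead_coeff Q) = c"
    unfolding degQ unfolding c_def Q_def d_def by (simp add: coeff_map_poly)
  have ev: "\<bar>poly q t\<bar> = c * (\<Prod>z\<leftarrow>zs. cmod (complex_of_real t - z))" for t
  proof -
    have "complex_of_real (poly q t) = poly Q (of_real t)"
      unfolding Q_def by (simp add: poly_altdef degree_map_poly coeff_map_poly)
    also have "\<dots> = lead_coeff Q * poly (\<Prod>x\<in>#A. [:-x, 1:]) (of_real t)"
      by (subst A(2)) simp
    also have "poly (\<Prod>x\<in>#A. [:-x, 1:]) (of_real t) = (\<Prod>z\<leftarrow>zs. complex_of_real t - z)"
      unfolding zs[symmetric] by (induction zs) (auto simp: algebra_simps)
    finally have "cmod (complex_of_real (poly q t)) = c * cmod (\<Prod>z\<leftarrow>zs. complex_of_real t - z)"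
      by (simp add: norm_mult lc)
    also have "cmod (\<Prod>z\<leftarrow>zs. complex_of_real t - z) = (\<Prod>z\<leftarrow>zs. cmod (complex_of_real t - z))"
      by (induction zs) (auto simp: norm_mult)
    finally show ?thesis by simp
  qed
  have r0: "r \<ge> 0" by (simp add: r_def)
  have sub: "{t. \<bar>poly q t\<bar> \<le> \<delta>} \<subseteq> (\<Union>z\<in>set zs. {Re z - r..Re z + r})"
  proof
    fix t assume "t \<in> {t. \<bar>poly q t\<bar> \<le> \<delta>}"
    then have t: "c * (\<Prod>z\<leftarrow>zs. cmod (complex_of_real t - z)) \<le> \<delta>" using ev by simp
    \<comment> \<open>This is where \<delta> < |lead| enters: a constant polynomial has an empty
      sublevel set, so t can exist only in positive degree.\<close>
    have "zs \<noteq> []" using t c by auto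
    then have d0: "d > 0" using len by auto
    have "\<exists>z\<in>set zs. cmod (complex_of_real t - z) \<le> r"
    proof (rule ccontr)
      assume "\<not> ?thesis"
      then have "r ^ d < (\<Prod>z\<leftarrow>zs. cmod (complex_of_real t - z))"
        using prod_dist_greater[of zs r "complex_of_real t"] r0 \<open>zs \<noteq> []\<close> len by force
      moreover have "r ^ d = \<delta> / c"
        unfolding r_def using d0 c assms by (simp add: powr_power)
      ultimately show False using t c by (simp add: field_simps)
    qed
    then obtain z where z: "z \<in> set zs" "cmod (complex_of_real t - z) \<le> r" by blast
    have "\<bar>t - Re z\<bar> \<le> r"
      using abs_Re_le_cmod[of "complex_of_real t - z"] z(2) by simp
    then show "t \<in> (\<Union>z\<in>set zs. {Re z - r..Re z + r})" using z(1) by force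
  qed
  have "emeasure lborel {t. \<bar>poly q t\<bar> \<le> \<delta>} \<le> emeasure lborel (\<Union>z\<in>set zs. {Re z - r..Re z + r})"
    by (intro emeasure_mono sub) auto
  also have "\<dots> \<le> (\<Sum>z\<in>set zs. emeasure lborel {Re z - r..Re z + r})"
    by (intro emeasure_subadditive_finite) auto
  also have "\<dots> = of_nat (card (set zs)) * ennreal (2 * r)"
    using r0 by simp
  also have "\<dots> \<le> of_nat d * ennreal (2 * r)"
    using card_length[of zs] len by (intro mult_right_mono) (auto intro: of_nat_mono)
  also have "\<dots> = ennreal (2 * d * r)"
    using r0 by (simp add: ennreal_of_nat_eq_real_of_nat ennreal_mult'[symmetric] mult_ac)
  finally show ?thesis by (simp add: r_def d_def c_def)
qed

lemma cube_in_sets: "finite I \<Longrightarrow> I \<rightarrow>\<^sub>E {-1..1} \<in> sets (lborel_on I)"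
  by (rule sets_PiM_I_finite) auto

lemma cube_Collect_in_sets:
  fixes f g :: "('v \<Rightarrow> real) \<Rightarrow> real"
  assumes "finite I" and [measurable]: "f \<in> borel_measurable (lborel_on I)" "g \<in> borel_measurable (lborel_on I)"
  shows "{x \<in> I \<rightarrow>\<^sub>E {-1..1}. f x \<le> g x} \<in> sets (lborel_on I)"
proof -
  have "{x \<in> I \<rightarrow>\<^sub>E {-1..1}. f x \<le> g x} = (I \<rightarrow>\<^sub>E {-1..1}) \<inter> {x \<in> space (lborel_on I). f x \<le> g x}"
    by (auto simp: space_PiM PiE_def)
  then show ?thesis using cube_in_sets[OF assms(1)] by simp
qed

text \<open>View f as a polynomial in the new variable with top coefficient g. Where |g| \<le> sqrt
  \<delta>, the induction hypothesis for g bounds the base and each fibre has length at most 2.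
  Elsewhere the univariate bound applies with \<delta> / |g| \<le> sqrt \<delta>. The threshold sqrt
  \<delta> leaves a power of \<delta> in both cases.\<close>

lemma polyfun_sublevel:
  fixes I :: "'v set"
  assumes "finite I" "polyfun I f" "f x0 \<noteq> 0"
  shows "\<exists>C k. C > 0 \<and> k > 0 \<and> (\<forall>\<delta>. 0 < \<delta> \<and> \<delta> \<le> 1 \<longrightarrow>
    emeasure (lborel_on I) {x \<in> I \<rightarrow>\<^sub>E {-1..1}. \<bar>f x\<bar> \<le> \<delta>} \<le> ennreal (C * \<delta> powr k))"
  using assms
proof (induction I arbitrary: f x0 rule: finite_induct)
  case empty
  define c where "c = \<bar>f x0\<bar>"
  have c: "c > 0" using empty by (simp add: c_def)
  have f: "\<bar>f x\<bar> = c" for x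
    unfolding c_def by (subst polyfun_cong_on[OF empty(1), of x x0]) auto
  have "emeasure (lborel_on {}) {x \<in> {} \<rightarrow>\<^sub>E {-1..1}. \<bar>f x\<bar> \<le> \<delta>}
      \<le> ennreal (1 / c * \<delta> powr 1)" if "0 < \<delta>" for \<delta>
  proof (cases "\<delta> < c")
    case False
    have "{x \<in> ({} :: 'v set) \<rightarrow>\<^sub>E {-1..1}. \<bar>f x\<bar> \<le> \<delta>} \<subseteq> {\<lambda>x. undefined}" by auto
    then have "emeasure (lborel_on {}) {x \<in> {} \<rightarrow>\<^sub>E {-1..1}. \<bar>f x\<bar> \<le> \<delta>}
        \<le> emeasure (lborel_on ({} :: 'v set)) {\<lambda>x. undefined}"
      by (intro emeasure_mono) (auto simp: PiM_empty)
    also have "\<dots> = 1" by (rule emeasure_PiM_empty)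
    also have "\<dots> \<le> ennreal (1 / c * \<delta> powr 1)"
      using False c that by (auto simp: ennreal_ge_1 field_simps simp flip: ennreal_1 intro!: ennreal_leI)
    finally show ?thesis .
  qed (simp add: f not_le)
  then show ?case using c by (intro exI[of _ "1 / c"] exI[of _ 1]) auto
next
  case (insert v I)
  interpret product_sigma_finite "\<lambda>_ :: 'v. lborel :: real measure" by standard
  from polyfun_insert_poly[OF insert.prems(1)] obtain P d0 where
    P: "\<And>i. polyfun I (\<lambda>x. coeff (P x) i)" "\<And>x. degree (P x) \<le> d0" "\<And>x. f x = poly (P x) (x v)"
    by blast
  \<comment> \<open>The degree of \<open>P x\<close> varies with x. The largest index whose
    coefficient is not identically zero gives \<open>g\<close>; wherever \<open>g\<close> does not
    vanish, the degree is exactly that index.\<close>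
  define D where "D = {i. \<exists>x. coeff (P x) i \<noteq> 0}"
  have fin: "finite D"
  proof (rule finite_subset)
    show "D \<subseteq> {..d0}"
      unfolding D_def using P(2) le_degree order_trans by blast
  qed simp
  have "P x0 \<noteq> 0" using insert.prems P(3) by (metis poly_0)
  then have "degree (P x0) \<in> D" unfolding D_def using leading_coeff_neq_0 by blast
  then have ne: "D \<noteq> {}" by auto
  define d where "d = Max D"
  have dD: "d \<in> D" using fin ne by (simp add: d_def)
  define g where "g = (\<lambda>x. coeff (P x) d)"
  obtain x1 where x1: "g x1 \<noteq> 0" using dD by (auto simp: D_def g_def)
  have deg: "degree (P x) = d" if "g x \<noteq> 0" for x
  proof (rule antisym)
    have "P x \<noteq> 0" using that by (auto simp: g_def)
    then have "degree (P x) \<in> D" unfolding D_def using leading_coeff_neq_0 by blast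
    then show "degree (P x) \<le> d" using fin by (simp add: d_def)
    show "d \<le> degree (P x)" using that by (auto simp: g_def le_degree)
  qed
  have pg: "polyfun I g" unfolding g_def by (rule P(1))
  from insert.IH[OF pg x1] obtain C k where Ck: "C > 0 \<and> k > 0 \<and> (\<forall>\<delta>. 0 < \<delta> \<and> \<delta> \<le> 1 \<longrightarrow>
      emeasure (lborel_on I) {x \<in> I \<rightarrow>\<^sub>E {-1..1}. \<bar>g x\<bar> \<le> \<delta>} \<le> ennreal (C * \<delta> powr k))"
    by (elim exE)
  have C: "C > 0" "k > 0" using Ck by auto
  have CB: "emeasure (lborel_on I) {x \<in> I \<rightarrow>\<^sub>E {-1..1}. \<bar>g x\<bar> \<le> \<delta>} \<le> ennreal (C * \<delta> powr k)"
    if "0 < \<delta>" "\<delta> \<le> 1" for \<delta> using Ck that by blast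
  \<comment> \<open>The halves come from the threshold sqrt \<delta>. Writing d + 1 keeps the second
    exponent positive for d = 0 and below 1/(2d) otherwise.\<close>
  define k' where "k' = min (k / 2) (1 / (2 * (real d + 1)))"
  \<comment> \<open>Fibre length 2 over the set where g is small, plus 2d intervals' worth of radius
    over the whole cube, whose volume is 2^|I|.\<close>
  define C' where "C' = 2 * C + 2 ^ card I * (2 * real d)"
  have k': "k' > 0" using C by (simp add: k'_def)
  have C': "C' > 0" using C by (auto simp: C'_def intro!: add_pos_nonneg)
  have "emeasure (lborel_on (insert v I)) {x \<in> insert v I \<rightarrow>\<^sub>E {-1..1}. \<bar>f x\<bar> \<le> \<delta>}
      \<le> ennreal (C' * \<delta> powr k')" (is "emeasure ?M ?A \<le> _") if \<delta>: "0 < \<delta>" "\<delta> \<le> 1" for \<delta>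
  proof -
    define B where "B = {x \<in> I \<rightarrow>\<^sub>E {-1..1}. \<bar>g x\<bar> \<le> sqrt \<delta>}"
    define cI :: "('v \<Rightarrow> real) set" where "cI = I \<rightarrow>\<^sub>E {-1..1}"
    define R where "R = 2 * real d * \<delta> powr k'"
    have fm [measurable]: "f \<in> borel_measurable ?M" by (rule polyfun_measurable[OF insert.prems(1)])
    have gm [measurable]: "g \<in> borel_measurable (lborel_on I)" by (rule polyfun_measurable[OF pg])
    have Am: "?A \<in> sets ?M" by (rule cube_Collect_in_sets) (use insert.hyps in auto)
    have Bm: "B \<in> sets (lborel_on I)"
      unfolding B_def by (rule cube_Collect_in_sets) (use insert.hyps in auto)
    have cIm: "cI \<in> sets (lborel_on I)" unfolding cI_def using cube_in_sets insert.hyps by simp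
    have inner: "(\<integral>\<^sup>+y. indicator ?A (x(v := y)) \<partial>lborel) \<le> 2 * indicator B x + ennreal R * indicator cI x"
      if x: "x \<in> space (lborel_on I)" for x
    proof -
      have fx: "f (x(v := y)) = poly (P x) y" for y
      proof -
        have "P (x(v := y)) = P x"
          by (rule poly_eqI) (rule polyfun_cong_on[OF P(1)], use insert.hyps in auto)
        then show ?thesis using P(3)[of "x(v := y)"] by simp
      qed
      show ?thesis
      proof (cases "x \<in> cI")
        case False
        have "x(v := y) \<notin> ?A" for y
        proof
          assume "x(v := y) \<in> ?A"
          then have "\<forall>i\<in>I. x i \<in> {-1..1}" using insert.hyps by (auto simp: PiE_iff split: if_splits)
          then show False using False x by (auto simp: cI_def space_PiM PiE_iff)
        qed
        then show ?thesis by simp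
      next
        case xc: True
        show ?thesis
        proof (cases "\<bar>g x\<bar> \<le> sqrt \<delta>")
          case True
          then have "x \<in> B" using xc by (simp add: B_def cI_def)
          have "(\<integral>\<^sup>+y. indicator ?A (x(v := y)) \<partial>lborel) \<le> (\<integral>\<^sup>+y. indicator {-1..1} y \<partial>(lborel :: real measure))"
            by (intro nn_integral_mono) (auto simp: indicator_def PiE_iff split: if_splits)
          also have "\<dots> = 2" by simp
          finally show ?thesis using \<open>x \<in> B\<close> by (auto intro: order_trans)
        next
          case False
          then have gx: "sqrt \<delta> < \<bar>g x\<bar>" by simp
          then have "g x \<noteq> 0" using \<delta> by auto
          have dx: "degree (P x) = d" using deg \<open>g x \<noteq> 0\<close> by blast
          have "\<delta> \<le> sqrt \<delta>" using \<delta> by (intro real_le_rsqrt) (simp add: power2_eq_square mult_left_le)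
          then have dg: "\<delta> < \<bar>g x\<bar>" using gx by simp
          have "(\<integral>\<^sup>+y. indicator ?A (x(v := y)) \<partial>lborel) \<le> (\<integral>\<^sup>+y. indicator {t. \<bar>poly (P x) t\<bar> \<le> \<delta>} y \<partial>lborel)"
            by (intro nn_integral_mono) (auto simp: indicator_def fx split: if_splits)
          also have "\<dots> = emeasure lborel {t. \<bar>poly (P x) t\<bar> \<le> \<delta>}"
            by (rule nn_integral_indicator) (auto intro!: borel_closed closed_Collect_le continuous_intros)
          also have "\<dots> \<le> ennreal (2 * d * (\<delta> / \<bar>g x\<bar>) powr (1 / d))"
            using sublevel_real_poly[of \<delta> "P x", unfolded dx] \<delta> dg by (simp add: g_def)
          also have "\<dots> \<le> ennreal R"
          proof (rule ennreal_leI, cases "d = 0")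
            case False
            have "\<delta> / \<bar>g x\<bar> \<le> \<delta> / sqrt \<delta>" using gx \<delta> \<open>g x \<noteq> 0\<close> by (intro divide_left_mono mult_pos_pos) auto
            also have "\<dots> = \<delta> powr (1/2)" using \<delta> by (simp add: real_div_sqrt powr_half_sqrt)
            finally have "(\<delta> / \<bar>g x\<bar>) powr (1 / d) \<le> (\<delta> powr (1/2)) powr (1 / d)"
              using \<delta> by (intro powr_mono2) auto
            also have "\<dots> = \<delta> powr (1 / (2 * d))" by (simp add: powr_powr)
            also have "\<dots> \<le> \<delta> powr k'"
            proof (rule powr_mono')
              have "k' \<le> 1 / (2 * (real d + 1))" by (simp add: k'_def)
              also have "\<dots> \<le> 1 / (2 * d)" using False by (intro divide_left_mono) auto
              finally show "k' \<le> 1 / (2 * d)" by simp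
            qed (use \<delta> in auto)
            finally show "2 * d * (\<delta> / \<bar>g x\<bar>) powr (1 / d) \<le> R"
              unfolding R_def of_nat_mult of_nat_numeral by (rule mult_left_mono) simp
          qed (simp add: R_def)
          finally show ?thesis using xc by (auto simp: indicator_def intro: order_trans)
        qed
      qed
    qed
    have "emeasure ?M ?A = (\<integral>\<^sup>+x. indicator ?A x \<partial>?M)"
      using Am by simp
    also have "\<dots> = (\<integral>\<^sup>+x. \<integral>\<^sup>+y. indicator ?A (x(v := y)) \<partial>lborel \<partial>lborel_on I)"
      using Am insert.hyps by (intro product_nn_integral_insert) auto
    also have "\<dots> \<le> (\<integral>\<^sup>+x. 2 * indicator B x + ennreal R * indicator cI x \<partial>lborel_on I)"
      by (intro nn_integral_mono inner)
    also have "\<dots> = 2 * emeasure (lborel_on I) B + ennreal R * emeasure (lborel_on I) cI"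
      using Bm cIm by (subst nn_integral_add) (auto simp: nn_integral_cmult)
    also have "emeasure (lborel_on I) cI = ennreal (2 ^ card I)"
      unfolding cI_def using insert.hyps by (subst emeasure_PiM) (auto simp flip: ennreal_power)
    also have "2 * emeasure (lborel_on I) B + ennreal R * ennreal (2 ^ card I)
        \<le> 2 * ennreal (C * sqrt \<delta> powr k) + ennreal R * ennreal (2 ^ card I)"
      using CB[of "sqrt \<delta>"] \<delta> by (intro add_right_mono mult_left_mono) (auto simp: B_def)
    also have "\<dots> = ennreal (2 * (C * sqrt \<delta> powr k) + R * 2 ^ card I)"
    proof -
      have "2 * ennreal (C * sqrt \<delta> powr k) = ennreal (2 * (C * sqrt \<delta> powr k))"
        using C by (subst ennreal_mult) auto
      moreover have "ennreal R * ennreal (2 ^ card I) = ennreal (R * 2 ^ card I)"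
        by (subst ennreal_mult) (auto simp: R_def)
      ultimately show ?thesis using C by (subst ennreal_plus) (auto simp: R_def)
    qed
    also have "\<dots> \<le> ennreal (C' * \<delta> powr k')"
    proof (rule ennreal_leI)
      have "sqrt \<delta> powr k = \<delta> powr (k / 2)"
        using powr_half_sqrt[of \<delta>] \<delta> by (metis less_imp_le mult.left_neutral powr_powr times_divide_eq_left)
      also have "\<dots> \<le> \<delta> powr k'" using \<delta> by (intro powr_mono') (auto simp: k'_def)
      finally have "2 * (C * sqrt \<delta> powr k) \<le> 2 * C * \<delta> powr k'"
        using C by simp
      then show "2 * (C * sqrt \<delta> powr k) + R * 2 ^ card I \<le> C' * \<delta> powr k'"
        unfolding R_def C'_def by (simp add: algebra_simps)
    qed
    finally show ?thesis .
  qed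
  then show ?case using C' k' by blast
qed

section \<open>The Lojasiewicz inequality on the cube\<close>

text \<open>Zorn's lemma for proper filters below \<open>sequentially\<close>, ordered by
  refinement. A maximal one decides every P: if the negation of P is not eventual, adjoining P gives
  a proper finer filter, which by maximality is the same one.\<close>

lemma exists_ultrafilter:
  "\<exists>U :: nat filter. U \<noteq> bot \<and> U \<le> sequentially \<and>
     (\<forall>P. eventually P U \<or> eventually (\<lambda>n. \<not> P n) U)"
proof -
  define \<F> where "\<F> = {F :: nat filter. F \<noteq> bot \<and> F \<le> sequentially}"
  define r where "r = {(F, G). F \<in> \<F> \<and> G \<in> \<F> \<and> G \<le> F}"
  have fld: "Field r = \<F>" by (auto simp: r_def Field_def)
  have "\<exists>m\<in>Field r. \<forall>a\<in>Field r. (m, a) \<in> r \<longrightarrow> a = m"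
  proof (rule Zorns_po_lemma)
    show "Partial_order r"
      unfolding partial_order_on_def preorder_on_def refl_on_def trans_def antisym_def fld
      by (auto simp: r_def)
    fix C assume C: "C \<in> Chains r"
    then have CF: "C \<subseteq> \<F>" using Chains_subset[of r] fld by (auto simp: Chains_def r_def)
    show "\<exists>u\<in>Field r. \<forall>a\<in>C. (a, u) \<in> r"
    proof (cases "C = {}")
      case True
      have "sequentially \<in> \<F>" by (simp add: \<F>_def)
      then show ?thesis using True fld by auto
    next
      case False
      \<comment> \<open>An event eventual for the infimum of a chain is already eventual for one
        member, so the infimum stays proper.\<close>
      have "eventually P (Inf C) = (\<exists>b\<in>C. eventually P b)" for P
      proof (rule eventually_Inf_base[OF False])
        fix F G assume "F \<in> C" "G \<in> C"
        then have "F \<le> G \<or> G \<le> F" using C by (auto simp: Chains_def r_def)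
        then show "\<exists>x\<in>C. x \<le> inf F G" using \<open>F \<in> C\<close> \<open>G \<in> C\<close> by (auto intro: bexI[of _ F] bexI[of _ G])
      qed
      then have "Inf C \<noteq> bot"
        using CF unfolding trivial_limit_def \<F>_def by auto
      moreover have "Inf C \<le> sequentially"
        using False CF by (auto simp: \<F>_def intro: Inf_lower2)
      ultimately have "Inf C \<in> \<F>" by (simp add: \<F>_def)
      then show ?thesis using CF unfolding fld by (intro bexI[of _ "Inf C"]) (auto simp: r_def intro: Inf_lower)
    qed
  qed
  then obtain U where U: "U \<in> \<F>" "\<And>G. G \<in> \<F> \<Longrightarrow> G \<le> U \<Longrightarrow> G = U"
    unfolding fld by (auto simp: r_def)
  have "eventually P U \<or> eventually (\<lambda>n. \<not> P n) U" for P
  proof (rule disjCI)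
    assume np: "\<not> eventually (\<lambda>n. \<not> P n) U"
    define G where "G = inf U (principal {n. P n})"
    have evG: "eventually Q G \<longleftrightarrow> eventually (\<lambda>n. P n \<longrightarrow> Q n) U" for Q
      by (simp add: G_def eventually_inf_principal)
    have "G \<noteq> bot" using np evG by (simp add: trivial_limit_def)
    moreover have "G \<le> U" by (simp add: G_def)
    ultimately have "G = U" using U by (auto simp: \<F>_def)
    then show "eventually P U"
      using evG[of P] by simp
  qed
  then show ?thesis using U(1) by (auto simp: \<F>_def)
qed

section \<open>Exact roots near approximate simple roots\<close>

lemma power_add_remainder:
  fixes y s :: real
  assumes "\<bar>s\<bar> \<le> 1"
  shows "\<exists>E. (y + s) ^ i = y ^ i + of_nat i * y ^ (i - 1) * s + s\<^sup>2 * E \<and> \<bar>E\<bar> \<le> (2 * (\<bar>y\<bar> + 1)) ^ i"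
proof (induction i)
  case 0
  show ?case by (intro exI[of _ 0]) auto
next
  case (Suc i)
  then obtain E where E: "(y + s) ^ i = y ^ i + of_nat i * y ^ (i - 1) * s + s\<^sup>2 * E"
    "\<bar>E\<bar> \<le> (2 * (\<bar>y\<bar> + 1)) ^ i" by blast
  define Y where "Y = \<bar>y\<bar> + 1"
  have Y: "Y \<ge> 1" "\<bar>y\<bar> \<le> Y" "\<bar>y + s\<bar> \<le> Y" using assms by (auto simp: Y_def)
  define E' where "E' = of_nat i * y ^ (i - 1) + (y + s) * E"
  have "y * (of_nat i * y ^ (i - 1)) = of_nat i * y ^ i" by (cases i) auto
  then have "(y + s) ^ Suc i = y ^ Suc i + of_nat (Suc i) * y ^ i * s + s\<^sup>2 * E'"
    unfolding power_Suc E E'_def by (simp add: algebra_simps power2_eq_square)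
  moreover have "\<bar>E'\<bar> \<le> (2 * Y) ^ Suc i"
  proof -
    have "\<bar>of_nat i * y ^ (i - 1)\<bar> \<le> of_nat i * Y ^ (i - 1)"
      unfolding abs_mult power_abs using Y by (auto intro!: mult_left_mono power_mono)
    also have "\<dots> \<le> 2 ^ i * Y ^ i"
      using Y by (intro mult_mono power_increasing) (auto simp: of_nat_less_two_power less_imp_le)
    also have "\<dots> \<le> Y * (2 * Y) ^ i" using Y mult_right_mono[of 1 Y "2 ^ i * Y ^ i"] by (simp add: power_mult_distrib)
    finally have 1: "\<bar>of_nat i * y ^ (i - 1)\<bar> \<le> Y * (2 * Y) ^ i" .
    have 2: "\<bar>(y + s) * E\<bar> \<le> Y * (2 * Y) ^ i"
      unfolding abs_mult using Y E(2) by (intro mult_mono) (auto simp: Y_def)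
    show ?thesis using 1 2 unfolding E'_def power_Suc by linarith
  qed
  ultimately show ?case unfolding Y_def by auto
qed

text \<open>Newton's criterion over the reals, with the iteration replaced by the intermediate value
  theorem: within the stated radius the linear term outweighs the value at y together with the
  quadratic remainder, so q changes sign. The bound \<open>M\<close> is polynomial in |y| and the
  coefficients, hence moderate when these are, and \<open>e\<close> may be chosen uniformly along a
  sequence of polynomials.\<close>

lemma quantitative_root:
  fixes p :: "real poly" and y :: real and e :: nat
  defines "q \<equiv> poly p"
  defines "D \<equiv> poly (pderiv p) y"
  defines "M \<equiv> \<Sum>i\<le>e. \<bar>coeff p i\<bar> * (2 * (\<bar>y\<bar> + 1)) ^ i"
  assumes e: "degree p \<le> e"
    and D: "D \<noteq> 0" and h: "2 * \<bar>q y\<bar> \<le> \<bar>D\<bar>" and M: "4 * M * \<bar>q y\<bar> \<le> D\<^sup>2"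
  shows "\<exists>z. q z = 0 \<and> \<bar>z - y\<bar> \<le> 2 * \<bar>q y\<bar> / \<bar>D\<bar>"
proof -
  define b where "b = coeff p"
  have q_sum: "q t = (\<Sum>i\<le>e. b i * t ^ i)" for t
    unfolding q_def b_def by (rule poly_sum_le[OF e])
  have "((\<lambda>t. \<Sum>i\<le>e. b i * t ^ i) has_real_derivative (\<Sum>i\<le>e. b i * (of_nat i * y ^ (i - 1)))) (at y)"
    by (rule derivative_eq_intros refl | simp add: mult_ac)+
  moreover have "(poly p has_real_derivative D) (at y)" unfolding D_def by (rule poly_DERIV)
  moreover have "poly p = (\<lambda>t. \<Sum>i\<le>e. b i * t ^ i)" using q_sum by (auto simp: q_def)
  ultimately have D_sum: "D = (\<Sum>i\<le>e. b i * (of_nat i * y ^ (i - 1)))"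
    using DERIV_unique by metis
  \<comment> \<open>Twice the Newton step: the linear change w|D| is split evenly between cancelling
    |q y| = w|D|/2 and dominating the remainder, which is at most w|D|/2.\<close>
  define w where "w = 2 * \<bar>q y\<bar> / \<bar>D\<bar>"
  have w: "0 \<le> w" "w \<le> 1" using h D by (auto simp: w_def field_simps)
  have qy: "\<bar>q y\<bar> = w * \<bar>D\<bar> / 2" using D by (simp add: w_def)
  have Mw: "2 * M * w \<le> \<bar>D\<bar>"
  proof -
    have "2 * M * w * \<bar>D\<bar> \<le> \<bar>D\<bar> * \<bar>D\<bar>"
      using M D by (simp add: w_def power2_eq_square)
    then show ?thesis using D by (meson mult_right_le_imp_le zero_less_abs_iff)
  qed
  have exp: "\<bar>q (y + s) - q y - s * D\<bar> \<le> w\<^sup>2 * M" if s: "\<bar>s\<bar> \<le> w" for s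
  proof -
    have "\<forall>i. \<exists>E. (y + s) ^ i = y ^ i + of_nat i * y ^ (i - 1) * s + s\<^sup>2 * E \<and> \<bar>E\<bar> \<le> (2 * (\<bar>y\<bar> + 1)) ^ i"
      using power_add_remainder s w by auto
    then obtain E where E: "\<And>i. (y + s) ^ i = y ^ i + of_nat i * y ^ (i - 1) * s + s\<^sup>2 * E i"
      "\<And>i. \<bar>E i\<bar> \<le> (2 * (\<bar>y\<bar> + 1)) ^ i" by metis
    have "q (y + s) = q y + s * D + s\<^sup>2 * (\<Sum>i\<le>e. b i * E i)"
      unfolding q_sum D_sum E(1) by (simp add: sum.distrib sum_distrib_left algebra_simps)
    then have "\<bar>q (y + s) - q y - s * D\<bar> = s\<^sup>2 * \<bar>\<Sum>i\<le>e. b i * E i\<bar>" by (simp add: abs_mult)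
    also have "\<bar>\<Sum>i\<le>e. b i * E i\<bar> \<le> M"
      unfolding M_def b_def using E(2) by (intro order_trans[OF sum_abs] sum_mono) (simp add: abs_mult mult_left_mono)
    then have "s\<^sup>2 * \<bar>\<Sum>i\<le>e. b i * E i\<bar> \<le> w\<^sup>2 * M"
      using s by (intro mult_mono) (auto simp: abs_le_square_iff[symmetric])
    finally show ?thesis .
  qed
  have small: "w\<^sup>2 * M \<le> w * \<bar>D\<bar> / 2"
    using mult_left_mono[OF Mw w(1)] by (simp add: power2_eq_square algebra_simps)
  define \<sigma> where "\<sigma> = sgn D"
  have \<sigma>: "\<sigma> * D = \<bar>D\<bar>" "\<bar>\<sigma>\<bar> = 1" using D by (auto simp: \<sigma>_def sgn_if)
  have \<sigma>w: "\<sigma> * w * D = w * \<bar>D\<bar>" "\<bar>\<sigma> * w\<bar> \<le> w"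
    using \<sigma>(1) by (simp add: mult.commute mult.left_commute) (simp add: abs_mult \<sigma>(2) w(1))
  have up: "q (y + \<sigma> * w) \<ge> 0"
    using exp[OF \<sigma>w(2), unfolded \<sigma>w(1)] small qy by linarith
  have lo: "q (y - \<sigma> * w) \<le> 0"
    using exp[of "- (\<sigma> * w)"] \<sigma>w small qy by simp
  have cont: "continuous_on A q" for A unfolding q_sum by (intro continuous_intros)
  have "\<exists>z. \<bar>z - y\<bar> \<le> w \<and> q z = 0"
  proof (cases "\<sigma> \<ge> 0")
    case True
    then have "\<sigma> = 1" using \<sigma> by auto
    then obtain z where "y - w \<le> z" "z \<le> y + w" "q z = 0"
      using IVT'[of q "y - w" 0 "y + w"] up lo cont w by auto
    then show ?thesis by (intro exI[of _ z]) auto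
  next
    case False
    then have "\<sigma> = -1" using \<sigma> by auto
    then obtain z where "y - w \<le> z" "z \<le> y + w" "q z = 0"
      using IVT2'[of q "y + w" 0 "y - w"] up lo cont w by auto
    then show ?thesis by (intro exI[of _ z]) auto
  qed
  then show ?thesis by (auto simp: w_def)
qed

section \<open>Moderate and negligible sequences along an ultrafilter\<close>

locale ultra_scale =
  fixes U :: "nat filter" and \<eta> :: "nat \<Rightarrow> real"
  assumes U_ne: "U \<noteq> bot"
    and ultra: "eventually P U \<or> eventually (\<lambda>n. \<not> P n) U"
    and eta_pos: "\<And>n. 0 < \<eta> n"
    and eta_small: "\<And>c. 0 < c \<Longrightarrow> eventually (\<lambda>n. \<eta> n < c) U"
begin

definition negligible_seq :: "(nat \<Rightarrow> real) \<Rightarrow> bool" where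
  "negligible_seq f \<longleftrightarrow> (\<forall>N. eventually (\<lambda>n. \<bar>f n\<bar> \<le> \<eta> n ^ N) U)"

definition moderate_seq :: "(nat \<Rightarrow> real) \<Rightarrow> bool" where
  "moderate_seq f \<longleftrightarrow> (\<exists>N. eventually (\<lambda>n. \<bar>f n\<bar> * \<eta> n ^ N \<le> 1) U)"

lemma not_eventually_ultra: "\<not> eventually P U \<Longrightarrow> eventually (\<lambda>n. \<not> P n) U"
  by (rule disjE[OF ultra[of P]]) simp_all

lemma eventually_contr: "eventually P U \<Longrightarrow> eventually (\<lambda>n. \<not> P n) U \<Longrightarrow> False"
proof -
  assume "eventually P U" "eventually (\<lambda>n. \<not> P n) U"
  then have "eventually (\<lambda>n. False) U" by eventually_elim simp
  then show False using U_ne by (simp add: trivial_limit_def)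
qed

lemma negligible_cong:
  "negligible_seq f \<Longrightarrow> eventually (\<lambda>n. f n = g n) U \<Longrightarrow> negligible_seq g"
  unfolding negligible_seq_def
proof
  fix N
  assume "\<forall>N. eventually (\<lambda>n. \<bar>f n\<bar> \<le> \<eta> n ^ N) U" and eq: "eventually (\<lambda>n. f n = g n) U"
  then have "eventually (\<lambda>n. \<bar>f n\<bar> \<le> \<eta> n ^ N) U" by blast
  then show "eventually (\<lambda>n. \<bar>g n\<bar> \<le> \<eta> n ^ N) U" using eq by eventually_elim simp
qed

lemma negligible_add:
  assumes "negligible_seq f" "negligible_seq g"
  shows "negligible_seq (\<lambda>n. f n + g n)"
  unfolding negligible_seq_def
proof
  fix N
  have "eventually (\<lambda>n. \<bar>f n\<bar> \<le> \<eta> n ^ Suc N) U" "eventually (\<lambda>n. \<bar>g n\<bar> \<le> \<eta> n ^ Suc N) U"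
    using assms unfolding negligible_seq_def by blast+
  moreover have "eventually (\<lambda>n. \<eta> n < 1 / 2) U" using eta_small[of "1 / 2"] by simp
  ultimately show "eventually (\<lambda>n. \<bar>f n + g n\<bar> \<le> \<eta> n ^ N) U"
  proof eventually_elim
    case (elim n)
    have "\<eta> n ^ Suc N \<le> 1 / 2 * \<eta> n ^ N" using elim eta_pos[of n] by simp
    then show ?case using elim by linarith
  qed
qed

lemma moderate_mult_negligible:
  assumes "moderate_seq f" "negligible_seq g"
  shows "negligible_seq (\<lambda>n. f n * g n)"
  unfolding negligible_seq_def
proof
  fix N
  obtain M where "eventually (\<lambda>n. \<bar>f n\<bar> * \<eta> n ^ M \<le> 1) U"
    using assms unfolding moderate_seq_def by blast
  moreover have "eventually (\<lambda>n. \<bar>g n\<bar> \<le> \<eta> n ^ (M + N)) U"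
    using assms unfolding negligible_seq_def by blast
  ultimately show "eventually (\<lambda>n. \<bar>f n * g n\<bar> \<le> \<eta> n ^ N) U"
  proof eventually_elim
    case (elim n)
    have "\<bar>f n * g n\<bar> \<le> \<bar>f n\<bar> * \<eta> n ^ (M + N)"
      using elim(2) by (simp add: abs_mult mult_left_mono)
    also have "\<dots> = (\<bar>f n\<bar> * \<eta> n ^ M) * \<eta> n ^ N" by (simp add: power_add)
    also have "\<dots> \<le> 1 * \<eta> n ^ N" using elim(1) eta_pos[of n] by (intro mult_right_mono) auto
    finally show ?case by simp
  qed
qed

lemma moderate_add:
  assumes "moderate_seq f" "moderate_seq g"
  shows "moderate_seq (\<lambda>n. f n + g n)"
proof -
  obtain M N where "eventually (\<lambda>n. \<bar>f n\<bar> * \<eta> n ^ M \<le> 1) U" "eventually (\<lambda>n. \<bar>g n\<bar> * \<eta> n ^ N \<le> 1) U"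
    using assms unfolding moderate_seq_def by blast
  moreover have "eventually (\<lambda>n. \<eta> n < 1 / 2) U" using eta_small[of "1 / 2"] by simp
  ultimately have "eventually (\<lambda>n. \<bar>f n + g n\<bar> * \<eta> n ^ (M + N + 1) \<le> 1) U"
  proof eventually_elim
    case (elim n)
    have le1: "\<eta> n ^ k \<le> 1" for k using elim(3) eta_pos[of n] by (intro power_le_one) auto
    have "\<bar>f n\<bar> * \<eta> n ^ (M + N + 1) = (\<bar>f n\<bar> * \<eta> n ^ M) * \<eta> n ^ N * \<eta> n" by (simp add: power_add)
    also have "\<dots> \<le> 1 * 1 * (1 / 2)"
      using elim eta_pos[of n] le1 by (intro mult_mono) auto
    finally have 1: "\<bar>f n\<bar> * \<eta> n ^ (M + N + 1) \<le> 1 / 2" by simp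
    have "\<bar>g n\<bar> * \<eta> n ^ (M + N + 1) = (\<bar>g n\<bar> * \<eta> n ^ N) * \<eta> n ^ M * \<eta> n" by (simp add: power_add)
    also have "\<dots> \<le> 1 * 1 * (1 / 2)"
      using elim eta_pos[of n] le1 by (intro mult_mono) auto
    finally have 2: "\<bar>g n\<bar> * \<eta> n ^ (M + N + 1) \<le> 1 / 2" by simp
    have "\<bar>f n + g n\<bar> * \<eta> n ^ (M + N + 1) \<le> (\<bar>f n\<bar> + \<bar>g n\<bar>) * \<eta> n ^ (M + N + 1)"
      using eta_pos[of n] by (intro mult_right_mono) auto
    then show ?case using 1 2 by (simp only: distrib_right)
  qed
  then show ?thesis unfolding moderate_seq_def by blast
qed

lemma moderate_mult:
  assumes "moderate_seq f" "moderate_seq g"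
  shows "moderate_seq (\<lambda>n. f n * g n)"
proof -
  obtain M N where "eventually (\<lambda>n. \<bar>f n\<bar> * \<eta> n ^ M \<le> 1) U" "eventually (\<lambda>n. \<bar>g n\<bar> * \<eta> n ^ N \<le> 1) U"
    using assms unfolding moderate_seq_def by blast
  then have "eventually (\<lambda>n. \<bar>f n * g n\<bar> * \<eta> n ^ (M + N) \<le> 1) U"
  proof eventually_elim
    case (elim n)
    have "\<bar>f n * g n\<bar> * \<eta> n ^ (M + N) = (\<bar>f n\<bar> * \<eta> n ^ M) * (\<bar>g n\<bar> * \<eta> n ^ N)"
      by (simp add: power_add abs_mult)
    also have "\<dots> \<le> 1 * 1" using elim eta_pos[of n] by (intro mult_mono) auto
    finally show ?case by simp
  qed
  then show ?thesis unfolding moderate_seq_def by blast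
qed

lemma moderate_const: "moderate_seq (\<lambda>_. c)"
proof -
  have "eventually (\<lambda>n. \<eta> n < 1 / (\<bar>c\<bar> + 1)) U" by (rule eta_small) auto
  then have "eventually (\<lambda>n. \<bar>c\<bar> * \<eta> n ^ 1 \<le> 1) U"
  proof eventually_elim
    case (elim n)
    have "\<bar>c\<bar> * \<eta> n \<le> (\<bar>c\<bar> + 1) * (1 / (\<bar>c\<bar> + 1))"
      using elim eta_pos[of n] by (intro mult_mono) auto
    also have "\<dots> = 1" by simp
    finally show ?case by simp
  qed
  then show ?thesis unfolding moderate_seq_def by blast
qed

lemma negligible_imp_moderate: "negligible_seq f \<Longrightarrow> moderate_seq f"
  unfolding negligible_seq_def moderate_seq_def
  by (rule exI[of _ 0], drule spec[of _ 0]) simp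

lemma negligible_zero: "negligible_seq (\<lambda>_. 0)"
  unfolding negligible_seq_def using eta_pos by (simp add: less_imp_le)

lemma negligible_sum: "(\<And>i. i \<in> A \<Longrightarrow> negligible_seq (f i)) \<Longrightarrow> negligible_seq (\<lambda>n. \<Sum>i\<in>A. f i n)"
  by (induction A rule: infinite_finite_induct) (auto intro: negligible_add negligible_zero)

lemma moderate_sum: "(\<And>i. i \<in> A \<Longrightarrow> moderate_seq (f i)) \<Longrightarrow> moderate_seq (\<lambda>n. \<Sum>i\<in>A. f i n)"
  by (induction A rule: infinite_finite_induct) (auto intro: moderate_add moderate_const)

lemma moderate_power: "moderate_seq f \<Longrightarrow> moderate_seq (\<lambda>n. f n ^ i)"
  by (induction i) (auto intro: moderate_mult moderate_const)

lemma moderate_abs: "moderate_seq f \<Longrightarrow> moderate_seq (\<lambda>n. \<bar>f n\<bar>)"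
  by (simp add: moderate_seq_def)

text \<open>Along an ultrafilter the failure of a single bound is a reverse bound. So a
  non-negligible element has a moderate inverse, which is why moderate modulo negligible is a
  field.\<close>

lemma not_negligible_bound:
  assumes "\<not> negligible_seq f"
  obtains N where "eventually (\<lambda>n. \<eta> n ^ N < \<bar>f n\<bar>) U"
proof -
  obtain N where "\<not> eventually (\<lambda>n. \<bar>f n\<bar> \<le> \<eta> n ^ N) U"
    using assms unfolding negligible_seq_def by blast
  then show ?thesis using that[of N] not_eventually_ultra by (force simp: not_le)
qed

lemma negligible_not_bounded_below:
  assumes "negligible_seq f" "eventually (\<lambda>n. \<eta> n ^ N < \<bar>f n\<bar>) U"
  shows False
proof (rule eventually_contr)
  show "eventually (\<lambda>n. \<bar>f n\<bar> \<le> \<eta> n ^ N) U"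
    using assms(1) by (simp add: negligible_seq_def)
  show "eventually (\<lambda>n. \<not> \<bar>f n\<bar> \<le> \<eta> n ^ N) U"
    using assms(2) by (simp add: not_le)
qed

text \<open>Sequences represent elements of the ultrapower along \<open>U\<close>; a good ring is mapped injectively to
  the residue field \<open>moderate / negligible\<close>.\<close>

definition good_ring :: "(nat \<Rightarrow> real) set \<Rightarrow> bool" where
  "good_ring A \<longleftrightarrow> (\<forall>c. (\<lambda>_. c) \<in> A) \<and>
     (\<forall>f\<in>A. \<forall>g\<in>A. (\<lambda>n. f n + g n) \<in> A \<and> (\<lambda>n. f n * g n) \<in> A) \<and>
     (\<forall>f\<in>A. moderate_seq f \<and> (negligible_seq f \<longrightarrow> eventually (\<lambda>n. f n = 0) U))"

lemma good_ringD:
  assumes "good_ring A"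
  shows "(\<lambda>_. c) \<in> A"
    and "f \<in> A \<Longrightarrow> g \<in> A \<Longrightarrow> (\<lambda>n. f n + g n) \<in> A"
    and "f \<in> A \<Longrightarrow> g \<in> A \<Longrightarrow> (\<lambda>n. f n * g n) \<in> A"
    and "f \<in> A \<Longrightarrow> moderate_seq f"
    and "f \<in> A \<Longrightarrow> negligible_seq f \<Longrightarrow> eventually (\<lambda>n. f n = 0) U"
  using assms unfolding good_ring_def by blast+

lemma good_ring_diff:
  assumes "good_ring A" "f \<in> A" "g \<in> A"
  shows "(\<lambda>n. f n - g n) \<in> A"
  using good_ringD(2)[OF assms(1,2) good_ringD(3)[OF assms(1) good_ringD(1)[OF assms(1), of "-1"] assms(3)]]
  by simp

lemma good_ring_sum:
  assumes "good_ring A" "\<And>i. i \<in> J \<Longrightarrow> f i \<in> A"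
  shows "(\<lambda>n. \<Sum>i\<in>J. f i n) \<in> A"
  using assms(2)
  by (induction J rule: infinite_finite_induct) (auto intro: good_ringD[OF assms(1)])

lemma good_ring_const: "good_ring (range (\<lambda>c _. c))"
proof -
  have "eventually (\<lambda>n. c = 0) U" if "negligible_seq (\<lambda>_. c)" for c :: real
  proof (cases "c = 0")
    case False
    have "eventually (\<lambda>n. \<eta> n ^ 1 < \<bar>c\<bar>) U" using eta_small[of "\<bar>c\<bar>"] False by simp
    then show ?thesis using negligible_not_bounded_below that by blast
  qed simp
  then show ?thesis unfolding good_ring_def using moderate_const by auto
qed

text \<open>The degree of \<open>P n\<close> may vary with n, so \<open>d\<close> is only a uniform
  bound. The polynomial in the ultrapower has degree exactly \<open>d\<close> when
  \<open>coeff (P n) d\<close> does not vanish along U.\<close>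

definition pol_over :: "(nat \<Rightarrow> real) set \<Rightarrow> nat \<Rightarrow> (nat \<Rightarrow> real poly) \<Rightarrow> bool" where
  "pol_over A d P \<longleftrightarrow> (\<forall>i. (\<lambda>n. coeff (P n) i) \<in> A) \<and> (\<forall>n. degree (P n) \<le> d)"

lemma moderate_poly:
  assumes "good_ring A" "pol_over A d P" "moderate_seq y"
  shows "moderate_seq (\<lambda>n. poly (P n) (y n))"
proof -
  have "poly (P n) (y n) = (\<Sum>i\<le>d. coeff (P n) i * y n ^ i)" for n
    using assms(2) by (intro poly_sum_le) (simp add: pol_over_def)
  then show ?thesis using assms
    by (auto intro!: moderate_sum moderate_mult moderate_power intro: good_ringD(4)[OF assms(1)] simp: pol_over_def)
qed

lemma negligible_power_diff:
  assumes "moderate_seq y" "moderate_seq y'" "negligible_seq (\<lambda>n. y' n - y n)"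
  shows "negligible_seq (\<lambda>n. y' n ^ i - y n ^ i)"
proof (induction i)
  case (Suc i)
  have "negligible_seq (\<lambda>n. y' n * (y' n ^ i - y n ^ i) + y n ^ i * (y' n - y n))"
    using Suc assms by (intro negligible_add moderate_mult_negligible moderate_power)
  then show ?case by (simp add: algebra_simps)
qed (simp add: negligible_zero)

lemma negligible_poly_diff:
  assumes "good_ring A" "pol_over A d P" "moderate_seq y" "moderate_seq y'"
    "negligible_seq (\<lambda>n. y' n - y n)"
  shows "negligible_seq (\<lambda>n. poly (P n) (y' n) - poly (P n) (y n))"
proof -
  have P: "poly (P n) t = (\<Sum>i\<le>d. coeff (P n) i * t ^ i)" for n t
    using assms(2) by (intro poly_sum_le) (simp add: pol_over_def)
  have "negligible_seq (\<lambda>n. \<Sum>i\<le>d. coeff (P n) i * (y' n ^ i - y n ^ i))"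
    using assms by (intro negligible_sum moderate_mult_negligible negligible_power_diff)
      (auto intro: good_ringD(4)[OF assms(1)] simp: pol_over_def)
  then show ?thesis by (simp add: P sum_subtractf algebra_simps)
qed

section \<open>Simple extensions of good rings\<close>

definition adjoin :: "(nat \<Rightarrow> real) set \<Rightarrow> (nat \<Rightarrow> real) \<Rightarrow> (nat \<Rightarrow> real) set" where
  "adjoin A y = {f. \<exists>P d. pol_over A d P \<and> f = (\<lambda>n. poly (P n) (y n))}"

text \<open>The danger in adjoining y is a new element that is negligible but not zero. By
  \<open>red\<close>, any such value is accompanied by an exact relation of no larger degree, so
  division with remainder lowers the degree until only an element of \<open>A\<close> is left. As
  \<open>A\<close> is a ring and not a field, the division is a pseudo-division.\<close>

lemma good_ring_adjoin:
  assumes A: "good_ring A" and y: "moderate_seq y"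
    and red: "\<And>P d. pol_over A d P \<Longrightarrow> \<not> eventually (\<lambda>n. coeff (P n) d = 0) U \<Longrightarrow>
      negligible_seq (\<lambda>n. poly (P n) (y n)) \<Longrightarrow>
      \<exists>Q e. 1 \<le> e \<and> e \<le> d \<and> pol_over A e Q \<and> \<not> eventually (\<lambda>n. coeff (Q n) e = 0) U \<and>
        eventually (\<lambda>n. poly (Q n) (y n) = 0) U"
  shows "good_ring (adjoin A y)"
proof -
  note cl = good_ringD[OF A] good_ring_diff[OF A] good_ring_sum[OF A]
  have zero: "eventually (\<lambda>n. poly (P n) (y n) = 0) U"
    if "pol_over A d P" "negligible_seq (\<lambda>n. poly (P n) (y n))" for P d
    using that
  proof (induction d arbitrary: P)
    case 0
    then have "degree (P n) = 0" for n by (simp add: pol_over_def)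
    then have "poly (P n) (y n) = coeff (P n) 0" for n by (simp add: poly_altdef)
    then show ?case using 0 cl(5) by (auto simp: pol_over_def)
  next
    case (Suc d)
    show ?case
    proof (cases "eventually (\<lambda>n. coeff (P n) (Suc d) = 0) U")
      case True
      \<comment> \<open>The top coefficient vanishes along U but perhaps not for every n. Removing
        it for all n restores the uniform degree bound.\<close>
      define P' where "P' = (\<lambda>n. P n - monom (coeff (P n) (Suc d)) (Suc d))"
      have "pol_over A d P'"
      proof -
        have "(\<lambda>n. coeff (P' n) i) \<in> A" for i
          using Suc.prems(1) unfolding P'_def
          by (cases "i = Suc d") (auto simp: pol_over_def intro!: cl)
        moreover have "degree (P' n) \<le> d" for n
        proof (rule degree_le, intro allI impI)
          fix i assume i: "d < i"
          have "degree (P n) \<le> Suc d" using Suc.prems(1) by (simp add: pol_over_def)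
          then show "coeff (P' n) i = 0"
            using i by (cases "i = Suc d") (auto simp: P'_def coeff_eq_0)
        qed
        ultimately show ?thesis by (simp add: pol_over_def)
      qed
      have eq: "eventually (\<lambda>n. poly (P n) (y n) = poly (P' n) (y n)) U"
        using True by eventually_elim (simp add: P'_def)
      have "eventually (\<lambda>n. poly (P' n) (y n) = 0) U"
        by (rule Suc.IH[OF \<open>pol_over A d P'\<close>]) (rule negligible_cong[OF Suc.prems(2) eq])
      then show ?thesis using eq by eventually_elim simp
    next
      case False
      from red[OF Suc.prems(1) False Suc.prems(2)] obtain Q e where
        Q: "1 \<le> e" "e \<le> Suc d" "pol_over A e Q" "\<not> eventually (\<lambda>n. coeff (Q n) e = 0) U"
          "eventually (\<lambda>n. poly (Q n) (y n) = 0) U" by blast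
      \<comment> \<open>Pseudo-division: the top coefficients cancel, and since Q vanishes at y
        along U, the value of P is merely multiplied by the leading coefficient of Q, which is
        nonzero along U.\<close>
      define P' where "P' = (\<lambda>n. Polynomial.smult (coeff (Q n) e) (P n)
        - monom (coeff (P n) (Suc d)) (Suc d - e) * Q n)"
      have "pol_over A d P'"
      proof -
        have "(\<lambda>n. coeff (P' n) i) \<in> A" for i
          using Suc.prems(1) Q(3) unfolding P'_def
          by (cases "i < Suc d - e") (auto simp: pol_over_def coeff_monom_mult intro!: cl)
        moreover have "degree (P' n) \<le> d" for n
        proof (rule degree_le, intro allI impI)
          fix i assume i: "d < i"
          show "coeff (P' n) i = 0"
          proof (cases "i = Suc d")
            case True
            then show ?thesis using Q(1,2) by (simp add: P'_def coeff_monom_mult)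
          next
            case False
            then have "coeff (P n) i = 0" "coeff (Q n) (i - (Suc d - e)) = 0"
              using i Suc.prems(1) Q unfolding pol_over_def
              by (auto intro!: coeff_eq_0 intro: le_less_trans)
            then show ?thesis by (simp add: P'_def coeff_monom_mult)
          qed
        qed
        ultimately show ?thesis by (simp add: pol_over_def)
      qed
      have eq: "eventually (\<lambda>n. coeff (Q n) e * poly (P n) (y n) = poly (P' n) (y n)) U"
        using Q(5) by eventually_elim (simp add: P'_def)
      have "negligible_seq (\<lambda>n. coeff (Q n) e * poly (P n) (y n))"
        using Q(3) by (intro moderate_mult_negligible Suc.prems cl(4)) (auto simp: pol_over_def)
      then have "eventually (\<lambda>n. poly (P' n) (y n) = 0) U"
        by (intro Suc.IH[OF \<open>pol_over A d P'\<close>]) (rule negligible_cong[OF _ eq])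
      then show ?thesis using eq not_eventually_ultra[OF Q(4)] by eventually_elim simp
    qed
  qed
  have 1: "(\<lambda>_. c) \<in> adjoin A y" for c
    unfolding adjoin_def
    by (auto simp: pol_over_def coeff_pCons split: nat.split intro!: exI[of _ "\<lambda>_. [:c:]"] exI[of _ 0] cl)
  have 2: "(\<lambda>n. f n + g n) \<in> adjoin A y \<and> (\<lambda>n. f n * g n) \<in> adjoin A y"
    if fg: "f \<in> adjoin A y" "g \<in> adjoin A y" for f g
  proof -
    obtain P d where P: "pol_over A d P" "f = (\<lambda>n. poly (P n) (y n))"
      using fg(1) unfolding adjoin_def by blast
    obtain Q e where Q: "pol_over A e Q" "g = (\<lambda>n. poly (Q n) (y n))"
      using fg(2) unfolding adjoin_def by blast
    have "pol_over A (max d e) (\<lambda>n. P n + Q n)"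
      using P(1) Q(1) unfolding pol_over_def
      by (auto intro!: cl degree_add_le intro: max.coboundedI1 max.coboundedI2)
    moreover have "degree (P n * Q n) \<le> d + e" for n
      using degree_mult_le[of "P n" "Q n"] P(1) Q(1) unfolding pol_over_def
      by (meson add_mono order_trans)
    then have "pol_over A (d + e) (\<lambda>n. P n * Q n)"
      using P(1) Q(1) unfolding pol_over_def by (auto simp: coeff_mult intro!: cl)
    ultimately show ?thesis unfolding adjoin_def P(2) Q(2) by fastforce
  qed
  show ?thesis
    unfolding good_ring_def
    using 1 2 zero moderate_poly[OF A _ y] by (auto simp: adjoin_def)
qed

lemma adjoin_subset: "good_ring A \<Longrightarrow> A \<subseteq> adjoin A y"
  unfolding adjoin_def
proof
  fix f assume A: "good_ring A" and f: "f \<in> A"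
  have "pol_over A 0 (\<lambda>n. [:f n:])"
  proof -
    have "(\<lambda>n. coeff [:f n:] i) \<in> A" for i
      using f good_ringD(1)[OF A, of 0] by (cases i) auto
    then show ?thesis by (simp add: pol_over_def)
  qed
  then show "f \<in> {f. \<exists>P d. pol_over A d P \<and> f = (\<lambda>n. poly (P n) (y n))}" by force
qed

lemma adjoin_self: "good_ring A \<Longrightarrow> y \<in> adjoin A y"
proof -
  assume A: "good_ring A"
  have "pol_over A 1 (\<lambda>n. [:0, 1:])"
    unfolding pol_over_def using good_ringD(1)[OF A] by auto
  then show ?thesis unfolding adjoin_def by force
qed

text \<open>Hensel's lemma: a moderate sequence that is
  algebraic modulo negligible sequences is corrected to a root of its minimal polynomial, so that
  no new negligible elements appear in the extended ring.\<close>

lemma good_ring_extend: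
  assumes A: "good_ring A" and y: "moderate_seq y"
  shows "\<exists>B y'. good_ring B \<and> A \<subseteq> B \<and> y' \<in> B \<and> negligible_seq (\<lambda>n. y' n - y n)"
proof -
  define R where "R = (\<lambda>e. \<exists>Q. pol_over A e Q \<and> \<not> eventually (\<lambda>n. coeff (Q n) e = 0) U \<and>
    negligible_seq (\<lambda>n. poly (Q n) (y n)))"
  have "\<exists>y'. good_ring (adjoin A y') \<and> negligible_seq (\<lambda>n. y' n - y n)"
  proof (cases "\<exists>e. R e")
    case False
    \<comment> \<open>Transcendental case: no relation holds even modulo negligible sequences, so
      the reduction hypothesis is vacuous and y itself can be adjoined.\<close>
    then have "good_ring (adjoin A y)"
      by (intro good_ring_adjoin[OF A y]) (auto simp: R_def)
    then show ?thesis by (intro exI[of _ y]) (simp add: negligible_zero)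
  next
    case True
    define e where "e = (LEAST e. R e)"
    have Re: "R e" unfolding e_def using True by (metis LeastI_ex)
    have min: "e \<le> d" if "R d" for d unfolding e_def using that by (rule Least_le)
    obtain Q where Q: "pol_over A e Q" "\<not> eventually (\<lambda>n. coeff (Q n) e = 0) U"
      "negligible_seq (\<lambda>n. poly (Q n) (y n))" using Re unfolding R_def by blast
    have e1: "1 \<le> e"
    proof (rule ccontr)
      assume "\<not> 1 \<le> e"
      then have "e = 0" by simp
      then have "degree (Q n) = 0" for n using Q(1) by (simp add: pol_over_def)
      then have "poly (Q n) (y n) = coeff (Q n) 0" for n by (simp add: poly_altdef)
      then have "eventually (\<lambda>n. coeff (Q n) 0 = 0) U"
        using Q(1,3) good_ringD(5)[OF A] by (auto simp: pol_over_def)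
      then show False using Q(2) \<open>e = 0\<close> by simp
    qed
    define D where "D = (\<lambda>n. poly (pderiv (Q n)) (y n))"
    \<comment> \<open>The root is simple in the residue field: otherwise the derivative, whose
      coefficient at e - 1 is e times the coefficient of Q at e, would be a relation of smaller
      degree.\<close>
    have "\<not> negligible_seq D"
    proof
      assume "negligible_seq D"
      moreover have "pol_over A (e - 1) (\<lambda>n. pderiv (Q n))"
        using Q(1) good_ringD(3)[OF A good_ringD(1)[OF A]] unfolding pol_over_def
        by (auto simp: coeff_pderiv degree_pderiv diff_le_mono simp del: of_nat_Suc)
      moreover have "\<not> eventually (\<lambda>n. coeff (pderiv (Q n)) (e - 1) = 0) U"
        using Q(2) e1 by (simp add: coeff_pderiv)
      ultimately have "R (e - 1)" unfolding R_def D_def by blast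
      then show False using min e1 by fastforce
    qed
    then obtain N where N: "eventually (\<lambda>n. \<eta> n ^ N < \<bar>D n\<bar>) U" by (rule not_negligible_bound)
    define M where "M = (\<lambda>n. \<Sum>i\<le>e. \<bar>coeff (Q n) i\<bar> * (2 * (\<bar>y n\<bar> + 1)) ^ i)"
    have Mm: "moderate_seq M"
      unfolding M_def using Q(1) y good_ringD(4)[OF A]
      by (intro moderate_sum moderate_mult moderate_power moderate_add moderate_abs moderate_const)
         (auto simp: pol_over_def)
    have nM: "negligible_seq (\<lambda>n. 4 * M n * poly (Q n) (y n))"
      by (intro moderate_mult_negligible moderate_mult moderate_const Mm Q)
    have n2: "negligible_seq (\<lambda>n. 2 * poly (Q n) (y n))"
      by (intro moderate_mult_negligible moderate_const Q)
    \<comment> \<open>The value 0 is taken at indices without a nearby root; along U there are none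
      of these.\<close>
    define y' where "y' = (\<lambda>n. if \<exists>z. poly (Q n) z = 0 \<and> \<bar>z - y n\<bar> \<le> 2 * \<bar>poly (Q n) (y n)\<bar> / \<bar>D n\<bar>
      then SOME z. poly (Q n) z = 0 \<and> \<bar>z - y n\<bar> \<le> 2 * \<bar>poly (Q n) (y n)\<bar> / \<bar>D n\<bar> else 0)"
    have y'_ev: "eventually (\<lambda>n. poly (Q n) (y' n) = 0 \<and> \<bar>y' n - y n\<bar> \<le> 2 * \<bar>poly (Q n) (y n)\<bar> / \<bar>D n\<bar>) U"
      using N nM[unfolded negligible_seq_def, rule_format, of "N + N"]
        n2[unfolded negligible_seq_def, rule_format, of N]
    proof eventually_elim
      case (elim n)
      have "0 \<le> M n" unfolding M_def by (intro sum_nonneg) auto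
      have "\<exists>z. poly (Q n) z = 0 \<and> \<bar>z - y n\<bar> \<le> 2 * \<bar>poly (Q n) (y n)\<bar> / \<bar>D n\<bar>"
        unfolding D_def
      proof (rule quantitative_root[where e = e])
        show "degree (Q n) \<le> e" using Q(1) by (simp add: pol_over_def)
        have D0: "0 < \<eta> n ^ N" using eta_pos[of n] by simp
        then show "poly (pderiv (Q n)) (y n) \<noteq> 0" using elim(1) by (auto simp: D_def)
        show "2 * \<bar>poly (Q n) (y n)\<bar> \<le> \<bar>poly (pderiv (Q n)) (y n)\<bar>"
          using elim(1,3) by (simp add: D_def abs_mult)
        have "4 * M n * \<bar>poly (Q n) (y n)\<bar> \<le> \<eta> n ^ N * \<eta> n ^ N"
          using elim(2) \<open>0 \<le> M n\<close> by (simp add: abs_mult power_add)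
        also have "\<dots> \<le> \<bar>D n\<bar> * \<bar>D n\<bar>" using elim(1) D0 by (intro mult_mono) auto
        finally show "4 * (\<Sum>i\<le>e. \<bar>coeff (Q n) i\<bar> * (2 * (\<bar>y n\<bar> + 1)) ^ i) * \<bar>poly (Q n) (y n)\<bar>
            \<le> (poly (pderiv (Q n)) (y n))\<^sup>2"
          by (simp add: M_def D_def power2_eq_square)
      qed
      then show ?case unfolding y'_def by (simp only: if_True) (rule someI_ex)
    qed
    have y'n: "negligible_seq (\<lambda>n. y' n - y n)"
      unfolding negligible_seq_def
    proof
      fix K
      show "eventually (\<lambda>n. \<bar>y' n - y n\<bar> \<le> \<eta> n ^ K) U"
        using y'_ev N n2[unfolded negligible_seq_def, rule_format, of "K + N"]
      proof eventually_elim
        case (elim n)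
        have p: "0 < \<eta> n ^ N" using eta_pos[of n] by simp
        have "\<bar>y' n - y n\<bar> \<le> 2 * \<bar>poly (Q n) (y n)\<bar> / \<bar>D n\<bar>" using elim by simp
        also have "\<dots> \<le> \<eta> n ^ (K + N) / \<eta> n ^ N"
          using elim p eta_pos[of n] by (intro frac_le) (auto simp: abs_mult)
        also have "\<dots> = \<eta> n ^ K" using eta_pos[of n] by (simp add: power_add)
        finally show ?case .
      qed
    qed
    have y'm: "moderate_seq y'"
      using moderate_add[OF negligible_imp_moderate[OF y'n] y] by simp
    have "good_ring (adjoin A y')"
    proof (rule good_ring_adjoin[OF A y'm])
      fix P d
      assume P: "pol_over A d P" "\<not> eventually (\<lambda>n. coeff (P n) d = 0) U"
        "negligible_seq (\<lambda>n. poly (P n) (y' n))"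
      \<comment> \<open>A relation for y' modulo negligible sequences is also one for y, so its
        degree is at least the minimal e, and Q can serve as the exact relation for the
        reduction.\<close>
      have "negligible_seq (\<lambda>n. - 1 * (poly (P n) (y' n) - poly (P n) (y n)) + poly (P n) (y' n))"
        by (intro negligible_add P moderate_mult_negligible moderate_const
            negligible_poly_diff[OF A P(1) y y'm y'n])
      then have "R d" unfolding R_def using P by auto
      then have "e \<le> d" by (rule min)
      moreover have "eventually (\<lambda>n. poly (Q n) (y' n) = 0) U"
        using y'_ev by eventually_elim simp
      ultimately show "\<exists>Q e. 1 \<le> e \<and> e \<le> d \<and> pol_over A e Q \<and>
          \<not> eventually (\<lambda>n. coeff (Q n) e = 0) U \<and> eventually (\<lambda>n. poly (Q n) (y' n) = 0) U"
        using e1 Q by blast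
    qed
    then show ?thesis using y'n by blast
  qed
  then show ?thesis using adjoin_subset[OF A] adjoin_self[OF A] by blast
qed

section \<open>Points and inequalities in good rings\<close>

lemma good_ring_approx:
  fixes a :: "nat \<Rightarrow> 'v \<Rightarrow> real"
  assumes "finite I" "\<And>v. v \<in> I \<Longrightarrow> moderate_seq (\<lambda>n. a n v)"
  shows "\<exists>A a'. good_ring A \<and>
    (\<forall>v\<in>I. (\<lambda>n. a' n v) \<in> A \<and> negligible_seq (\<lambda>n. a' n v - a n v))"
  using assms
proof (induction I rule: finite_induct)
  case empty
  then show ?case using good_ring_const by blast
next
  case (insert w I)
  then obtain A a' where A: "good_ring A"
    "\<And>v. v \<in> I \<Longrightarrow> (\<lambda>n. a' n v) \<in> A \<and> negligible_seq (\<lambda>n. a' n v - a n v)" by auto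
  obtain B y' where B: "good_ring B" "A \<subseteq> B" "y' \<in> B" "negligible_seq (\<lambda>n. y' n - a n w)"
    using good_ring_extend[OF A(1), of "\<lambda>n. a n w"] insert.prems by auto
  define a'' where "a'' = (\<lambda>n v. if v = w then y' n else a' n v)"
  have "(\<lambda>n. a'' n v) = (if v = w then y' else (\<lambda>n. a' n v))" for v
    by (auto simp: a''_def)
  moreover have "(\<lambda>n. a'' n v - a n v) = (if v = w then (\<lambda>n. y' n - a n w) else (\<lambda>n. a' n v - a n v))" for v
    by (auto simp: a''_def)
  ultimately have "\<forall>v\<in>insert w I. (\<lambda>n. a'' n v) \<in> B \<and> negligible_seq (\<lambda>n. a'' n v - a n v)"
    using A B insert.hyps by (auto split: if_splits)
  then show ?case using B(1) by blast
qed

lemma good_ring_polyfun: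
  assumes "polyfun I f" "good_ring A" "\<And>v. v \<in> I \<Longrightarrow> (\<lambda>n. a n v) \<in> A"
  shows "(\<lambda>n. f (a n)) \<in> A"
  using assms by induction (auto intro: good_ringD)

lemma negligible_polyfun_diff:
  assumes "polyfun I f" "\<And>v. v \<in> I \<Longrightarrow> moderate_seq (\<lambda>n. a n v)"
    "\<And>v. v \<in> I \<Longrightarrow> negligible_seq (\<lambda>n. a' n v - a n v)"
  shows "moderate_seq (\<lambda>n. f (a n)) \<and> moderate_seq (\<lambda>n. f (a' n)) \<and>
    negligible_seq (\<lambda>n. f (a' n) - f (a n))"
  using assms
proof induction
  case (polyfun_const c)
  then show ?case by (simp add: moderate_const negligible_zero)
next
  case (polyfun_var v)
  then show ?case
    using moderate_add[OF negligible_imp_moderate, of "\<lambda>n. a' n v - a n v" "\<lambda>n. a n v"] by simp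
next
  case (polyfun_add f g)
  then show ?case
    using negligible_add[of "\<lambda>n. f (a' n) - f (a n)" "\<lambda>n. g (a' n) - g (a n)"]
    by (auto intro: moderate_add simp: algebra_simps)
next
  case (polyfun_mult f g)
  then have "negligible_seq (\<lambda>n. f (a' n) * (g (a' n) - g (a n)) + g (a n) * (f (a' n) - f (a n)))"
    by (intro negligible_add moderate_mult_negligible) auto
  then show ?case using polyfun_mult by (auto intro: moderate_mult simp: algebra_simps)
qed

text \<open>If y' exceeded c along U, then y' - c would be a nonzero element of the good ring, hence
  above some power of \<eta>. But y' - c \<le> y' - y, which is negligible. This keeps the corrected
  point inside the cube.\<close>

lemma good_ring_le:
  assumes A: "good_ring A" and y': "y' \<in> A" and n: "negligible_seq (\<lambda>n. y' n - y n)"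
    and y: "\<And>n. y n \<le> c"
  shows "eventually (\<lambda>n. y' n \<le> c) U"
proof (rule ccontr)
  assume "\<not> ?thesis"
  then have gt: "eventually (\<lambda>n. c < y' n) U" using not_eventually_ultra[of "\<lambda>n. y' n \<le> c"] by (simp add: not_le)
  have mem: "(\<lambda>n. y' n - c) \<in> A" by (intro good_ring_diff[OF A] y' good_ringD(1)[OF A])
  have "\<not> negligible_seq (\<lambda>n. y' n - c)"
  proof
    assume "negligible_seq (\<lambda>n. y' n - c)"
    then have "eventually (\<lambda>n. y' n - c = 0) U" using good_ringD(5)[OF A mem] by blast
    then show False using gt by (auto intro!: eventually_contr[OF gt] elim: eventually_mono)
  qed
  then obtain N where "eventually (\<lambda>n. \<eta> n ^ N < \<bar>y' n - c\<bar>) U" by (rule not_negligible_bound)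
  with gt have "eventually (\<lambda>n. \<eta> n ^ N < \<bar>y' n - y n\<bar>) U"
  proof eventually_elim
    case (elim n)
    then show ?case using y[of n] by linarith
  qed
  then show False using negligible_not_bounded_below n by blast
qed

end

text \<open>Constant and exponent are tied to a single integer m, so that the negation supplies one
  counterexample for each m and thus a sequence.\<close>

theorem lojasiewicz_cube:
  fixes I :: "'v set"
  assumes I: "finite I" and f: "polyfun I f"
    and z0: "z0 \<in> I \<rightarrow>\<^sub>E {-1..1}" "f z0 = 0"
  shows "\<exists>m::nat. 1 \<le> m \<and> (\<forall>x\<in>I \<rightarrow>\<^sub>E {-1..1}. \<exists>z\<in>I \<rightarrow>\<^sub>E {-1..1}. f z = 0 \<and>
    L2_set (\<lambda>v. x v - z v) I \<le> real m * \<bar>f x\<bar> powr (1 / real m))"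
proof (rule ccontr)
  assume contr: "\<not> ?thesis"
  define C where "C = I \<rightarrow>\<^sub>E {-1..1::real}"
  define B where "B m x z \<longleftrightarrow> L2_set (\<lambda>v. x v - z v) I \<le> real m * \<bar>f x\<bar> powr (1 / real m)"
    for m :: nat and x z
  have no_m: "\<not> (\<exists>m::nat. 1 \<le> m \<and> (\<forall>x\<in>C. \<exists>z\<in>C. f z = 0 \<and> B m x z))"
    unfolding C_def B_def by (rule contr)
  have "\<forall>n. \<exists>x. x \<in> C \<and> (\<forall>z\<in>C. f z = 0 \<longrightarrow> \<not> B (Suc n) x z)"
  proof
    fix n
    have "1 \<le> Suc n" by simp
    then show "\<exists>x. x \<in> C \<and> (\<forall>z\<in>C. f z = 0 \<longrightarrow> \<not> B (Suc n) x z)" using no_m by blast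
  qed
  from choice[OF this] obtain a where "\<forall>n. a n \<in> C \<and> (\<forall>z\<in>C. f z = 0 \<longrightarrow> \<not> B (Suc n) (a n) z)"
    by blast
  then have a: "a n \<in> I \<rightarrow>\<^sub>E {-1..1}"
    and far: "z \<in> I \<rightarrow>\<^sub>E {-1..1} \<Longrightarrow> f z = 0 \<Longrightarrow>
      real (Suc n) * \<bar>f (a n)\<bar> powr (1 / real (Suc n)) < L2_set (\<lambda>v. a n v - z v) I" for n z
    unfolding C_def B_def not_le by (simp_all del: PiE_iff)
  \<comment> \<open>With this scale |f (a n)| = \<eta>^(n+1), which is eventually below every fixed
    power of \<eta>, while every zero in the cube is farther than (n+1) * \<eta> from a n.\<close>
  define \<eta> where "\<eta> = (\<lambda>n. \<bar>f (a n)\<bar> powr (1 / real (Suc n)))"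
  have fa: "f (a n) \<noteq> 0" for n
    using far[OF a[of n], of n] by (auto simp: L2_set_def)
  have pos: "0 < \<eta> n" for n using fa[of n] by (simp add: \<eta>_def)
  have pow: "\<eta> n ^ Suc n = \<bar>f (a n)\<bar>" for n
    using fa[of n] unfolding \<eta>_def by (subst powr_power) (auto simp del: power_Suc of_nat_Suc)
  have bound: "\<bar>a n v\<bar> \<le> 1" if "v \<in> I" for n v using a[of n] that by (force simp: PiE_iff)
  \<comment> \<open>The given zero \<open>z0\<close> is within 2|I| of any point of the cube, so
    being a counterexample already forces \<eta> to tend to 0.\<close>
  have eta_le: "\<eta> n \<le> 2 * real (card I) / real (Suc n)" for n
  proof -
    have "real (Suc n) * \<eta> n < L2_set (\<lambda>v. a n v - z0 v) I" unfolding \<eta>_def by (rule far[OF z0])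
    also have "\<dots> \<le> (\<Sum>v\<in>I. \<bar>a n v - z0 v\<bar>)" by (rule L2_set_le_sum_abs)
    also have "\<dots> \<le> (\<Sum>v\<in>I. 2)"
    proof (rule sum_mono)
      fix v assume "v \<in> I"
      then have "\<bar>a n v\<bar> \<le> 1" "\<bar>z0 v\<bar> \<le> 1" using bound z0 by (force simp: PiE_iff)+
      then show "\<bar>a n v - z0 v\<bar> \<le> 2" by linarith
    qed
    also have "\<dots> = 2 * real (card I)" by simp
    finally show ?thesis by (simp add: field_simps)
  qed
  have "(\<lambda>n. 2 * real (card I) / real (Suc n)) \<longlonglongrightarrow> 0"
    using tendsto_mult_right_zero[OF LIMSEQ_inverse_real_of_nat, of "2 * real (card I)"]
    by (simp add: field_simps)
  then have small: "eventually (\<lambda>n. \<eta> n < c) sequentially" if "0 < c" for c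
    using order_tendstoD(2)[of _ 0 sequentially c] that eta_le
    by (smt (verit, best) eventually_mono)
  obtain U :: "nat filter" where U: "U \<noteq> bot" "U \<le> sequentially"
    "\<And>P. eventually P U \<or> eventually (\<lambda>n. \<not> P n) U"
    using exists_ultrafilter by blast
  have ev: "eventually P sequentially \<Longrightarrow> eventually P U" for P
    using U(2) by (simp add: le_filter_def)
  interpret ultra_scale U \<eta>
  proof
    show "U \<noteq> bot" by (rule U(1))
    show "eventually P U \<or> eventually (\<lambda>n. \<not> P n) U" for P by (rule U(3))
    show "0 < \<eta> n" for n by (rule pos)
    show "eventually (\<lambda>n. \<eta> n < c) U" if "0 < c" for c by (rule ev[OF small[OF that]])
  qed
  have am: "moderate_seq (\<lambda>n. a n v)" if "v \<in> I" for v
    unfolding moderate_seq_def using bound[OF that] by (intro exI[of _ 0]) simp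
  obtain A a' where A: "good_ring A"
    and a': "\<And>v. v \<in> I \<Longrightarrow> (\<lambda>n. a' n v) \<in> A"
      "\<And>v. v \<in> I \<Longrightarrow> negligible_seq (\<lambda>n. a' n v - a n v)"
    using good_ring_approx[OF I, of a] am by blast
  have nfa: "negligible_seq (\<lambda>n. f (a n))"
    unfolding negligible_seq_def
  proof
    fix N
    have "eventually (\<lambda>n. N \<le> n) U" by (rule ev) (rule eventually_ge_at_top)
    moreover have "eventually (\<lambda>n. \<eta> n < 1) U" using eta_small[of 1] by simp
    ultimately show "eventually (\<lambda>n. \<bar>f (a n)\<bar> \<le> \<eta> n ^ N) U"
    proof eventually_elim
      case (elim n)
      show ?case unfolding pow[symmetric]
        using elim pos[of n] by (intro power_decreasing) auto
    qed
  qed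
  have "negligible_seq (\<lambda>n. (f (a' n) - f (a n)) + f (a n))"
    using negligible_polyfun_diff[OF f am a'(2)] nfa by (intro negligible_add) auto
  then have nfa': "negligible_seq (\<lambda>n. f (a' n))" by simp
  have zero: "eventually (\<lambda>n. f (a' n) = 0) U"
    by (rule good_ringD(5)[OF A good_ring_polyfun[OF f A, of a'] nfa']) (rule a'(1))
  have "eventually (\<lambda>n. \<forall>v\<in>I. a' n v \<le> 1 \<and> -1 \<le> a' n v \<and> \<bar>a' n v - a n v\<bar> \<le> \<eta> n) U"
  proof (rule eventually_ball_finite[OF I], rule ballI)
    fix v assume v: "v \<in> I"
    have 1: "eventually (\<lambda>n. a' n v \<le> 1) U"
      by (rule good_ring_le[OF A a'(1)[OF v] a'(2)[OF v]]) (use bound[OF v] in \<open>auto simp: abs_le_iff\<close>)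
    have "eventually (\<lambda>n. - 1 * a' n v \<le> 1) U"
    proof (rule good_ring_le[OF A])
      show "(\<lambda>n. - 1 * a' n v) \<in> A" by (intro good_ringD(3)[OF A] good_ringD(1)[OF A] a'(1) v)
      have "negligible_seq (\<lambda>n. - 1 * (a' n v - a n v))"
        by (intro moderate_mult_negligible moderate_const a'(2) v)
      then show "negligible_seq (\<lambda>n. - 1 * a' n v - - 1 * a n v)" by (simp add: algebra_simps)
      show "- 1 * a n v \<le> 1" for n using bound[OF v, of n] by linarith
    qed
    moreover have "eventually (\<lambda>n. \<bar>a' n v - a n v\<bar> \<le> \<eta> n ^ 1) U"
      using a'(2)[OF v] unfolding negligible_seq_def by blast
    ultimately show "eventually (\<lambda>n. a' n v \<le> 1 \<and> -1 \<le> a' n v \<and> \<bar>a' n v - a n v\<bar> \<le> \<eta> n) U"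
      using 1 by eventually_elim auto
  qed
  \<comment> \<open>The corrected zero differs by at most \<eta> in each coordinate, hence by at
    most |I| * \<eta> in norm, which contradicts the distance (n+1) * \<eta> once n reaches
    |I|.\<close>
  moreover have "eventually (\<lambda>n. card I \<le> n) U" by (rule ev) (rule eventually_ge_at_top)
  ultimately have "eventually (\<lambda>n. False) U" using zero
  proof eventually_elim
    case (elim n)
    \<comment> \<open>The correction controls only the coordinates in I; restriction makes the point
      extensional, as membership in the cube demands.\<close>
    define z where "z = restrict (a' n) I"
    have "z \<in> I \<rightarrow>\<^sub>E {-1..1}" using elim by (auto simp: z_def)
    moreover have "f z = 0"
      using elim polyfun_cong_on[OF f, of z "a' n"] by (simp add: z_def)
    ultimately have "real (Suc n) * \<eta> n < L2_set (\<lambda>v. a n v - z v) I"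
      unfolding \<eta>_def by (rule far)
    also have "\<dots> \<le> (\<Sum>v\<in>I. \<bar>a n v - z v\<bar>)" by (rule L2_set_le_sum_abs)
    also have "\<dots> \<le> (\<Sum>v\<in>I. \<eta> n)"
      using elim by (intro sum_mono) (auto simp: z_def abs_minus_commute)
    also have "\<dots> \<le> real (Suc n) * \<eta> n"
      using elim pos[of n] by simp
    finally show ?case by simp
  qed
  then show False using U_ne by (simp add: trivial_limit_def)
qed

section \<open>Conditional covariances\<close>

abbreviation std_gauss :: "real measure" where
  "std_gauss \<equiv> density lborel (\<lambda>x. ennreal (std_normal_density x))"

lemma std_gauss_shift:
  assumes [measurable]: "F \<in> borel_measurable borel"
  shows "(\<integral>\<^sup>+y. F (y + c) \<partial>std_gauss) = (\<integral>\<^sup>+y. F y * ennreal (exp (c * y - c\<^sup>2 / 2)) \<partial>std_gauss)"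
proof -
  have eq: "std_normal_density (c + y) * exp (c * (c + y) - c\<^sup>2 / 2) = std_normal_density y" for y
  proof -
    have "- (c + y)\<^sup>2 / 2 + (c * (c + y) - c\<^sup>2 / 2) = - y\<^sup>2 / 2"
      by (simp add: power2_eq_square field_simps)
    then show ?thesis
      unfolding std_normal_density_def by (simp add: exp_add[symmetric] mult.assoc)
  qed
  have "(\<integral>\<^sup>+y. F y * ennreal (exp (c * y - c\<^sup>2 / 2)) \<partial>std_gauss)
      = (\<integral>\<^sup>+y. ennreal (std_normal_density y) * (F y * ennreal (exp (c * y - c\<^sup>2 / 2))) \<partial>lborel)"
    by (rule nn_integral_density) auto
  also have "\<dots> = (\<integral>\<^sup>+y. ennreal (std_normal_density (c + y)) *
      (F (c + y) * ennreal (exp (c * (c + y) - c\<^sup>2 / 2))) \<partial>lborel)"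
    by (subst nn_integral_real_affine[where c = 1 and t = c]) auto
  also have "\<dots> = (\<integral>\<^sup>+y. ennreal (std_normal_density y) * F (y + c) \<partial>lborel)"
  proof (rule nn_integral_cong)
    fix y
    have "ennreal (std_normal_density (c + y)) * (F (c + y) * ennreal (exp (c * (c + y) - c\<^sup>2 / 2)))
        = ennreal (std_normal_density (c + y) * exp (c * (c + y) - c\<^sup>2 / 2)) * F (c + y)"
      by (subst ennreal_mult) (auto simp: mult_ac)
    then show "ennreal (std_normal_density (c + y)) * (F (c + y) * ennreal (exp (c * (c + y) - c\<^sup>2 / 2)))
        = ennreal (std_normal_density y) * F (y + c)"
      by (simp only: eq add.commute)
  qed
  also have "\<dots> = (\<integral>\<^sup>+y. F (y + c) \<partial>std_gauss)"
    by (rule nn_integral_density[symmetric]) auto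
  finally show ?thesis by simp
qed

lemma prob_space_std_gauss: "prob_space std_gauss"
  using prob_space_normal_density[of 1 0] by simp

lemma measurable_std_gauss_coordinate:
  assumes "k \<in> I"
  shows "(\<lambda>x. x k) \<in> borel_measurable (PiM I (\<lambda>_. std_gauss))"
  using measurable_component_singleton[OF assms, of "\<lambda>_. std_gauss"] by simp

text \<open>Translations respect the product structure, so the formula follows coordinate by
  coordinate from the one-dimensional shift: integrate out the new coordinate and apply the
  induction hypothesis to the resulting function \<open>\<Phi>\<close>.\<close>

lemma cameron_martin:
  fixes I :: "'v set"
  assumes "finite I" "F \<in> borel_measurable (PiM I (\<lambda>_. std_gauss))"
  shows "(\<integral>\<^sup>+x. F (\<lambda>k\<in>I. x k + h k) \<partial>PiM I (\<lambda>_. std_gauss))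
    = (\<integral>\<^sup>+x. F x * ennreal (exp (\<Sum>k\<in>I. h k * x k - (h k)\<^sup>2 / 2)) \<partial>PiM I (\<lambda>_. std_gauss))"
  using assms
proof (induction I arbitrary: F rule: finite_induct)
  case empty
  show ?case by (simp add: PiM_empty nn_integral_count_space_finite)
next
  case (insert v I)
  interpret G: prob_space std_gauss by (rule prob_space_std_gauss)
  interpret product_sigma_finite "\<lambda>_ :: 'v. std_gauss" by standard
  note [measurable] = insert.prems
  let ?P = "PiM I (\<lambda>_. std_gauss)"
  let ?E = "\<lambda>y. ennreal (exp (h v * y - (h v)\<^sup>2 / 2))"
  have upd [measurable]: "(\<lambda>(x, y). x(v := y)) \<in> ?P \<Otimes>\<^sub>M std_gauss \<rightarrow>\<^sub>M PiM (insert v I) (\<lambda>_. std_gauss)"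
    by (rule measurable_add_dim)
  have Fm: "(\<lambda>(x, y). F (x(v := y))) \<in> borel_measurable (?P \<Otimes>\<^sub>M std_gauss)"
    using measurable_compose[OF upd insert.prems] by (simp add: case_prod_beta)
  have Em: "(\<lambda>(x, y). ?E y) \<in> borel_measurable (?P \<Otimes>\<^sub>M std_gauss)"
    by measurable
  have shiftm: "(\<lambda>x. \<lambda>k\<in>J. x k + h k) \<in> PiM J (\<lambda>_. std_gauss) \<rightarrow>\<^sub>M PiM J (\<lambda>_. std_gauss)" for J :: "'v set"
  proof (rule measurable_restrict)
    fix k assume "k \<in> J"
    note [measurable] = measurable_std_gauss_coordinate[OF this]
    show "(\<lambda>x. x k + h k) \<in> PiM J (\<lambda>_. std_gauss) \<rightarrow>\<^sub>M std_gauss" by simp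
  qed
  define \<Phi> where "\<Phi> = (\<lambda>x. \<integral>\<^sup>+y. F (x(v := y)) * ?E y \<partial>std_gauss)"
  have \<Phi>m: "\<Phi> \<in> borel_measurable ?P"
  proof -
    have "(\<lambda>(x, y). F (x(v := y)) * ?E y) \<in> borel_measurable (?P \<Otimes>\<^sub>M std_gauss)"
      using borel_measurable_times_ennreal[OF Fm Em] by (simp add: case_prod_beta)
    then show ?thesis unfolding \<Phi>_def by (rule G.borel_measurable_nn_integral)
  qed
  have sec: "(\<lambda>y. F (x(v := y))) \<in> borel_measurable borel" if "x \<in> space ?P" for x
    using measurable_compose[OF measurable_Pair1'[OF that, of std_gauss] Fm] by simp
  have "(\<integral>\<^sup>+x. F (\<lambda>k\<in>insert v I. x k + h k) \<partial>PiM (insert v I) (\<lambda>_. std_gauss))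
      = (\<integral>\<^sup>+x. \<integral>\<^sup>+y. F (\<lambda>k\<in>insert v I. (x(v := y)) k + h k) \<partial>std_gauss \<partial>?P)"
    by (rule product_nn_integral_insert[OF insert.hyps])
      (rule measurable_compose[OF shiftm insert.prems])
  also have "\<dots> = (\<integral>\<^sup>+x. \<Phi> (\<lambda>k\<in>I. x k + h k) \<partial>?P)"
  proof (rule nn_integral_cong)
    fix x assume x: "x \<in> space ?P"
    have sp: "(\<lambda>k\<in>I. x k + h k) \<in> space ?P" by (simp add: space_PiM)
    have "(\<lambda>k\<in>insert v I. (x(v := y)) k + h k) = (\<lambda>k\<in>I. x k + h k)(v := y + h v)" for y
      using insert.hyps by (auto simp: fun_eq_iff)
    then show "(\<integral>\<^sup>+y. F (\<lambda>k\<in>insert v I. (x(v := y)) k + h k) \<partial>std_gauss) = \<Phi> (\<lambda>k\<in>I. x k + h k)"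
      unfolding \<Phi>_def using std_gauss_shift[OF sec[OF sp], of "h v"] by simp
  qed
  also have "\<dots> = (\<integral>\<^sup>+x. \<Phi> x * ennreal (exp (\<Sum>k\<in>I. h k * x k - (h k)\<^sup>2 / 2)) \<partial>?P)"
    by (rule insert.IH[OF \<Phi>m])
  also have "\<dots> = (\<integral>\<^sup>+x. \<integral>\<^sup>+y. F (x(v := y)) *
      ennreal (exp (\<Sum>k\<in>insert v I. h k * (x(v := y)) k - (h k)\<^sup>2 / 2)) \<partial>std_gauss \<partial>?P)"
  proof (rule nn_integral_cong)
    fix x assume x: "x \<in> space ?P"
    have "ennreal (exp (\<Sum>k\<in>insert v I. h k * (x(v := y)) k - (h k)\<^sup>2 / 2))
        = ?E y * ennreal (exp (\<Sum>k\<in>I. h k * x k - (h k)\<^sup>2 / 2))" for y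
    proof -
      have "(\<Sum>k\<in>I. h k * (x(v := y)) k - (h k)\<^sup>2 / 2) = (\<Sum>k\<in>I. h k * x k - (h k)\<^sup>2 / 2)"
        using insert.hyps by (intro sum.cong) auto
      then show ?thesis
        using insert.hyps by (simp add: exp_add ennreal_mult)
    qed
    then show "\<Phi> x * ennreal (exp (\<Sum>k\<in>I. h k * x k - (h k)\<^sup>2 / 2)) = (\<integral>\<^sup>+y. F (x(v := y)) *
        ennreal (exp (\<Sum>k\<in>insert v I. h k * (x(v := y)) k - (h k)\<^sup>2 / 2)) \<partial>std_gauss)"
      unfolding \<Phi>_def using sec[OF x]
      by (subst nn_integral_multc[symmetric]) (auto simp: mult.assoc)
  qed
  also have "\<dots> = (\<integral>\<^sup>+x. F x * ennreal (exp (\<Sum>k\<in>insert v I. h k * x k - (h k)\<^sup>2 / 2))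
      \<partial>PiM (insert v I) (\<lambda>_. std_gauss))"
  proof (rule product_nn_integral_insert[OF insert.hyps, symmetric])
    have "(\<lambda>x. \<Sum>k\<in>insert v I. h k * x k - (h k)\<^sup>2 / 2) \<in> borel_measurable (PiM (insert v I) (\<lambda>_. std_gauss))"
    proof (rule borel_measurable_sum)
      fix k assume "k \<in> insert v I"
      note [measurable] = measurable_std_gauss_coordinate[OF this]
      show "(\<lambda>x. h k * x k - (h k)\<^sup>2 / 2) \<in> borel_measurable (PiM (insert v I) (\<lambda>_. std_gauss))" by simp
    qed
    then show "(\<lambda>x. F x * ennreal (exp (\<Sum>k\<in>insert v I. h k * x k - (h k)\<^sup>2 / 2)))
        \<in> borel_measurable (PiM (insert v I) (\<lambda>_. std_gauss))"
      by measurable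
  qed
  finally show ?case .
qed

section \<open>Moments from exponential moments\<close>

lemma sinh_quotient_bound:
  fixes t r :: real
  assumes "0 < t" "t \<le> 1"
  shows "\<bar>(exp (t * r) - exp (- (t * r))) / (2 * t)\<bar> \<le> \<bar>r\<bar> * exp \<bar>r\<bar>"
proof -
  have pos: "(exp (t * s) - exp (- (t * s))) / (2 * t) \<le> s * exp s" "0 \<le> (exp (t * s) - exp (- (t * s))) / (2 * t)"
    if "0 \<le> s" for s
  proof -
    have v: "0 \<le> t * s" "t * s \<le> s" using assms that by (auto simp: mult_left_le_one_le)
    have "exp (t * s) - exp (- (t * s)) = exp (t * s) * (1 - exp (- 2 * (t * s)))"
      by (simp add: right_diff_distrib exp_add[symmetric])
    also have "\<dots> \<le> exp (t * s) * (2 * (t * s))"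
      using exp_ge_add_one_self[of "- 2 * (t * s)"] by (intro mult_left_mono) auto
    also have "\<dots> \<le> exp s * (2 * (t * s))" using v by (intro mult_right_mono) auto
    finally show "(exp (t * s) - exp (- (t * s))) / (2 * t) \<le> s * exp s"
      using assms by (simp add: field_simps)
    show "0 \<le> (exp (t * s) - exp (- (t * s))) / (2 * t)" using v assms by simp
  qed
  show ?thesis
  proof (cases "0 \<le> r")
    case True
    then show ?thesis using pos[of r] by simp
  next
    case False
    have "(exp (t * r) - exp (- (t * r))) / (2 * t) = - ((exp (t * (- r)) - exp (- (t * (- r)))) / (2 * t))"
      by (subst minus_divide_left) simp
    then show ?thesis using pos[of "- r"] False by simp
  qed
qed

lemma sinh_quotient_tendsto:
  fixes r :: real and t :: "nat \<Rightarrow> real"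
  assumes "t \<longlonglongrightarrow> 0" "\<And>n. t n \<noteq> 0"
  shows "(\<lambda>n. (exp (t n * r) - exp (- (t n * r))) / (2 * t n)) \<longlonglongrightarrow> r"
proof -
  have "((\<lambda>s. exp (s * r) - exp (- (s * r))) has_real_derivative 2 * r) (at 0)"
    by (auto intro!: derivative_eq_intros)
  then have "(\<lambda>s. (exp (s * r) - exp (- (s * r))) / s) \<midarrow>0\<rightarrow> 2 * r"
    by (simp add: DERIV_def)
  then have "(\<lambda>n. (exp (t n * r) - exp (- (t n * r))) / t n) \<longlonglongrightarrow> 2 * r"
    by (rule filterlim_compose) (use assms in \<open>auto simp: filterlim_at\<close>)
  then have "(\<lambda>n. (exp (t n * r) - exp (- (t n * r))) / t n / 2) \<longlonglongrightarrow> 2 * r / 2"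
    by (intro tendsto_divide) auto
  then show ?thesis by (simp add: field_simps)
qed

text \<open>The first two moments are recovered from the moment generating function on an event by
  dominated convergence of symmetric difference quotients.\<close>

lemma (in prob_space) moments_from_mgf:
  fixes R :: "'a \<Rightarrow> real"
  assumes [measurable]: "R \<in> borel_measurable M" "B \<in> sets M"
    and int: "\<And>t. integrable M (\<lambda>x. exp (t * R x))"
    and mgf: "\<And>t. (\<integral>x. indicator B x * exp (t * R x) \<partial>M) = exp (t\<^sup>2 * q / 2) * prob B"
  shows "integrable M R" "integrable M (\<lambda>x. (R x)\<^sup>2)"
    and "(\<integral>x. indicator B x * R x \<partial>M) = 0" "(\<integral>x. indicator B x * (R x)\<^sup>2 \<partial>M) = q * prob B"
proof -
  \<comment> \<open>One dominating function for both limits. The quotients are bounded by |r| * exp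
    |r| \<le> exp (2|r|), and squaring for the second moment doubles the exponent to 4|r|.\<close>
  define w where "w = (\<lambda>x. 4 * (exp (4 * R x) + exp (- 4 * R x)))"
  have wi: "integrable M w" unfolding w_def using int[of 4] int[of "-4"] by simp
  have abs_le: "\<bar>r\<bar> \<le> exp \<bar>r\<bar>" for r :: real using exp_ge_add_one_self[of "\<bar>r\<bar>"] by linarith
  have e2: "exp (4 * \<bar>r\<bar>) \<le> exp (4 * r) + exp (- 4 * r)" for r :: real
    by (cases "0 \<le> r") (auto simp: abs_if)
  have le4: "s \<le> 4 * s" if "0 \<le> s" for s :: real using that by simp
  have b1: "\<bar>r\<bar> * exp \<bar>r\<bar> \<le> 4 * (exp (4 * r) + exp (- 4 * r))" for r :: real
  proof -
    have "\<bar>r\<bar> * exp \<bar>r\<bar> \<le> exp \<bar>r\<bar> * exp \<bar>r\<bar>" using abs_le by (intro mult_right_mono) auto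
    also have "\<dots> = exp (2 * \<bar>r\<bar>)" by (simp add: exp_add[symmetric])
    also have "\<dots> \<le> exp (4 * \<bar>r\<bar>)" by simp
    also have "\<dots> \<le> exp (4 * r) + exp (- 4 * r)" by (rule e2)
    also have "\<dots> \<le> 4 * (exp (4 * r) + exp (- 4 * r))" by (rule le4) (intro add_nonneg_nonneg exp_ge_zero)
    finally show ?thesis .
  qed
  have b2: "4 * (\<bar>r\<bar> * exp \<bar>r\<bar>)\<^sup>2 \<le> 4 * (exp (4 * r) + exp (- 4 * r))" for r :: real
  proof -
    have "(\<bar>r\<bar> * exp \<bar>r\<bar>)\<^sup>2 \<le> (exp \<bar>r\<bar> * exp \<bar>r\<bar>)\<^sup>2"
      using abs_le by (intro power_mono mult_right_mono) auto
    also have "\<dots> = exp (4 * \<bar>r\<bar>)" by (simp add: power2_eq_square exp_add[symmetric])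
    also have "\<dots> \<le> exp (4 * r) + exp (- 4 * r)" by (rule e2)
    finally show ?thesis by simp
  qed
  have b0: "\<bar>r\<bar> \<le> \<bar>r\<bar> * exp \<bar>r\<bar>" for r :: real
    using mult_left_mono[of 1 "exp \<bar>r\<bar>" "\<bar>r\<bar>"] by simp
  show "integrable M R"
    by (rule Bochner_Integration.integrable_bound[OF wi])
      (use b0 b1 in \<open>auto simp: w_def intro: order_trans\<close>)
  have "\<bar>(R x)\<^sup>2\<bar> \<le> w x" for x
  proof -
    have "(R x)\<^sup>2 \<le> (\<bar>R x\<bar> * exp \<bar>R x\<bar>)\<^sup>2" using b0[of "R x"] by (metis abs_ge_zero power2_abs power_mono)
    also have "\<dots> \<le> 4 * (\<bar>R x\<bar> * exp \<bar>R x\<bar>)\<^sup>2" by simp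
    also have "\<dots> \<le> w x" unfolding w_def by (rule b2)
    finally show ?thesis by simp
  qed
  then show "integrable M (\<lambda>x. (R x)\<^sup>2)"
    by (intro Bochner_Integration.integrable_bound[OF wi]) (auto intro: order_trans[OF _ abs_ge_self])
  define t where "t = (\<lambda>n. inverse (real (Suc n)))"
  have t0: "t \<longlonglongrightarrow> 0" unfolding t_def by (rule LIMSEQ_inverse_real_of_nat)
  have t: "0 < t n" "t n \<le> 1" for n by (auto simp: t_def field_simps)
  have ib: "integrable M (\<lambda>x. indicator B x * exp (s * R x))" for s
    using integrable_mult_indicator[OF assms(2) int[of s]] by simp
  define D where "D = (\<lambda>n r. (exp (t n * r) - exp (- (t n * r))) / (2 * t n))"
  have Dlim: "(\<lambda>n. D n r) \<longlonglongrightarrow> r" for r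
    unfolding D_def using t by (intro sinh_quotient_tendsto t0) (metis less_irrefl)
  have Db: "\<bar>D n r\<bar> \<le> \<bar>r\<bar> * exp \<bar>r\<bar>" for n r
    unfolding D_def using t by (intro sinh_quotient_bound)
  have Dm [measurable]: "(\<lambda>x. D n (R x / c)) \<in> borel_measurable M" for n c unfolding D_def by measurable
  have Dm1 [measurable]: "(\<lambda>x. D n (R x)) \<in> borel_measurable M" for n unfolding D_def by measurable
  have "(\<lambda>n. \<integral>x. indicator B x * D n (R x) \<partial>M) \<longlonglongrightarrow> (\<integral>x. indicator B x * R x \<partial>M)"
  proof (rule integral_dominated_convergence[OF _ _ wi])
    show "AE x in M. (\<lambda>n. indicator B x * D n (R x)) \<longlonglongrightarrow> indicator B x * R x"
      by (intro AE_I2 tendsto_mult Dlim tendsto_const)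
    show "AE x in M. norm (indicator B x * D n (R x)) \<le> w x" for n
      using Db b1 unfolding w_def by (intro AE_I2) (auto simp: indicator_def intro: order_trans)
  qed auto
  moreover have "(\<integral>x. indicator B x * D n (R x) \<partial>M) = 0" for n
  proof -
    have "indicator B x * D n (R x) = (indicator B x * exp (t n * R x) - indicator B x * exp (- t n * R x)) / (2 * t n)" for x
      by (simp add: D_def algebra_simps diff_divide_distrib)
    then have "(\<integral>x. indicator B x * D n (R x) \<partial>M) = ((\<integral>x. indicator B x * exp (t n * R x) \<partial>M)
        - (\<integral>x. indicator B x * exp (- t n * R x) \<partial>M)) / (2 * t n)"
      using Bochner_Integration.integral_diff[OF ib[of "t n"] ib[of "- t n"]] by simp
    then show ?thesis unfolding mgf by simp
  qed
  ultimately show "(\<integral>x. indicator B x * R x \<partial>M) = 0"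
    using LIMSEQ_unique[OF _ tendsto_const[of 0]] by simp
  \<comment> \<open>The second symmetric difference quotient of exp is the square of the first one
    taken at r/2. So both its limit and its domination follow from those for
    \<open>D\<close>.\<close>
  have "(\<lambda>n. \<integral>x. indicator B x * (2 * D n (R x * (1 / 2)))\<^sup>2 \<partial>M) \<longlonglongrightarrow> (\<integral>x. indicator B x * (R x)\<^sup>2 \<partial>M)"
  proof (rule integral_dominated_convergence[OF _ _ wi])
    have "(\<lambda>n. (2 * D n (r * (1 / 2)))\<^sup>2) \<longlonglongrightarrow> r\<^sup>2" for r
      using tendsto_power[OF tendsto_mult_left[OF Dlim[of "r * (1 / 2)"], of 2], of 2] by simp
    then show "AE x in M. (\<lambda>n. indicator B x * (2 * D n (R x * (1 / 2)))\<^sup>2) \<longlonglongrightarrow> indicator B x * (R x)\<^sup>2"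
      by (intro AE_I2 tendsto_mult tendsto_const)
    have "(2 * D n (r * (1 / 2)))\<^sup>2 \<le> 4 * (exp (4 * r) + exp (- 4 * r))" for n r
    proof -
      have "\<bar>D n (r * (1 / 2))\<bar> \<le> \<bar>r * (1 / 2)\<bar> * exp \<bar>r * (1 / 2)\<bar>" by (rule Db)
      also have "\<dots> \<le> \<bar>r\<bar> * exp \<bar>r\<bar>" by (intro mult_mono) auto
      finally have "\<bar>D n (r * (1 / 2))\<bar>\<^sup>2 \<le> (\<bar>r\<bar> * exp \<bar>r\<bar>)\<^sup>2" by (intro power_mono) auto
      then show ?thesis using b2[of r] by (simp add: power_mult_distrib)
    qed
    then show "AE x in M. norm (indicator B x * (2 * D n (R x * (1 / 2)))\<^sup>2) \<le> w x" for n
      unfolding w_def by (intro AE_I2) (auto simp: indicator_def)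
  qed auto
  moreover have "(\<integral>x. indicator B x * (2 * D n (R x * (1 / 2)))\<^sup>2 \<partial>M)
      = 2 * prob B * ((exp ((t n)\<^sup>2 * (q / 2)) - 1) / (t n)\<^sup>2)" for n
  proof -
    have sq: "(2 * D n (r * (1 / 2)))\<^sup>2 = (exp (t n * r) + exp (- t n * r) - 2) / (t n)\<^sup>2" for r
    proof -
      have "2 * D n (r * (1 / 2)) = (exp (t n * r / 2) - exp (- (t n * r / 2))) / t n"
        using t[of n] by (simp add: D_def field_simps)
      moreover have "(exp (t n * r / 2) - exp (- (t n * r / 2)))\<^sup>2 = exp (t n * r) + exp (- t n * r) - 2"
        by (simp add: power2_eq_square algebra_simps exp_add[symmetric])
      ultimately show ?thesis by (simp add: power_divide)
    qed
    have "indicator B x * (2 * D n (R x * (1 / 2)))\<^sup>2 = (indicator B x * exp (t n * R x)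
        + indicator B x * exp (- t n * R x) - 2 * indicator B x) / (t n)\<^sup>2" for x
      unfolding sq by (simp add: algebra_simps diff_divide_distrib add_divide_distrib)
    then have "(\<integral>x. indicator B x * (2 * D n (R x * (1 / 2)))\<^sup>2 \<partial>M)
      = ((\<integral>x. indicator B x * exp (t n * R x) \<partial>M) + (\<integral>x. indicator B x * exp (- t n * R x) \<partial>M)
        - 2 * prob B) / (t n)\<^sup>2"
      using ib[of 0] Bochner_Integration.integral_add[OF ib[of "t n"] ib[of "- t n"]]
        Bochner_Integration.integral_diff[OF Bochner_Integration.integrable_add[OF ib[of "t n"] ib[of "- t n"]],
          of "\<lambda>x. 2 * indicator B x"]
      by simp
    also have "\<dots> = 2 * prob B * ((exp ((t n)\<^sup>2 * (q / 2)) - 1) / (t n)\<^sup>2)"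
      unfolding mgf by (simp add: algebra_simps diff_divide_distrib)
    finally show ?thesis .
  qed
  moreover have "(\<lambda>n. 2 * prob B * ((exp ((t n)\<^sup>2 * (q / 2)) - 1) / (t n)\<^sup>2)) \<longlonglongrightarrow> 2 * prob B * (q / 2)"
  proof (intro tendsto_mult tendsto_const)
    have "((\<lambda>s. exp (s * (q / 2))) has_real_derivative q / 2) (at 0)"
      by (auto intro!: derivative_eq_intros)
    then have "(\<lambda>s. (exp (s * (q / 2)) - 1) / s) \<midarrow>0\<rightarrow> q / 2" by (simp add: DERIV_def)
    moreover have "filterlim (\<lambda>n. (t n)\<^sup>2) (at 0) sequentially"
      using tendsto_power[OF t0, of 2] t by (auto simp: filterlim_at intro!: always_eventually) (metis less_irrefl)
    ultimately show "(\<lambda>n. (exp ((t n)\<^sup>2 * (q / 2)) - 1) / (t n)\<^sup>2) \<longlonglongrightarrow> q / 2"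
      by (rule filterlim_compose)
  qed
  ultimately show "(\<integral>x. indicator B x * (R x)\<^sup>2 \<partial>M) = q * prob B"
    using LIMSEQ_unique by fastforce
qed

section \<open>Linear forms in the noise on translation invariant events\<close>

lemma measurable_coordinate: "k < p \<Longrightarrow> (\<lambda>x. x k) \<in> borel_measurable (noise p)"
  unfolding noise_def by (rule measurable_std_gauss_coordinate) simp

lemma prob_space_noise: "prob_space (noise p)"
  unfolding noise_def by (intro prob_space_PiM prob_space_std_gauss)

lemma space_noise: "space (noise p) = {..<p} \<rightarrow>\<^sub>E UNIV"
  by (simp add: noise_def space_PiM)

text \<open>\<open>B\<close> is invariant under translations along \<open>h\<close>; under this condition the linear form
  \<open>\<langle>h, \<epsilon>\<rangle>\<close> behaves on \<open>B\<close> as if it were independent of \<open>B\<close>.\<close>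

lemma noise_moments_on_invariant_set:
  assumes B: "B \<in> sets (noise p)"
    and inv: "\<And>t x. x \<in> space (noise p) \<Longrightarrow> (\<lambda>k\<in>{..<p}. x k + t * h k) \<in> B \<longleftrightarrow> x \<in> B"
  defines "R \<equiv> \<lambda>x. \<Sum>k<p. h k * x k"
  shows "integrable (noise p) R" "integrable (noise p) (\<lambda>x. (R x)\<^sup>2)"
    and "(\<integral>x. indicator B x * R x \<partial>noise p) = 0"
    and "(\<integral>x. indicator B x * (R x)\<^sup>2 \<partial>noise p) = (\<Sum>k<p. (h k)\<^sup>2) * measure (noise p) B"
proof -
  interpret prob_space "noise p" by (rule prob_space_noise)
  define q where "q = (\<Sum>k<p. (h k)\<^sup>2)"
  have Rm [measurable]: "R \<in> borel_measurable (noise p)"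
    unfolding R_def by (intro borel_measurable_sum borel_measurable_times measurable_coordinate) auto
  \<comment> \<open>Translating the indicator of \<open>A\<close> along h does nothing, while
    Cameron-Martin turns the translation into the factor exp (t R - t^2 q / 2). Besides B this is
    applied to the whole space, which gives integrability.\<close>
  have key: "(\<integral>\<^sup>+x. indicator A x * ennreal (exp (t * R x)) \<partial>noise p)
      = ennreal (exp (t\<^sup>2 * q / 2)) * emeasure (noise p) A"
    if A [measurable]: "A \<in> sets (noise p)" and Ainv: "\<And>t x. x \<in> space (noise p) \<Longrightarrow>
      (\<lambda>k\<in>{..<p}. x k + t * h k) \<in> A \<longleftrightarrow> x \<in> A" for A t
  proof -
    have ex: "(\<Sum>k<p. t * h k * x k - (t * h k)\<^sup>2 / 2) = t * R x - t\<^sup>2 * q / 2" for x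
      by (simp add: R_def q_def sum_subtractf sum_distrib_left sum_divide_distrib power_mult_distrib mult.assoc)
    have "emeasure (noise p) A = (\<integral>\<^sup>+x. indicator A x \<partial>noise p)" using A by simp
    also have "\<dots> = (\<integral>\<^sup>+x. indicator A (\<lambda>k\<in>{..<p}. x k + t * h k) \<partial>noise p)"
      by (rule nn_integral_cong) (simp add: indicator_def Ainv)
    also have "\<dots> = (\<integral>\<^sup>+x. indicator A x * ennreal (exp (t * R x - t\<^sup>2 * q / 2)) \<partial>noise p)"
      using A unfolding noise_def
      by (subst cameron_martin) (auto simp: ex)
    also have "\<dots> = (\<integral>\<^sup>+x. ennreal (exp (- (t\<^sup>2 * q / 2))) * (indicator A x * ennreal (exp (t * R x))) \<partial>noise p)"
    proof (rule nn_integral_cong)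
      fix x
      have "ennreal (exp (t * R x - t\<^sup>2 * q / 2)) = ennreal (exp (- (t\<^sup>2 * q / 2))) * ennreal (exp (t * R x))"
        by (simp add: ennreal_mult[symmetric] exp_add[symmetric])
      then show "indicator A x * ennreal (exp (t * R x - t\<^sup>2 * q / 2))
          = ennreal (exp (- (t\<^sup>2 * q / 2))) * (indicator A x * ennreal (exp (t * R x)))"
        by (simp only: mult.left_commute)
    qed
    also have "\<dots> = ennreal (exp (- (t\<^sup>2 * q / 2))) * (\<integral>\<^sup>+x. indicator A x * ennreal (exp (t * R x)) \<partial>noise p)"
      by (rule nn_integral_cmult) measurable
    finally have "ennreal (exp (t\<^sup>2 * q / 2)) * emeasure (noise p) A =
      ennreal (exp (t\<^sup>2 * q / 2)) * ennreal (exp (- (t\<^sup>2 * q / 2))) *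
        (\<integral>\<^sup>+x. indicator A x * ennreal (exp (t * R x)) \<partial>noise p)" by (simp add: mult.assoc)
    then show ?thesis by (simp add: ennreal_mult[symmetric] exp_add[symmetric])
  qed
  have fin: "(\<integral>\<^sup>+x. ennreal (exp (t * R x)) \<partial>noise p) = ennreal (exp (t\<^sup>2 * q / 2))" for t
  proof -
    have "(\<integral>\<^sup>+x. ennreal (exp (t * R x)) \<partial>noise p)
        = (\<integral>\<^sup>+x. indicator (space (noise p)) x * ennreal (exp (t * R x)) \<partial>noise p)"
      by (intro nn_integral_cong) simp
    also have "\<dots> = ennreal (exp (t\<^sup>2 * q / 2))"
      using emeasure_space_1 by (subst key[OF sets.top]) (auto simp: space_noise)
    finally show ?thesis .
  qed
  have int: "integrable (noise p) (\<lambda>x. exp (t * R x))" for t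
    by (rule integrableI_nonneg) (auto simp: fin)
  have mgf: "(\<integral>x. indicator B x * exp (t * R x) \<partial>noise p) = exp (t\<^sup>2 * q / 2) * prob B" for t
  proof -
    have "(\<integral>\<^sup>+x. ennreal (indicator B x * exp (t * R x)) \<partial>noise p)
        = ennreal (exp (t\<^sup>2 * q / 2) * prob B)"
    proof -
      have "(\<integral>\<^sup>+x. ennreal (indicator B x * exp (t * R x)) \<partial>noise p)
          = (\<integral>\<^sup>+x. indicator B x * ennreal (exp (t * R x)) \<partial>noise p)"
        by (intro nn_integral_cong) (simp add: indicator_def)
      then show ?thesis using key[OF B inv, of t]
        by (simp add: emeasure_eq_measure ennreal_mult)
    qed
    then show ?thesis by (intro integral_eq_nn_integral[THEN trans]) (use B in auto)
  qed
  note m = moments_from_mgf[OF Rm B int mgf]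
  show "integrable (noise p) R" "integrable (noise p) (\<lambda>x. (R x)\<^sup>2)"
    "(\<integral>x. indicator B x * R x \<partial>noise p) = 0" by (rule m)+
  show "(\<integral>x. indicator B x * (R x)\<^sup>2 \<partial>noise p) = (\<Sum>k<p. (h k)\<^sup>2) * prob B"
    using m(4) by (simp add: q_def)
qed

lemma integrable_coordinate:
  assumes "k < p"
  shows "integrable (noise p) (\<lambda>x. x k)"
proof -
  have eq: "(\<Sum>i<p. (if i = k then 1 else 0) * x i) = x k" for x :: "nat \<Rightarrow> real"
  proof -
    have "(\<Sum>i<p. (if i = k then 1 else 0) * x i) = (\<Sum>i<p. if i = k then x i else 0)"
      by (intro sum.cong) auto
    then show ?thesis using assms by simp
  qed
  show ?thesis
    using noise_moments_on_invariant_set(1)[OF sets.top, of p "\<lambda>i. if i = k then 1 else 0", unfolded eq]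
    by (simp add: space_noise)
qed

section \<open>Structural equations and the precision matrix\<close>

lemma sem_var_cong:
  "(\<And>k. k \<le> j \<Longrightarrow> x k = y k) \<Longrightarrow> sem_var E a j x = sem_var E a j y"
proof (induction j rule: less_induct)
  case (less j)
  show ?case
    unfolding sem_var.simps[of E a j] using less by (auto intro!: sum.cong)
qed

lemma sem_var_add:
  "sem_var E a j (\<lambda>k. x k + t * h k) = sem_var E a j x + t * sem_var E a j h"
proof (induction j rule: less_induct)
  case (less j)
  have "(\<Sum>i<j. edge_coeff E a i j * sem_var E a i (\<lambda>k. x k + t * h k))
      = (\<Sum>i<j. edge_coeff E a i j * sem_var E a i x) + t * (\<Sum>i<j. edge_coeff E a i j * sem_var E a i h)"
    unfolding sum_distrib_left sum.distrib[symmetric] using less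
    by (intro sum.cong) (auto simp: algebra_simps)
  then show ?case
    unfolding sem_var.simps[of E a j] by (simp add: algebra_simps)
qed

lemma sem_var_integrable:
  "j < p \<Longrightarrow> integrable (noise p) (sem_var E a j)"
proof (induction j rule: less_induct)
  case (less j)
  have "integrable (noise p) (\<lambda>x. (\<Sum>i<j. edge_coeff E a i j * sem_var E a i x) + x j)"
    using less by (intro Bochner_Integration.integrable_add Bochner_Integration.integrable_sum
        integrable_mult_right integrable_coordinate) auto
  then show ?case by (simp add: sem_var.simps[of E a j, abs_def])
qed

text \<open>The matrix I - A, so that K is this matrix times its transpose.\<close>

definition L_entry :: "(nat \<times> nat) set \<Rightarrow> (nat \<times> nat \<Rightarrow> real) \<Rightarrow> nat \<Rightarrow> nat \<Rightarrow> real" where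
  "L_entry E a u k = (if u = k then 1 else 0) - edge_coeff E a u k"

text \<open>The vector (I - A)^T y: the noise for which the structural equations produce X =
  y.\<close>

definition resid :: "nat \<Rightarrow> (nat \<times> nat) set \<Rightarrow> (nat \<times> nat \<Rightarrow> real) \<Rightarrow> (nat \<Rightarrow> real) \<Rightarrow> nat \<Rightarrow> real" where
  "resid p E a y k = (\<Sum>v<p. L_entry E a v k * y v)"

lemma edge_coeff_eq_0: "ordered_dag p E \<Longrightarrow> k \<le> u \<Longrightarrow> edge_coeff E a u k = 0"
  by (auto simp: ordered_dag_def edge_coeff_def)

lemma sum_L_entry:
  assumes "ordered_dag p E" "k < p"
  shows "(\<Sum>v<p. L_entry E a v k * y v) = y k - (\<Sum>i<k. edge_coeff E a i k * y i)"
proof -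
  have "(\<Sum>v<p. L_entry E a v k * y v) = (\<Sum>v<p. (if v = k then y v else 0)) - (\<Sum>v<p. edge_coeff E a v k * y v)"
    unfolding sum_subtractf[symmetric] by (intro sum.cong) (auto simp: L_entry_def algebra_simps)
  also have "(\<Sum>v<p. (if v = k then y v else 0)) = y k" using assms by simp
  also have "(\<Sum>v<p. edge_coeff E a v k * y v) = (\<Sum>i<k. edge_coeff E a i k * y i)"
    using assms edge_coeff_eq_0[OF assms(1)] by (intro sum.mono_neutral_right) auto
  finally show ?thesis .
qed

lemma sem_var_resid:
  assumes "ordered_dag p E"
  shows "j < p \<Longrightarrow> sem_var E a j (resid p E a y) = y j"
proof (induction j rule: less_induct)
  case (less j)
  have "sem_var E a j (resid p E a y) = (\<Sum>i<j. edge_coeff E a i j * y i) + resid p E a y j"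
    unfolding sem_var.simps[of E a j] using less by auto
  moreover have "resid p E a y j = y j - (\<Sum>i<j. edge_coeff E a i j * y i)"
    unfolding resid_def by (rule sum_L_entry[OF assms less.prems])
  ultimately show ?case by simp
qed

text \<open>The double sum is (K y)_v, as K = (I - A)(I - A)^T. So y, which vanishes on S, is off S
  the i-th column of the inverse of K with the rows and columns in S removed.\<close>

definition prec_solution ::
    "nat \<Rightarrow> (nat \<times> nat) set \<Rightarrow> nat set \<Rightarrow> (nat \<times> nat \<Rightarrow> real) \<Rightarrow> nat \<Rightarrow> (nat \<Rightarrow> real) \<Rightarrow> bool" where
  "prec_solution p E S a i y \<longleftrightarrow> (\<forall>s\<in>S. y s = 0) \<and>
     (\<forall>v\<in>{..<p} - S. (\<Sum>k<p. L_entry E a v k * resid p E a y k) = (if v = i then 1 else 0))"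

lemma noise_form_resid:
  assumes "ordered_dag p E"
  shows "(\<Sum>k<p. resid p E a y k * x k)
    = (\<Sum>u<p. (\<Sum>k<p. L_entry E a u k * resid p E a y k) * sem_var E a u x)"
proof -
  have x: "x k = (\<Sum>u<p. L_entry E a u k * sem_var E a u x)" if "k < p" for k
    using sum_L_entry[OF assms that, of a "\<lambda>u. sem_var E a u x"] sem_var.simps[of E a k x] by simp
  have "(\<Sum>k<p. resid p E a y k * x k)
      = (\<Sum>k<p. \<Sum>u<p. resid p E a y k * (L_entry E a u k * sem_var E a u x))"
    using x by (intro sum.cong) (auto simp: sum_distrib_left)
  also have "\<dots> = (\<Sum>u<p. \<Sum>k<p. resid p E a y k * (L_entry E a u k * sem_var E a u x))"
    by (rule sum.swap)
  finally show ?thesis by (simp add: sum_distrib_left sum_distrib_right mult_ac)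
qed

text \<open>As \<epsilon> = (I - A)^T X, the form with coefficient vector (I - A)^T y is (K y)^T X.
  Off S only the entry i of K y survives, so the form is X_i minus a combination of X_S: the
  regression residual.\<close>

lemma prec_solution_decomposition:
  assumes "ordered_dag p E" "S \<subseteq> {..<p}" "i < p" "i \<notin> S" "prec_solution p E S a i y"
  shows "\<exists>c. \<forall>x. sem_var E a i x = (\<Sum>k<p. resid p E a y k * x k) + (\<Sum>s\<in>S. c s * sem_var E a s x)"
proof -
  define c where "c u = (\<Sum>k<p. L_entry E a u k * resid p E a y k)" for u
  have "(\<Sum>k<p. resid p E a y k * x k) = sem_var E a i x + (\<Sum>s\<in>S. c s * sem_var E a s x)" for x
  proof -
    have "(\<Sum>k<p. resid p E a y k * x k) = (\<Sum>u<p. c u * sem_var E a u x)"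
      unfolding c_def by (rule noise_form_resid[OF assms(1)])
    also have "\<dots> = (\<Sum>u\<in>{..<p} - S. c u * sem_var E a u x) + (\<Sum>s\<in>S. c s * sem_var E a s x)"
      using assms(2) by (intro sum.subset_diff) auto
    also have "(\<Sum>u\<in>{..<p} - S. c u * sem_var E a u x) = (\<Sum>u\<in>{..<p} - S. if u = i then sem_var E a u x else 0)"
      using assms(5) unfolding prec_solution_def c_def by (intro sum.cong) auto
    also have "\<dots> = sem_var E a i x" using assms(3,4) by simp
    finally show ?thesis .
  qed
  then show ?thesis by (intro exI[of _ "\<lambda>s. - c s"]) (auto simp: sum_negf)
qed

text \<open>The inner product is y^T K y'; on S the factor y vanishes, and off S the vector K y' is
  the j-th unit vector.\<close>

lemma prec_solution_inner:
  assumes "S \<subseteq> {..<p}" "j < p" "j \<notin> S" "prec_solution p E S a i y" "prec_solution p E S a j y'"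
  shows "(\<Sum>k<p. resid p E a y k * resid p E a y' k) = y j"
proof -
  have "(\<Sum>k<p. resid p E a y k * resid p E a y' k)
      = (\<Sum>k<p. \<Sum>v<p. L_entry E a v k * y v * resid p E a y' k)"
    by (simp add: resid_def[of p E a y] sum_distrib_right)
  also have "\<dots> = (\<Sum>v<p. \<Sum>k<p. L_entry E a v k * y v * resid p E a y' k)" by (rule sum.swap)
  also have "\<dots> = (\<Sum>v<p. y v * (\<Sum>k<p. L_entry E a v k * resid p E a y' k))"
    by (simp add: sum_distrib_left mult_ac)
  also have "\<dots> = (\<Sum>v<p. if v = j then y v else 0)"
    using assms(4,5) unfolding prec_solution_def by (intro sum.cong) auto
  also have "\<dots> = y j" using assms(2) by simp
  finally show ?thesis .
qed

lemma sem_map_measurable: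
  assumes "S \<subseteq> {..<p}"
  shows "(\<lambda>\<epsilon>. \<lambda>s\<in>S. sem_var E a s \<epsilon>) \<in> noise p \<rightarrow>\<^sub>M PiM S (\<lambda>_. borel)"
  using assms borel_measurable_integrable[OF sem_var_integrable] by (intro measurable_restrict) auto

text \<open>Moving the noise by t (I - A)^T y moves X by t y, which is zero on S, so events that
  depend only on X_S do not notice it.\<close>

lemma sigma_of_invariant:
  assumes dag: "ordered_dag p E" and S: "S \<subseteq> {..<p}" and B: "B \<in> sets (sigma_of p E a S)"
    and y: "\<And>s. s \<in> S \<Longrightarrow> y s = 0" and x: "x \<in> space (noise p)"
  shows "(\<lambda>k\<in>{..<p}. x k + t * resid p E a y k) \<in> B \<longleftrightarrow> x \<in> B"
proof -
  have "(\<lambda>\<epsilon>. \<lambda>s\<in>S. sem_var E a s \<epsilon>) \<in> space (noise p) \<rightarrow> space (PiM S (\<lambda>_. borel :: real measure))"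
    by (auto simp: space_PiM)
  then obtain C where C: "B = (\<lambda>\<epsilon>. \<lambda>s\<in>S. sem_var E a s \<epsilon>) -` C \<inter> space (noise p)"
    using B unfolding sigma_of_def by (auto simp: sets_vimage_algebra2)
  have "sem_var E a s (\<lambda>k\<in>{..<p}. x k + t * resid p E a y k) = sem_var E a s x" if "s \<in> S" for s
  proof -
    have "s < p" using S that by auto
    then have "sem_var E a s (\<lambda>k\<in>{..<p}. x k + t * resid p E a y k)
        = sem_var E a s (\<lambda>k. x k + t * resid p E a y k)"
      by (intro sem_var_cong) auto
    also have "\<dots> = sem_var E a s x"
      unfolding sem_var_add sem_var_resid[OF dag \<open>s < p\<close>] by (simp add: y that)
    finally show ?thesis .
  qed
  then have "(\<lambda>s\<in>S. sem_var E a s (\<lambda>k\<in>{..<p}. x k + t * resid p E a y k)) = (\<lambda>s\<in>S. sem_var E a s x)"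
    by auto
  then show ?thesis using x unfolding C by (simp add: space_noise)
qed

theorem cond_cov_eq_prec_solution:
  assumes dag: "ordered_dag p E" and S: "S \<subseteq> {..<p}"
    and i: "i < p" "i \<notin> S" "prec_solution p E S a i y"
    and j: "j < p" "j \<notin> S" "prec_solution p E S a j y'"
  shows "cond_cov p E i j S a = y j"
proof -
  define M where "M = noise p"
  define F where "F = sigma_of p E a S"
  interpret prob_space M unfolding M_def by (rule prob_space_noise)
  note smap = sem_map_measurable[OF S, of E a]
  have spF: "space F = space M" by (simp add: F_def M_def sigma_of_def)
  have sub: "subalgebra M F"
    unfolding subalgebra_def spF
    using smap by (auto simp: F_def M_def sigma_of_def measurable_iff_sets)
  interpret finite_measure_subalgebra M F by standard (rule sub)
  have sem_m: "sem_var E a s \<in> borel_measurable F" if "s \<in> S" for s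
  proof -
    have "(\<lambda>\<epsilon>. \<lambda>s\<in>S. sem_var E a s \<epsilon>) \<in> F \<rightarrow>\<^sub>M PiM S (\<lambda>_. borel)"
      unfolding F_def sigma_of_def by (rule measurable_vimage_algebra1) (auto simp: space_PiM)
    from measurable_compose[OF this measurable_component_singleton[OF that]]
    show ?thesis using that by simp
  qed
  define r where "r z x = (\<Sum>k<p. resid p E a z k * x k)" for z x
  have moments: "integrable M (r z)" "integrable M (\<lambda>x. (r z x)\<^sup>2)"
    "B \<in> sets F \<Longrightarrow> (\<integral>x. indicator B x * r z x \<partial>M) = 0"
    "B \<in> sets F \<Longrightarrow> (\<integral>x. indicator B x * (r z x)\<^sup>2 \<partial>M) = (\<Sum>k<p. (resid p E a z k)\<^sup>2) * prob B"
    if "\<forall>s\<in>S. z s = 0" for z B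
  proof -
    have *: "B \<in> sets (noise p)"
      "\<And>t x. x \<in> space (noise p) \<Longrightarrow> (\<lambda>k\<in>{..<p}. x k + t * resid p E a z k) \<in> B \<longleftrightarrow> x \<in> B"
      if "B \<in> sets F" for B
      using that sub sigma_of_invariant[OF dag S, of B a z] \<open>\<forall>s\<in>S. z s = 0\<close>
      by (auto simp: F_def M_def subalgebra_def)
    note n = noise_moments_on_invariant_set[OF *, folded M_def r_def]
    show "integrable M (r z)" by (rule n(1)) (rule sets.top)+
    show "integrable M (\<lambda>x. (r z x)\<^sup>2)" by (rule n(2)) (rule sets.top)+
    show "(\<integral>x. indicator B x * r z x \<partial>M) = 0" if "B \<in> sets F" by (rule n(3)) (rule that)+
    show "(\<integral>x. indicator B x * (r z x)\<^sup>2 \<partial>M) = (\<Sum>k<p. (resid p E a z k)\<^sup>2) * prob B" if "B \<in> sets F"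
      by (rule n(4)) (rule that)+
  qed
  \<comment> \<open>The combination of X_S in the decomposition is measurable for the conditioning
    algebra, and the form r integrates to 0 over each of its events; this characterises the
    combination as the conditional expectation.\<close>
  have res: "AE x in M. sem_var E a l x - cexp p E a S (sem_var E a l) x = r z x"
    if l: "l < p" "l \<notin> S" "prec_solution p E S a l z" for l z
  proof -
    obtain c where c: "\<And>x. sem_var E a l x = r z x + (\<Sum>s\<in>S. c s * sem_var E a s x)"
      using prec_solution_decomposition[OF dag S l] unfolding r_def by blast
    have z0: "\<forall>s\<in>S. z s = 0" using l(3) by (simp add: prec_solution_def)
    define g where "g x = (\<Sum>s\<in>S. c s * sem_var E a s x)" for x
    have gi: "integrable M g"
      unfolding g_def M_def using S sem_var_integrable
      by (intro Bochner_Integration.integrable_sum integrable_mult_right) auto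
    have gm: "g \<in> borel_measurable F"
      unfolding g_def using sem_m by (intro borel_measurable_sum borel_measurable_times) auto
    have "AE x in M. real_cond_exp M F (sem_var E a l) x = g x"
    proof (rule real_cond_exp_charact)
      show "integrable M (sem_var E a l)" unfolding M_def by (rule sem_var_integrable[OF l(1)])
      fix B assume B: "B \<in> sets F"
      then have BM: "B \<in> sets M" using sub by (auto simp: subalgebra_def)
      have "(\<integral>x\<in>B. sem_var E a l x \<partial>M) = (\<integral>x. indicator B x * r z x + indicator B x * g x \<partial>M)"
        unfolding set_lebesgue_integral_def by (simp add: c g_def algebra_simps)
      also have "\<dots> = (\<integral>x. indicator B x * r z x \<partial>M) + (\<integral>x. indicator B x * g x \<partial>M)"
        using integrable_mult_indicator[OF BM moments(1)[OF z0]] integrable_mult_indicator[OF BM gi]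
        by (intro Bochner_Integration.integral_add) auto
      also have "\<dots> = (\<integral>x\<in>B. g x \<partial>M)"
        by (simp add: moments(3)[OF z0 B] set_lebesgue_integral_def)
      finally show "(\<integral>x\<in>B. sem_var E a l x \<partial>M) = (\<integral>x\<in>B. g x \<partial>M)" .
    qed (fact gi gm)+
    then show ?thesis
      unfolding cexp_def F_def[symmetric] M_def[symmetric]
      by eventually_elim (simp add: c g_def)
  qed
  define P where "P x = r y x * r y' x" for x
  have z: "\<forall>s\<in>S. y s = 0" "\<forall>s\<in>S. y' s = 0" using i(3) j(3) by (auto simp: prec_solution_def)
  have r_add: "r (\<lambda>v. y v + t * y' v) x = r y x + t * r y' x" for t x
    by (simp add: r_def resid_def sum.distrib sum_distrib_left sum_distrib_right algebra_simps)
  have resid_add: "resid p E a (\<lambda>v. y v + t * y' v) k = resid p E a y k + t * resid p E a y' k" for t k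
    by (simp add: resid_def sum.distrib sum_distrib_left algebra_simps)
  have z': "\<forall>s\<in>S. y s + t * y' s = 0" for t using z by simp
  \<comment> \<open>Polarisation: only second moments of single forms are available, and y + y' and
    y - y' again vanish on S.\<close>
  have P_eq: "P x = (r (\<lambda>v. y v + 1 * y' v) x)\<^sup>2 / 4 - (r (\<lambda>v. y v + (-1) * y' v) x)\<^sup>2 / 4" for x
    unfolding P_def r_add by (simp add: power2_eq_square field_simps)
  have Pi: "integrable M P"
    unfolding P_eq by (intro Bochner_Integration.integrable_diff integrable_divide moments(2) z')
  have P_int: "(\<integral>x. indicator B x * P x \<partial>M) = y j * prob B" if B: "B \<in> sets F" for B
  proof -
    have BM: "B \<in> sets M" using B sub by (auto simp: subalgebra_def)
    have "(\<integral>x. indicator B x * P x \<partial>M)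
      = (\<integral>x. indicator B x * (r (\<lambda>v. y v + 1 * y' v) x)\<^sup>2 / 4 - indicator B x * (r (\<lambda>v. y v + (-1) * y' v) x)\<^sup>2 / 4 \<partial>M)"
      unfolding P_eq by (simp add: right_diff_distrib)
    also have "\<dots> = (\<integral>x. indicator B x * (r (\<lambda>v. y v + 1 * y' v) x)\<^sup>2 \<partial>M) / 4
        - (\<integral>x. indicator B x * (r (\<lambda>v. y v + (-1) * y' v) x)\<^sup>2 \<partial>M) / 4"
      using integrable_mult_indicator[OF BM moments(2)[OF z'[of 1]]]
        integrable_mult_indicator[OF BM moments(2)[OF z'[of "-1"]]]
      by (subst Bochner_Integration.integral_diff) auto
    also have "\<dots> = (\<Sum>k<p. (resid p E a y k + 1 * resid p E a y' k)\<^sup>2 / 4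
        - (resid p E a y k + (-1) * resid p E a y' k)\<^sup>2 / 4) * prob B"
      unfolding moments(4)[OF z' B] resid_add
      by (simp add: sum_subtractf sum_divide_distrib[symmetric] left_diff_distrib)
    also have "(\<Sum>k<p. (resid p E a y k + 1 * resid p E a y' k)\<^sup>2 / 4
        - (resid p E a y k + (-1) * resid p E a y' k)\<^sup>2 / 4) = (\<Sum>k<p. resid p E a y k * resid p E a y' k)"
      by (intro sum.cong) (auto simp: power2_eq_square field_simps)
    also have "\<dots> = y j" by (rule prec_solution_inner[OF S j(1,2) i(3) j(3)])
    finally show ?thesis .
  qed
  define W where "W \<omega> = (sem_var E a i \<omega> - cexp p E a S (sem_var E a i) \<omega>) *
    (sem_var E a j \<omega> - cexp p E a S (sem_var E a j) \<omega>)" for \<omega>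
  have "AE x in M. W x = P x"
    using res[OF i] res[OF j] unfolding W_def P_def by eventually_elim simp
  moreover have sm: "sem_var E a l \<in> borel_measurable M" if "l < p" for l
    using sem_var_integrable[OF that] unfolding M_def by blast
  have "W \<in> borel_measurable M"
    unfolding W_def cexp_def F_def[symmetric] M_def[symmetric]
    by (intro borel_measurable_times borel_measurable_diff sm i(1) j(1) borel_measurable_cond_exp2)
  ultimately have 1: "AE x in M. real_cond_exp M F W x = real_cond_exp M F P x"
    using Pi by (intro real_cond_exp_cong) auto
  have 2: "AE x in M. real_cond_exp M F P x = y j"
  proof (rule real_cond_exp_charact)
    fix B assume B: "B \<in> sets F"
    then have "B \<in> sets M" using sub by (auto simp: subalgebra_def)
    then show "(\<integral>x\<in>B. P x \<partial>M) = (\<integral>x\<in>B. y j \<partial>M)"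
      using P_int[OF B] by (simp add: set_lebesgue_integral_def)
  qed (use Pi in auto)
  have val: "AE x in M. cexp p E a S W x = y j"
    unfolding cexp_def F_def[symmetric] M_def[symmetric] using 1 2 by eventually_elim simp
  show ?thesis
    unfolding cond_cov_def W_def[symmetric] M_def[symmetric]
  proof (rule the_equality)
    show "AE x in M. cexp p E a S W x = y j" by (rule val)
    \<comment> \<open>Two constants that agree almost everywhere on a probability space are equal,
      so the definite description denotes the value found.\<close>
    fix v assume "AE x in M. cexp p E a S W x = v"
    then have "AE x in M. v = y j" using val by eventually_elim simp
    then show "v = y j" by simp
  qed
qed

section \<open>Rational formula and d-connection\<close>

lemma polyfun_det:
  assumes "\<And>a. M a \<in> carrier_mat n n"
    and "\<And>i j. i < n \<Longrightarrow> j < n \<Longrightarrow> polyfun I (\<lambda>a. M a $$ (i, j))"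
  shows "polyfun I (\<lambda>a. Determinant.det (M a))"
proof -
  have "(\<lambda>a. Determinant.det (M a)) =
      (\<lambda>a. \<Sum>\<pi>\<in>{\<pi>. \<pi> permutes {0..<n}}. signof \<pi> * (\<Prod>i = 0..<n. M a $$ (i, \<pi> i)))"
  proof
    fix a
    have "dim_row (M a) = n" "dim_col (M a) = n" using assms(1)[of a] by auto
    then show "Determinant.det (M a) =
        (\<Sum>\<pi>\<in>{\<pi>. \<pi> permutes {0..<n}}. signof \<pi> * (\<Prod>i = 0..<n. M a $$ (i, \<pi> i)))"
      by (simp add: Determinant.det_def)
  qed
  moreover have "polyfun I (\<lambda>a. \<Sum>\<pi>\<in>{\<pi>. \<pi> permutes {0..<n}}. signof \<pi> * (\<Prod>i = 0..<n. M a $$ (i, \<pi> i)))"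
  proof (intro polyfun_sum polyfun_mult polyfun_const polyfun_prod)
    fix \<pi> i assume "\<pi> \<in> {\<pi>. \<pi> permutes {0..<n}}" "i \<in> {0..<n}"
    then show "polyfun I (\<lambda>a. M a $$ (i, \<pi> i))"
      using permutes_in_image[of \<pi> "{0..<n}" i] by (intro assms(2)) auto
  qed
  ultimately show ?thesis by simp
qed

lemma polyfun_adj:
  assumes M: "\<And>a. M a \<in> carrier_mat n n"
    and entry: "\<And>i j. i < n \<Longrightarrow> j < n \<Longrightarrow> polyfun I (\<lambda>a. M a $$ (i, j))"
    and ij: "i < n" "j < n"
  shows "polyfun I (\<lambda>a. adj_mat (M a) $$ (i, j))"
proof -
  have dim: "dim_row (M a) = n" "dim_col (M a) = n" for a using M[of a] by auto
  have "polyfun I (\<lambda>a. Determinant.det (mat_delete (M a) j i))"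
  proof (rule polyfun_det[where n = "n - 1"])
    show "mat_delete (M a) j i \<in> carrier_mat (n - 1) (n - 1)" for a
      by (simp add: mat_delete_def dim)
    show "polyfun I (\<lambda>a. mat_delete (M a) j i $$ (r, s))" if "r < n - 1" "s < n - 1" for r s
      using that entry by (simp add: mat_delete_def dim)
  qed
  then have "polyfun I (\<lambda>a. (-1) ^ (j + i) * Determinant.det (mat_delete (M a) j i))"
    by (intro polyfun_mult polyfun_const)
  then show ?thesis
    using ij by (simp add: adj_mat_def cofactor_def dim)
qed

lemma adj_mat_solves:
  fixes A :: "real mat"
  assumes A: "A \<in> carrier_mat n n" and d: "Determinant.det A \<noteq> 0" and "i < n" "u < n"
  shows "(\<Sum>v<n. A $$ (u, v) * (adj_mat A $$ (v, i) / Determinant.det A)) = (if u = i then 1 else 0)"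
proof -
  have adj: "adj_mat A \<in> carrier_mat n n" by (rule adj_mat(1)[OF A])
  have "(\<Sum>v<n. A $$ (u, v) * adj_mat A $$ (v, i)) = (A * adj_mat A) $$ (u, i)"
    using A adj assms by (auto simp: scalar_prod_def lessThan_atLeast0)
  also have "\<dots> = (if u = i then Determinant.det A else 0)"
    unfolding adj_mat(2)[OF A] using assms by simp
  finally have "(\<Sum>v<n. A $$ (u, v) * adj_mat A $$ (v, i)) / Determinant.det A = (if u = i then 1 else 0)"
    using d by simp
  then show ?thesis by (simp add: sum_divide_distrib)
qed

text \<open>Multiply A y = e_i by the adjugate. This turns an explicitly known solution into a value
  of the numerator polynomial.\<close>

lemma adj_mat_of_solution:
  fixes A :: "real mat"
  assumes A: "A \<in> carrier_mat n n" and "i < n" "j < n"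
    and sol: "\<And>u. u < n \<Longrightarrow> (\<Sum>v<n. A $$ (u, v) * y v) = (if u = i then 1 else 0)"
  shows "adj_mat A $$ (j, i) = Determinant.det A * y j"
proof -
  have adj: "adj_mat A \<in> carrier_mat n n" by (rule adj_mat(1)[OF A])
  have prod: "(\<Sum>u<n. adj_mat A $$ (j, u) * A $$ (u, v)) = (if j = v then Determinant.det A else 0)"
    if "v < n" for v
  proof -
    have "(\<Sum>u<n. adj_mat A $$ (j, u) * A $$ (u, v)) = (adj_mat A * A) $$ (j, v)"
      using A adj assms that by (auto simp: scalar_prod_def lessThan_atLeast0)
    then show ?thesis unfolding adj_mat(3)[OF A] using assms that by simp
  qed
  have "adj_mat A $$ (j, i) = (\<Sum>u<n. adj_mat A $$ (j, u) * (if u = i then 1 else 0))"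
  proof -
    have "(\<Sum>u<n. adj_mat A $$ (j, u) * (if u = i then 1 else 0)) = (\<Sum>u<n. if u = i then adj_mat A $$ (j, u) else 0)"
      by (intro sum.cong) auto
    then show ?thesis using assms(2) by simp
  qed
  also have "\<dots> = (\<Sum>u<n. \<Sum>v<n. adj_mat A $$ (j, u) * A $$ (u, v) * y v)"
    using sol[symmetric] by (intro sum.cong) (auto simp: sum_distrib_left mult.assoc)
  also have "\<dots> = (\<Sum>v<n. \<Sum>u<n. adj_mat A $$ (j, u) * A $$ (u, v) * y v)" by (rule sum.swap)
  also have "\<dots> = (\<Sum>v<n. if j = v then Determinant.det A * y v else 0)"
    using prod by (intro sum.cong) (auto simp: sum_distrib_right[symmetric])
  also have "\<dots> = Determinant.det A * y j" using assms(3) by simp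
  finally show ?thesis .
qed

lemma det_nonzero_if_injective:
  fixes A :: "real mat"
  assumes A: "A \<in> carrier_mat n n"
    and inj: "\<And>x. (\<And>u. u < n \<Longrightarrow> (\<Sum>v<n. A $$ (u, v) * x v) = 0) \<Longrightarrow> (\<forall>v<n. x v = 0)"
  shows "Determinant.det A \<noteq> 0"
proof
  assume "Determinant.det A = 0"
  then obtain w where w: "w \<in> carrier_vec n" "w \<noteq> 0\<^sub>v n" "A *\<^sub>v w = 0\<^sub>v n"
    using det_0_iff_vec_prod_zero[OF A] by blast
  have "(\<Sum>v<n. A $$ (u, v) * w $ v) = 0" if "u < n" for u
  proof -
    have "(\<Sum>v<n. A $$ (u, v) * w $ v) = (A *\<^sub>v w) $ u"
      using A w(1) that by (auto simp: scalar_prod_def lessThan_atLeast0)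
    then show ?thesis using w(3) that by simp
  qed
  then have "\<forall>v<n. w $ v = 0" by (rule inj)
  then have "w = 0\<^sub>v n" using w(1) by (intro eq_vecI) auto
  then show False using w(2) by simp
qed

text \<open>The precision matrix of \<open>X\<close> conditioned on \<open>X\<^sub>S\<close>, padded with the identity on \<open>S\<close>.
  The weight \<open>\<sigma>\<close> multiplies the contributions \<open>u \<rightarrow> s \<leftarrow> v\<close> of colliders \<open>s \<in> S\<close>; the value
  \<open>\<sigma> = 1\<close> belongs to the model, while for \<open>\<sigma> = -1\<close> and nonnegative edge weights the inverse is a
  sum over d-connecting walks without cancellation.\<close>

definition prec_mat ::
    "nat \<Rightarrow> (nat \<times> nat) set \<Rightarrow> nat set \<Rightarrow> real \<Rightarrow> (nat \<times> nat \<Rightarrow> real) \<Rightarrow> real mat" where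
  "prec_mat p E S \<sigma> a = mat p p (\<lambda>(u, v).
     if u \<in> S \<or> v \<in> S then (if u = v then 1 else 0)
     else (\<Sum>k<p. (if k \<in> S then \<sigma> else 1) * L_entry E a u k * L_entry E a v k))"

lemma prec_mat_carrier: "prec_mat p E S \<sigma> a \<in> carrier_mat p p"
  by (simp add: prec_mat_def)

lemma prec_mat_mult:
  assumes "u < p"
  shows "(\<Sum>v<p. prec_mat p E S \<sigma> a $$ (u, v) * y v) =
    (if u \<in> S then y u else (\<Sum>k<p. (if k \<in> S then \<sigma> else 1) * L_entry E a u k *
       (\<Sum>v\<in>{..<p} - S. L_entry E a v k * y v)))"
proof (cases "u \<in> S")
  case True
  have "(\<Sum>v<p. prec_mat p E S \<sigma> a $$ (u, v) * y v) = (\<Sum>v<p. if u = v then y v else 0)"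
    using assms True by (intro sum.cong) (auto simp: prec_mat_def)
  then show ?thesis using assms True by simp
next
  case False
  have "(\<Sum>v<p. prec_mat p E S \<sigma> a $$ (u, v) * y v)
      = (\<Sum>v\<in>{..<p} - S. prec_mat p E S \<sigma> a $$ (u, v) * y v)"
    using assms False by (intro sum.mono_neutral_right) (auto simp: prec_mat_def)
  also have "\<dots> = (\<Sum>v\<in>{..<p} - S. \<Sum>k<p. (if k \<in> S then \<sigma> else 1) * L_entry E a u k * (L_entry E a v k * y v))"
    using assms False by (intro sum.cong) (auto simp: prec_mat_def sum_distrib_right mult.assoc)
  also have "\<dots> = (\<Sum>k<p. \<Sum>v\<in>{..<p} - S. (if k \<in> S then \<sigma> else 1) * L_entry E a u k * (L_entry E a v k * y v))"
    by (rule sum.swap)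
  also have "\<dots> = (\<Sum>k<p. (if k \<in> S then \<sigma> else 1) * L_entry E a u k * (\<Sum>v\<in>{..<p} - S. L_entry E a v k * y v))"
    by (simp only: sum_distrib_left)
  finally show ?thesis using False by simp
qed

lemma prec_mat_kernel_zero:
  assumes S: "S \<subseteq> {..<p}" and x: "\<And>u. u < p \<Longrightarrow> (\<Sum>v<p. prec_mat p E S \<sigma> a $$ (u, v) * x v) = 0"
    and s: "s \<in> S"
  shows "x s = 0"
  using x[of s] prec_mat_mult[of s p E S \<sigma> a x] S s by auto

text \<open>The identity rows of the padded matrix enforce y = 0 on S, so both requirements become
  one square system of size p, and the vertices off S keep their numbers.\<close>

lemma prec_solution_iff:
  assumes "S \<subseteq> {..<p}" "i < p" "i \<notin> S"
  shows "prec_solution p E S a i y \<longleftrightarrow>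
    (\<forall>u<p. (\<Sum>v<p. prec_mat p E S 1 a $$ (u, v) * y v) = (if u = i then 1 else 0))"
proof -
  have row: "(\<Sum>v<p. prec_mat p E S 1 a $$ (u, v) * y v)
      = (if u \<in> S then y u else (\<Sum>k<p. L_entry E a u k * resid p E a y k))"
    if "u < p" "\<forall>s\<in>S. y s = 0" for u
  proof -
    have "(\<Sum>v\<in>{..<p} - S. L_entry E a v k * y v) = resid p E a y k" for k
      unfolding resid_def using that(2) by (intro sum.mono_neutral_left) auto
    then show ?thesis unfolding prec_mat_mult[OF that(1)] by simp
  qed
  have zero: "\<forall>s\<in>S. y s = 0"
    if "\<forall>u<p. (\<Sum>v<p. prec_mat p E S 1 a $$ (u, v) * y v) = (if u = i then 1 else 0)"
  proof
    fix s assume "s \<in> S"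
    then have "s < p" "s \<noteq> i" using assms by auto
    then show "y s = 0" using that prec_mat_mult[of s p E S 1 a y] \<open>s \<in> S\<close> by simp
  qed
  show ?thesis
  proof
    assume sol: "prec_solution p E S a i y"
    show "\<forall>u<p. (\<Sum>v<p. prec_mat p E S 1 a $$ (u, v) * y v) = (if u = i then 1 else 0)"
    proof (intro allI impI)
      fix u assume "u < p"
      then show "(\<Sum>v<p. prec_mat p E S 1 a $$ (u, v) * y v) = (if u = i then 1 else 0)"
        using sol row[of u] assms(3) by (auto simp: prec_solution_def)
    qed
  next
    assume eqs: "\<forall>u<p. (\<Sum>v<p. prec_mat p E S 1 a $$ (u, v) * y v) = (if u = i then 1 else 0)"
    note z = zero[OF eqs]
    show "prec_solution p E S a i y"
      unfolding prec_solution_def using z row[OF _ z] eqs by simp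
  qed
qed

definition cov_num ::
    "nat \<Rightarrow> (nat \<times> nat) set \<Rightarrow> nat \<Rightarrow> nat \<Rightarrow> nat set \<Rightarrow> (nat \<times> nat \<Rightarrow> real) \<Rightarrow> real" where
  "cov_num p E i j S a = adj_mat (prec_mat p E S 1 a) $$ (j, i)"

definition cov_den :: "nat \<Rightarrow> (nat \<times> nat) set \<Rightarrow> nat set \<Rightarrow> (nat \<times> nat \<Rightarrow> real) \<Rightarrow> real" where
  "cov_den p E S a = Determinant.det (prec_mat p E S 1 a)"

lemma resid_eq_0_imp:
  assumes "ordered_dag p E" "\<And>k. k < p \<Longrightarrow> resid p E a y k = 0" "v < p"
  shows "y v = 0"
proof -
  have "y v = sem_var E a v (resid p E a y)" using sem_var_resid[OF assms(1,3)] by simp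
  also have "\<dots> = sem_var E a v (resid p E a (\<lambda>_. 0))"
    using assms(2,3) by (intro sem_var_cong) (auto simp: resid_def)
  also have "\<dots> = 0" using sem_var_resid[OF assms(1,3)] by simp
  finally show ?thesis .
qed

text \<open>Positive definiteness: for x in the kernel the quadratic form is the squared norm of (I
  - A)^T x, so this vector is 0, and x = 0 because the structural equations recover x from
  it.\<close>

lemma cov_den_nonzero:
  assumes dag: "ordered_dag p E" and S: "S \<subseteq> {..<p}"
  shows "cov_den p E S a \<noteq> 0"
  unfolding cov_den_def
proof (rule det_nonzero_if_injective[OF prec_mat_carrier])
  fix x assume x: "\<And>u. u < p \<Longrightarrow> (\<Sum>v<p. prec_mat p E S 1 a $$ (u, v) * x v) = 0"
  note xS = prec_mat_kernel_zero[OF S x]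
  have res: "(\<Sum>v\<in>{..<p} - S. L_entry E a v k * x v) = resid p E a x k" for k
    unfolding resid_def using xS by (intro sum.mono_neutral_left) auto
  have row: "(\<Sum>k<p. L_entry E a u k * resid p E a x k) = 0" if "u \<in> {..<p} - S" for u
    using x[of u] that prec_mat_mult[of u p E S 1 a x] by (simp add: res)
  have "(\<Sum>k<p. (resid p E a x k)\<^sup>2) = (\<Sum>k<p. (\<Sum>v\<in>{..<p} - S. L_entry E a v k * x v) * resid p E a x k)"
    by (simp add: res power2_eq_square)
  also have "\<dots> = (\<Sum>k<p. \<Sum>v\<in>{..<p} - S. x v * (L_entry E a v k * resid p E a x k))"
    by (intro sum.cong refl, subst sum_distrib_right) (simp add: mult_ac)
  also have "\<dots> = (\<Sum>v\<in>{..<p} - S. \<Sum>k<p. x v * (L_entry E a v k * resid p E a x k))" by (rule sum.swap)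
  also have "\<dots> = 0" using row by (simp add: sum_distrib_left[symmetric])
  finally have "\<forall>k<p. resid p E a x k = 0" by (simp add: sum_nonneg_eq_0_iff)
  then show "\<forall>v<p. x v = 0" using resid_eq_0_imp[OF dag] by blast
qed

lemma prec_solution_adj:
  assumes dag: "ordered_dag p E" and S: "S \<subseteq> {..<p}" and i: "i < p" "i \<notin> S"
  shows "prec_solution p E S a i (\<lambda>v. adj_mat (prec_mat p E S 1 a) $$ (v, i) / cov_den p E S a)"
  unfolding prec_solution_iff[OF S i] cov_den_def
  using adj_mat_solves[OF prec_mat_carrier cov_den_nonzero[OF dag S, unfolded cov_den_def] i(1)]
  by blast

lemma cond_cov_eq_quotient:
  assumes dag: "ordered_dag p E" and S: "S \<subseteq> {..<p}" and ij: "i < p" "i \<notin> S" "j < p" "j \<notin> S"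
  shows "cond_cov p E i j S a = cov_num p E i j S a / cov_den p E S a"
proof -
  note sol = prec_solution_adj[OF dag S, of _ a]
  show ?thesis
    unfolding cov_num_def
    by (rule cond_cov_eq_prec_solution[OF dag S ij(1,2) sol[OF ij(1,2)] ij(3,4) sol[OF ij(3,4)]])
qed

lemma polyfun_L_entry: "polyfun E (\<lambda>a. L_entry E a u k)"
proof (cases "(u, k) \<in> E")
  case True
  then show ?thesis
    unfolding L_entry_def edge_coeff_def by (simp add: polyfun_diff polyfun_const polyfun_var)
next
  case False
  then show ?thesis unfolding L_entry_def edge_coeff_def by (simp add: polyfun_const)
qed

lemma polyfun_prec_mat:
  assumes "u < p" "v < p"
  shows "polyfun E (\<lambda>a. prec_mat p E S \<sigma> a $$ (u, v))"
proof (cases "u \<in> S \<or> v \<in> S")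
  case True
  then show ?thesis using assms by (simp add: prec_mat_def polyfun_const)
next
  case False
  then show ?thesis using assms
    by (simp add: prec_mat_def) (intro polyfun_sum polyfun_mult polyfun_const polyfun_L_entry)
qed

lemma polyfun_cov_den: "polyfun E (cov_den p E S)"
  unfolding cov_den_def[abs_def]
  by (rule polyfun_det[OF prec_mat_carrier]) (rule polyfun_prec_mat)

lemma polyfun_cov_num:
  assumes "i < p" "j < p"
  shows "polyfun E (cov_num p E i j S)"
  unfolding cov_num_def[abs_def]
  by (rule polyfun_adj[OF prec_mat_carrier polyfun_prec_mat assms(2,1)])

section \<open>Walk expansion and positivity under d-connection\<close>

lemma weighted_sum_bound:
  fixes f g :: "nat \<Rightarrow> real"
  assumes A: "card A \<le> n" "0 < n" and f: "\<And>c. 0 \<le> f c" "\<And>c. f c \<le> 1 / (4 * real n)"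
    and g: "\<And>c. c \<in> A \<Longrightarrow> \<bar>g c\<bar> \<le> b" and b: "0 \<le> b"
  shows "\<bar>\<Sum>c\<in>A. f c * g c\<bar> \<le> b / 4"
proof -
  have "\<bar>\<Sum>c\<in>A. f c * g c\<bar> \<le> (\<Sum>c\<in>A. \<bar>f c * g c\<bar>)" by (rule sum_abs)
  also have "\<dots> \<le> (\<Sum>c\<in>A. 1 / (4 * real n) * b)"
    unfolding abs_mult using f g b by (intro sum_mono mult_mono) auto
  also have "\<dots> = real (card A) * (1 / (4 * real n) * b)" by simp
  also have "\<dots> \<le> real n * (1 / (4 * real n) * b)" using A b by (intro mult_right_mono) auto
  also have "\<dots> = b / 4" using A by simp
  finally show ?thesis .
qed

text \<open>The least nonnegative solution of the walk equations: \<open>z\<close> collects walks from \<open>i\<close> arriving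
  against an edge (or the empty walk), \<open>y\<close> all walks ending outside \<open>S\<close>, and \<open>w\<close> walks ending
  with an edge into \<open>S\<close>.\<close>

lemma walk_equations_solvable:
  fixes e :: "nat \<Rightarrow> nat \<Rightarrow> real"
  assumes fin: "finite W" "finite S" and n: "card W \<le> n" "card S \<le> n" "0 < n"
    and e: "\<And>u v. 0 \<le> e u v" "\<And>u v. e u v \<le> 1 / (4 * real n)"
  shows "\<exists>z y w. (\<forall>v. 0 \<le> z v \<and> 0 \<le> y v \<and> 0 \<le> w v) \<and>
    (\<forall>v\<in>W. z v = (if v = i then 1 else 0) + (\<Sum>c\<in>W. e v c * z c) + (\<Sum>s\<in>S. e v s * w s)) \<and>
    (\<forall>v\<in>W. y v = (\<Sum>u\<in>W. e u v * y u) + z v) \<and>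
    (\<forall>s\<in>S. w s = (\<Sum>u\<in>W. e u s * y u))"
proof -
  \<comment> \<open>Over the extended nonnegative reals the least fixed point exists by monotonicity
    alone. The tags 0, 1, 2 hold the components z, y, w.\<close>
  define \<Phi> :: "(nat \<times> nat \<Rightarrow> ennreal) \<Rightarrow> (nat \<times> nat \<Rightarrow> ennreal)" where
    "\<Phi> g = (\<lambda>(m, v).
      if m = 0 then (if v = i then 1 else 0) + (\<Sum>c\<in>W. ennreal (e v c) * g (0, c)) + (\<Sum>s\<in>S. ennreal (e v s) * g (2, s))
      else if m = 1 then (\<Sum>u\<in>W. ennreal (e u v) * g (1, u)) + g (0, v)
      else (\<Sum>u\<in>W. ennreal (e u v) * g (1, u)))" for g
  have mono: "mono \<Phi>"
    unfolding mono_def le_fun_def \<Phi>_def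
    by (auto intro!: add_mono sum_mono mult_left_mono)
  \<comment> \<open>Finiteness of the least fixed point. Weights at most 1/(4n) shrink a sum of at
    most n terms by 4, and (2, 4, 1) is a supersolution since 1 + 2/4 + 1/4 \<le> 2, 4/4 + 2 \<le> 4
    and 4/4 \<le> 1.\<close>
  define G :: "nat \<times> nat \<Rightarrow> ennreal" where
    "G = (\<lambda>(m, v). if m = 0 then ennreal 2 else if m = 1 then ennreal 4 else ennreal 1)"
  have bnd: "(\<Sum>c\<in>A. ennreal (f c) * ennreal b) \<le> ennreal (b / 4)"
    if A: "finite A" "card A \<le> n" and f: "\<And>c. 0 \<le> f c" "\<And>c. f c \<le> 1 / (4 * real n)" and b: "0 \<le> b"
    for A :: "nat set" and f b
  proof -
    have "(\<Sum>c\<in>A. f c * b) \<le> b / 4"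
      using weighted_sum_bound[OF A(2) n(3), of f "\<lambda>_. b" b] f b by simp
    moreover have "(\<Sum>c\<in>A. ennreal (f c) * ennreal b) = ennreal (\<Sum>c\<in>A. f c * b)"
      using f b by (subst sum_ennreal[symmetric]) (auto simp: ennreal_mult)
    ultimately show ?thesis by (simp add: ennreal_leI)
  qed
  have "\<Phi> G \<le> G"
  proof (rule le_funI)
    fix x :: "nat \<times> nat"
    obtain m v where x: "x = (m, v)" by (cases x)
    consider "m = 0" | "m = 1" | "m \<noteq> 0" "m \<noteq> 1" by blast
    then show "\<Phi> G x \<le> G x"
    proof cases
      case 1
      have "\<Phi> G x = (if v = i then 1 else 0) + (\<Sum>c\<in>W. ennreal (e v c) * ennreal 2)
          + (\<Sum>s\<in>S. ennreal (e v s) * ennreal 1)"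
        by (simp add: x \<Phi>_def G_def 1 del: ennreal_numeral ennreal_1)
      also have "\<dots> \<le> ennreal 1 + ennreal (2 / 4) + ennreal (1 / 4)"
        by (intro add_mono bnd fin n e) auto
      also have "\<dots> = ennreal (1 + 2 / 4 + 1 / 4)"
        by (subst ennreal_plus, simp, simp, subst ennreal_plus, simp, simp, rule refl)
      also have "\<dots> \<le> ennreal 2" by (rule ennreal_leI) simp
      finally show ?thesis using 1 by (simp add: x G_def)
    next
      case 2
      have "\<Phi> G x = (\<Sum>u\<in>W. ennreal (e u v) * ennreal 4) + ennreal 2"
        by (simp add: x \<Phi>_def G_def 2 del: ennreal_numeral ennreal_1)
      also have "\<dots> \<le> ennreal (4 / 4) + ennreal 2"
        by (intro add_mono bnd fin n e) auto
      also have "\<dots> = ennreal (4 / 4 + 2)" by (rule ennreal_plus[symmetric]) simp_all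
      also have "\<dots> \<le> ennreal 4" by (rule ennreal_leI) simp
      finally show ?thesis using 2 by (simp add: x G_def)
    next
      case 3
      have "\<Phi> G x \<le> ennreal (4 / 4)"
        unfolding x \<Phi>_def G_def using 3 bnd[OF fin(1) n(1), of "\<lambda>u. e u v" 4] e by auto
      then show ?thesis using 3 by (simp add: x G_def)
    qed
  qed
  then have le: "lfp \<Phi> \<le> G" by (rule lfp_lowerbound)
  define r where "r m v = enn2real (lfp \<Phi> (m, v))" for m v
  have r: "lfp \<Phi> (m, v) = ennreal (r m v)" for m v
  proof -
    have "lfp \<Phi> (m, v) \<le> G (m, v)" using le by (simp add: le_fun_def)
    also have "\<dots> < (top_class.top :: ennreal)" by (simp add: G_def)
    finally show ?thesis unfolding r_def by simp
  qed
  have r0: "0 \<le> r m v" for m v by (simp add: r_def)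
  have fx: "ennreal (r m v) = \<Phi> (\<lambda>(m, v). ennreal (r m v)) (m, v)" for m v
  proof -
    have "lfp \<Phi> = (\<lambda>(m, v). ennreal (r m v))" using r by auto
    then show ?thesis using fun_cong[OF lfp_unfold[OF mono], of "(m, v)"] by simp
  qed
  have sumr: "(\<Sum>c\<in>A. ennreal (f c) * ennreal (g c)) = ennreal (\<Sum>c\<in>A. f c * g c)"
    if "\<And>c. 0 \<le> f c" "\<And>c. 0 \<le> g c" for A :: "nat set" and f g
  proof -
    have "(\<Sum>c\<in>A. ennreal (f c) * ennreal (g c)) = (\<Sum>c\<in>A. ennreal (f c * g c))"
      by (intro sum.cong refl ennreal_mult[symmetric] that)
    also have "\<dots> = ennreal (\<Sum>c\<in>A. f c * g c)"
      by (intro sum_ennreal mult_nonneg_nonneg that)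
    finally show ?thesis .
  qed
  have nn: "0 \<le> (\<Sum>c\<in>A. f c * r m c)" if "\<And>c. 0 \<le> f c" for A :: "nat set" and f m
    using that r0 by (intro sum_nonneg mult_nonneg_nonneg)
  have eq0: "r 0 v = (if v = i then 1 else 0) + (\<Sum>c\<in>W. e v c * r 0 c) + (\<Sum>s\<in>S. e v s * r 2 s)" for v
  proof -
    have "ennreal (r 0 v) = (if v = i then 1 else 0) + ennreal (\<Sum>c\<in>W. e v c * r 0 c) + ennreal (\<Sum>s\<in>S. e v s * r 2 s)"
      unfolding fx[of 0 v] \<Phi>_def using e r0 by (simp add: sumr)
    also have "\<dots> = ennreal ((if v = i then 1 else 0) + (\<Sum>c\<in>W. e v c * r 0 c) + (\<Sum>s\<in>S. e v s * r 2 s))"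
      using nn e by (simp add: ennreal_plus add_nonneg_nonneg)
    finally show ?thesis using r0 nn e by (subst (asm) ennreal_inj) (auto intro!: add_nonneg_nonneg)
  qed
  have eq1: "r 1 v = (\<Sum>u\<in>W. e u v * r 1 u) + r 0 v" for v
  proof -
    have "ennreal (r 1 v) = ennreal (\<Sum>u\<in>W. e u v * r 1 u) + ennreal (r 0 v)"
      unfolding fx[of 1 v] \<Phi>_def using e r0 by (simp add: sumr)
    also have "\<dots> = ennreal ((\<Sum>u\<in>W. e u v * r 1 u) + r 0 v)"
      using nn e r0 by (simp add: ennreal_plus)
    finally show ?thesis using r0 nn e by (subst (asm) ennreal_inj) (auto intro!: add_nonneg_nonneg)
  qed
  have eq2: "r 2 v = (\<Sum>u\<in>W. e u v * r 1 u)" for v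
  proof -
    have "ennreal (r 2 v) = ennreal (\<Sum>u\<in>W. e u v * r 1 u)"
      unfolding fx[of 2 v] \<Phi>_def using e r0 by (simp add: sumr)
    then show ?thesis using r0 nn e by (subst (asm) ennreal_inj) auto
  qed
  show ?thesis
    by (rule exI[of _ "r 0"], rule exI[of _ "r 1"], rule exI[of _ "r 2"])
      (use r0 eq0 eq1 eq2 in blast)
qed

text \<open>Positivity is carried along an open path from i to j. The only difficult turn is at a
  collider outside S: there a directed path to S, followed down and back, makes the walk arrive
  against an edge, after which it may continue backwards.\<close>

lemma walk_positive:
  fixes z y w :: "nat \<Rightarrow> real" and e :: "nat \<Rightarrow> nat \<Rightarrow> real"
  assumes dag: "ordered_dag p E" and S: "S \<subseteq> {..<p}" and ij: "i < p" "i \<notin> S" "j < p" "j \<notin> S"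
  defines "W \<equiv> {..<p} - S"
  assumes e: "\<And>u v. (u, v) \<in> E \<Longrightarrow> 0 < e u v" "\<And>u v. 0 \<le> e u v"
    and nn: "\<And>v. 0 \<le> z v \<and> 0 \<le> y v \<and> 0 \<le> w v"
    and z: "\<And>v. v \<in> W \<Longrightarrow> z v = (if v = i then 1 else 0) + (\<Sum>c\<in>W. e v c * z c) + (\<Sum>s\<in>S. e v s * w s)"
    and y: "\<And>v. v \<in> W \<Longrightarrow> y v = (\<Sum>u\<in>W. e u v * y u) + z v"
    and w: "\<And>s. s \<in> S \<Longrightarrow> w s = (\<Sum>u\<in>W. e u s * y u)"
    and con: "\<not> d_separated E i j S"
  shows "0 < y j"
proof -
  have fin: "finite W" "finite S" using S by (auto simp: W_def intro: finite_subset)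
  have sum_pos: "0 < (\<Sum>u\<in>A. f u * g u)"
    if "finite A" "u0 \<in> A" "0 < f u0" "0 < g u0" "\<And>u. 0 \<le> f u" "\<And>u. 0 \<le> g u"
    for A :: "nat set" and f g :: "nat \<Rightarrow> real" and u0
  proof -
    have "f u0 * g u0 \<le> (\<Sum>u\<in>A. f u * g u)"
      using that by (intro member_le_sum) auto
    then show ?thesis using mult_pos_pos[OF that(3,4)] by linarith
  qed
  have sum_nn: "0 \<le> (\<Sum>u\<in>A. f u * g u)" if "\<And>u. 0 \<le> f u" "\<And>u. 0 \<le> g u"
    for A :: "nat set" and f g :: "nat \<Rightarrow> real"
    using that by (intro sum_nonneg mult_nonneg_nonneg)
  have nn': "0 \<le> z v" "0 \<le> y v" "0 \<le> w v" for v using nn[of v] by auto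
  have E_lt: "u < v" "v < p" "u < p" if "(u, v) \<in> E" for u v
    using dag that unfolding ordered_dag_def by force+
  have P1: "0 < z i"
    using z[of i] ij sum_nn[of "e i" z W] sum_nn[of "e i" w S] nn' e(2) by (simp add: W_def)
  have P2: "0 < z u" if "(u, c) \<in> E" "u \<in> W" "c \<in> W" "0 < z c" for u c
    using z[OF that(2)] sum_pos[OF fin(1) that(3), of "e u" z] sum_nn[of "e u" w S] nn' e that
    by (simp add: add_pos_nonneg add_nonneg_pos)
  have P3: "0 < z u" if "(u, s) \<in> E" "u \<in> W" "s \<in> S" "0 < w s" for u s
    using z[OF that(2)] sum_pos[OF fin(2) that(3), of "e u" w] sum_nn[of "e u" z W] nn' e that
    by (simp add: add_pos_nonneg add_nonneg_pos)
  have P4: "0 < y v" if "v \<in> W" "0 < z v" for v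
    using y[OF that(1)] sum_nn[of "\<lambda>u. e u v" y W] nn' e(2) that by (simp add: add_nonneg_pos)
  have P5: "0 < y v" if "(u, v) \<in> E" "u \<in> W" "v \<in> W" "0 < y u" for u v
    using y[OF that(3)] sum_pos[OF fin(1) that(2), of "\<lambda>u. e u v" y] nn' e that
    by (simp add: add_pos_nonneg)
  have P6: "0 < w s" if "(u, s) \<in> E" "u \<in> W" "s \<in> S" "0 < y u" for u s
    using w[OF that(3)] sum_pos[OF fin(1) that(2), of "\<lambda>u. e u s" y] nn' e that by simp
  \<comment> \<open>The detour below a collider. The directed path may meet S before s; then the
    walk turns round at that earlier vertex.\<close>
  have P7: "v \<in> W \<Longrightarrow> 0 < y v \<Longrightarrow> 0 < z v" if "(v, s) \<in> E\<^sup>+" "s \<in> S" for v s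
    using that(1)
  proof (induction rule: converse_trancl_induct)
    case (base v)
    then show ?case using P6 P3 that(2) by blast
  next
    case (step v u)
    show ?case
    proof (cases "u \<in> S")
      case True
      then show ?thesis using P6 P3 step by blast
    next
      case False
      then have "u \<in> W" using E_lt[OF step.hyps(1)] by (simp add: W_def)
      then show ?thesis using P5 P2 step by blast
    qed
  qed
  obtain xs where path: "skeleton_path E i j xs"
    and open_path: "\<And>n. 0 < n \<Longrightarrow> n + 1 < length xs \<Longrightarrow>
      \<not> ((\<not> collider_at E xs n \<and> xs ! n \<in> S) \<or>
         (collider_at E xs n \<and> xs ! n \<notin> S \<and> (\<forall>s\<in>S. (xs ! n, s) \<notin> E\<^sup>+)))"
    using con unfolding d_separated_def by blast
  have xs: "xs \<noteq> []" "xs ! 0 = i" "xs ! (length xs - 1) = j"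
    and adj: "\<And>n. Suc n < length xs \<Longrightarrow> adjacent E (xs ! n) (xs ! Suc n)"
    using path by (auto simp: skeleton_path_def hd_conv_nth last_conv_nth)
  \<comment> \<open>The invariant records the direction of arrival: after a backward step, or at the
    start, z is positive too, and then a further backward step makes no collider.\<close>
  have "n < length xs \<Longrightarrow>
      (xs ! n \<in> W \<and> 0 < y (xs ! n) \<or> xs ! n \<in> S \<and> 0 < w (xs ! n)) \<and>
      (n = 0 \<or> (xs ! n, xs ! (n - 1)) \<in> E \<longrightarrow> xs ! n \<in> W \<and> 0 < z (xs ! n))" for n
  proof (induction n)
    case 0
    then show ?case using xs ij P1 P4 by (simp add: W_def)
  next
    case (Suc n)
    then have IH: "xs ! n \<in> W \<and> 0 < y (xs ! n) \<or> xs ! n \<in> S \<and> 0 < w (xs ! n)"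
      "n = 0 \<or> (xs ! n, xs ! (n - 1)) \<in> E \<Longrightarrow> xs ! n \<in> W \<and> 0 < z (xs ! n)" by auto
    have notS: "xs ! m \<notin> S" if "m = 0 \<or> m = length xs - 1 \<or> \<not> collider_at E xs m" "m < length xs" for m
    proof (cases "m = 0 \<or> m = length xs - 1")
      case True
      then show ?thesis using xs ij by auto
    next
      case False
      then have "0 < m" "m + 1 < length xs" using that(2) by auto
      then show ?thesis using that(1) False open_path[of m] by blast
    qed
    show ?case
    proof (cases "(xs ! n, xs ! Suc n) \<in> E")
      case True
      note lt = E_lt[OF True]
      have nback: "(xs ! Suc n, xs ! n) \<notin> E" using lt E_lt by (meson less_asym)
      have "xs ! n \<notin> S"
        using notS[of n] Suc.prems nback by (auto simp: collider_at_def)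
      then have "xs ! n \<in> W" "0 < y (xs ! n)" using IH(1) by auto
      moreover have "xs ! Suc n \<in> W \<or> xs ! Suc n \<in> S" using lt by (auto simp: W_def)
      ultimately show ?thesis using P5[OF True] P6[OF True] nback by auto
    next
      case False
      then have redge: "(xs ! Suc n, xs ! n) \<in> E"
        using adj[OF Suc.prems] by (auto simp: adjacent_def)
      have "xs ! Suc n \<notin> S"
        using notS[of "Suc n"] Suc.prems False by (auto simp: collider_at_def)
      then have W1: "xs ! Suc n \<in> W" using E_lt[OF redge] by (simp add: W_def)
      have "0 < z (xs ! Suc n)"
      proof (cases "n = 0 \<or> (xs ! n, xs ! (n - 1)) \<in> E")
        case True
        then show ?thesis using IH(2) P2[OF redge W1] by blast
      next
        case arrow: False
        have n: "0 < n" "n + 1 < length xs" using arrow Suc.prems by auto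
        have "adjacent E (xs ! (n - 1)) (xs ! n)" using adj[of "n - 1"] n by simp
        then have "(xs ! (n - 1), xs ! n) \<in> E" using arrow by (auto simp: adjacent_def)
        then have col: "collider_at E xs n" using redge by (simp add: collider_at_def)
        show ?thesis
        proof (cases "xs ! n \<in> S")
          case True
          then have "0 < w (xs ! n)" using IH(1) by (auto simp: W_def)
          then show ?thesis using P3[OF redge W1 True] by blast
        next
          case False
          then obtain s where "s \<in> S" "(xs ! n, s) \<in> E\<^sup>+" using open_path[OF n] col by blast
          moreover have "xs ! n \<in> W" "0 < y (xs ! n)" using IH(1) False by auto
          ultimately show ?thesis using P7 P2[OF redge W1] by blast
        qed
      qed
      then show ?thesis using W1 P4 by blast
    qed
  qed
  from this[of "length xs - 1"] show ?thesis using xs ij by (auto simp: W_def)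
qed

text \<open>Applying (I - A)^T to x gives z off S and -w on S. The weight -1 cancels the minus sign
  on S, and multiplying by I - A then subtracts both sums; setting the result to a unit vector gives
  exactly the walk equations with positive terms.\<close>

lemma prec_mat_mult_walk:
  assumes dag: "ordered_dag p E" and S: "S \<subseteq> {..<p}" and u: "u \<in> {..<p} - S"
  defines "W \<equiv> {..<p} - S"
  assumes z: "\<And>v. v \<in> W \<Longrightarrow> z v = x v - (\<Sum>c\<in>W. edge_coeff E a c v * x c)"
    and w: "\<And>s. s \<in> S \<Longrightarrow> w s = (\<Sum>c\<in>W. edge_coeff E a c s * x c)"
  shows "(\<Sum>v<p. prec_mat p E S (-1) a $$ (u, v) * x v)
    = z u - (\<Sum>c\<in>W. edge_coeff E a u c * z c) - (\<Sum>s\<in>S. edge_coeff E a u s * w s)"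
proof -
  have fin: "finite W" "finite S" using S by (auto simp: W_def intro: finite_subset)
  have uW: "u < p" "u \<notin> S" "u \<in> W" using u by (auto simp: W_def)
  have inner: "(\<Sum>v\<in>W. L_entry E a v k * x v) = (if k \<in> S then - w k else z k)" if "k < p" for k
  proof -
    have "(\<Sum>v\<in>W. L_entry E a v k * x v) = (\<Sum>v\<in>W. if v = k then x v else 0) - (\<Sum>v\<in>W. edge_coeff E a v k * x v)"
      unfolding sum_subtractf[symmetric] by (intro sum.cong) (auto simp: L_entry_def algebra_simps)
    then show ?thesis using fin z[of k] w[of k] that by (auto simp: W_def)
  qed
  have "(\<Sum>v<p. prec_mat p E S (-1) a $$ (u, v) * x v)
      = (\<Sum>k<p. (if k \<in> S then -1 else 1) * L_entry E a u k * (\<Sum>v\<in>W. L_entry E a v k * x v))"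
    using prec_mat_mult[OF uW(1), of E S "-1" a x] uW(2) by (simp add: W_def)
  also have "\<dots> = (\<Sum>k<p. if k \<in> S then L_entry E a u k * w k else L_entry E a u k * z k)"
    using inner by (intro sum.cong) auto
  also have "\<dots> = (\<Sum>k\<in>W. L_entry E a u k * z k) + (\<Sum>k\<in>S. L_entry E a u k * w k)"
    using S by (subst sum.If_cases) (auto simp: W_def Diff_eq Int_absorb1 Int_commute add.commute intro!: arg_cong2[of _ _ _ _ "(+)"] sum.cong)
  also have "(\<Sum>k\<in>W. L_entry E a u k * z k) = (\<Sum>k\<in>W. if u = k then z k else 0) - (\<Sum>k\<in>W. edge_coeff E a u k * z k)"
    unfolding sum_subtractf[symmetric] by (intro sum.cong) (auto simp: L_entry_def algebra_simps)
  also have "(\<Sum>k\<in>W. if u = k then z k else 0) = z u" using fin uW by simp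
  also have "(\<Sum>k\<in>S. L_entry E a u k * w k) = - (\<Sum>k\<in>S. edge_coeff E a u k * w k)"
    unfolding sum_negf[symmetric] using uW by (intro sum.cong) (auto simp: L_entry_def)
  finally show ?thesis by simp
qed

lemma det_prec_mat_minus_one:
  assumes dag: "ordered_dag p E" and S: "S \<subseteq> {..<p}" and W0: "{..<p} - S \<noteq> {}"
    and e: "\<And>u v. 0 \<le> edge_coeff E a u v" "\<And>u v. edge_coeff E a u v \<le> 1 / (4 * real p)"
  shows "Determinant.det (prec_mat p E S (-1) a) \<noteq> 0"
proof (rule det_nonzero_if_injective[OF prec_mat_carrier])
  fix x assume x: "\<And>u. u < p \<Longrightarrow> (\<Sum>v<p. prec_mat p E S (-1) a $$ (u, v) * x v) = 0"
  define W where "W = {..<p} - S"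
  have fin: "finite W" "finite S" and W: "W \<noteq> {}" using S W0 by (auto simp: W_def intro: finite_subset)
  have p0: "0 < p" using W0 by auto
  have card: "card W \<le> p" "card S \<le> p"
    using card_mono[of "{..<p}" W] card_mono[of "{..<p}" S] S by (auto simp: W_def)
  note xS = prec_mat_kernel_zero[OF S x]
  define z where "z v = x v - (\<Sum>c\<in>W. edge_coeff E a c v * x c)" for v
  define w where "w s = (\<Sum>c\<in>W. edge_coeff E a c s * x c)" for s
  have eqz: "z u = (\<Sum>c\<in>W. edge_coeff E a u c * z c) + (\<Sum>s\<in>S. edge_coeff E a u s * w s)" if "u \<in> W" for u
    using prec_mat_mult_walk[OF dag S, of u z x a w] x[of u] that by (simp add: W_def z_def w_def)
  note bnd = weighted_sum_bound[OF _ p0]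
  define X where "X = Max ((\<lambda>v. \<bar>x v\<bar>) ` W)"
  define Z where "Z = Max ((\<lambda>v. \<bar>z v\<bar>) ` W)"
  have X: "\<bar>x v\<bar> \<le> X" and Z: "\<bar>z v\<bar> \<le> Z" if "v \<in> W" for v
    using fin that by (auto simp: X_def Z_def)
  obtain v0 where "v0 \<in> W" using W by blast
  then have nn: "0 \<le> X" "0 \<le> Z" using X[of v0] Z[of v0] by linarith+
  have wb: "\<bar>w s\<bar> \<le> X / 4" for s
    unfolding w_def using X nn by (intro bnd card e)
  have "Z \<le> Z / 4 + X / 4 / 4"
  proof -
    have "Z \<in> (\<lambda>v. \<bar>z v\<bar>) ` W" unfolding Z_def using fin W by (intro Max_in) auto
    then obtain u where u: "u \<in> W" "Z = \<bar>z u\<bar>" by blast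
    have "\<bar>\<Sum>c\<in>W. edge_coeff E a u c * z c\<bar> \<le> Z / 4" using Z nn by (intro bnd card e)
    moreover have "\<bar>\<Sum>s\<in>S. edge_coeff E a u s * w s\<bar> \<le> X / 4 / 4"
      using wb nn by (intro bnd card e) auto
    ultimately show ?thesis using eqz[OF u(1)] u(2) by linarith
  qed
  moreover have "X \<le> X / 4 + Z"
  proof -
    have "X \<in> (\<lambda>v. \<bar>x v\<bar>) ` W" unfolding X_def using fin W by (intro Max_in) auto
    then obtain u where u: "u \<in> W" "X = \<bar>x u\<bar>" by blast
    have "\<bar>\<Sum>c\<in>W. edge_coeff E a c u * x c\<bar> \<le> X / 4" using X nn by (intro bnd card e)
    then show ?thesis using Z[OF u(1)] u(2) z_def[of u] by linarith
  qed
  ultimately have "X \<le> 0" by linarith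
  then have "x v = 0" if "v \<in> W" for v using X[OF that] by linarith
  then show "\<forall>v<p. x v = 0" using xS by (auto simp: W_def)
qed

theorem cov_num_nonzero:
  assumes dag: "ordered_dag p E" and S: "S \<subseteq> {..<p}" and ij: "i < p" "i \<notin> S" "j < p" "j \<notin> S"
    and con: "\<not> d_separated E i j S"
  shows "\<exists>a. cov_num p E i j S a \<noteq> 0"
proof -
  define W where "W = {..<p} - S"
  have fin: "finite W" "finite S" using S by (auto simp: W_def intro: finite_subset)
  have card: "card W \<le> p" "card S \<le> p" and p0: "0 < p"
    using card_mono[of "{..<p}" W] card_mono[of "{..<p}" S] S ij by (auto simp: W_def)
  \<comment> \<open>Positive on every edge, for positivity of the walk sums, and small enough for
    their convergence.\<close>
  define a :: "nat \<times> nat \<Rightarrow> real" where "a = (\<lambda>_. 1 / (4 * real p))"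
  define e where "e = edge_coeff E a"
  have e: "0 \<le> e u v" "e u v \<le> 1 / (4 * real p)" "(u, v) \<in> E \<Longrightarrow> 0 < e u v" for u v
    using p0 by (auto simp: e_def edge_coeff_def a_def)
  from walk_equations_solvable[of W S p e i, OF fin card p0 e(1,2)] obtain z y w where zyw:
    "(\<forall>v. 0 \<le> z v \<and> 0 \<le> y v \<and> 0 \<le> w v) \<and>
    (\<forall>v\<in>W. z v = (if v = i then 1 else 0) + (\<Sum>c\<in>W. e v c * z c) + (\<Sum>s\<in>S. e v s * w s)) \<and>
    (\<forall>v\<in>W. y v = (\<Sum>u\<in>W. e u v * y u) + z v) \<and>
    (\<forall>s\<in>S. w s = (\<Sum>u\<in>W. e u s * y u))"
    by (elim exE)
  have nn: "0 \<le> z v \<and> 0 \<le> y v \<and> 0 \<le> w v" for v using zyw by blast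
  have z: "z v = (if v = i then 1 else 0) + (\<Sum>c\<in>W. e v c * z c) + (\<Sum>s\<in>S. e v s * w s)" if "v \<in> W" for v
    using zyw that by blast
  have y: "y v = (\<Sum>u\<in>W. e u v * y u) + z v" if "v \<in> W" for v using zyw that by blast
  have w: "w s = (\<Sum>u\<in>W. e u s * y u)" if "s \<in> S" for s using zyw that by blast
  have yj: "0 < y j"
    by (rule walk_positive[OF dag S ij e(3,1) nn z[unfolded W_def] y[unfolded W_def] w[unfolded W_def] con])
  define y' where "y' v = (if v \<in> W then y v else 0)" for v
  have sum_y': "(\<Sum>c\<in>W. f c * y' c) = (\<Sum>c\<in>W. f c * y c)" for f
    by (intro sum.cong) (auto simp: y'_def)
  have sol: "(\<Sum>v<p. prec_mat p E S (-1) a $$ (u, v) * y' v) = (if u = i then 1 else 0)" if "u < p" for u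
  proof (cases "u \<in> S")
    case True
    then show ?thesis
      using prec_mat_mult[OF that, of E S "-1" a y'] ij by (auto simp: y'_def W_def)
  next
    case False
    then have uW: "u \<in> W" using that by (simp add: W_def)
    have "(\<Sum>v<p. prec_mat p E S (-1) a $$ (u, v) * y' v)
        = z u - (\<Sum>c\<in>W. edge_coeff E a u c * z c) - (\<Sum>s\<in>S. edge_coeff E a u s * w s)"
      unfolding W_def
    proof (rule prec_mat_mult_walk[OF dag S])
      show "u \<in> {..<p} - S" using uW by (simp add: W_def)
      show "z v = y' v - (\<Sum>c\<in>{..<p} - S. edge_coeff E a c v * y' c)" if "v \<in> {..<p} - S" for v
        using y[of v] that unfolding W_def[symmetric] sum_y' e_def by (simp add: y'_def)
      show "w s = (\<Sum>c\<in>{..<p} - S. edge_coeff E a c s * y' c)" if "s \<in> S" for s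
        using w[OF that] unfolding W_def[symmetric] sum_y' e_def by simp
    qed
    then show ?thesis using z[OF uW] by (simp add: e_def)
  qed
  have det: "Determinant.det (prec_mat p E S (-1) a) \<noteq> 0"
    using ij e(1,2) by (intro det_prec_mat_minus_one[OF dag S]) (auto simp: e_def)
  \<comment> \<open>The way back from imaginary to real weights: f is a polynomial in \<sigma>,
    nonzero at -1, so it has finitely many roots and is nonzero at some \<sigma> in (0, 1), where a
    real square root exists.\<close>
  define f where "f \<sigma> = adj_mat (prec_mat p E S \<sigma> a) $$ (j, i)" for \<sigma>
  have "f (-1) = Determinant.det (prec_mat p E S (-1) a) * y' j"
    unfolding f_def by (rule adj_mat_of_solution[OF prec_mat_carrier ij(1,3) sol])
  then have fm1: "f (-1) \<noteq> 0" using det yj ij by (simp add: y'_def W_def)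
  \<comment> \<open>One variable, indexed by the unit type. Splitting it off leaves coefficients
    over the empty index set, that is, constants.\<close>
  have "polyfun {()} (\<lambda>x. f (x ()))"
    unfolding f_def
  proof (rule polyfun_adj[OF prec_mat_carrier _ ij(3,1)])
    fix u v assume uv: "u < p" "v < p"
    have weight: "polyfun {()} (\<lambda>x. if k \<in> S then x () else 1)" for k :: nat
      by (cases "k \<in> S") (auto intro: polyfun_var polyfun_const)
    show "polyfun {()} (\<lambda>x. prec_mat p E S (x ()) a $$ (u, v))"
    proof (cases "u \<in> S \<or> v \<in> S")
      case True
      then show ?thesis using uv by (simp add: prec_mat_def polyfun_const)
    next
      case False
      then show ?thesis using uv
        by (simp add: prec_mat_def) (intro polyfun_sum polyfun_mult polyfun_const weight)
    qed
  qed
  then obtain P where P: "\<And>k. polyfun {} (\<lambda>x. coeff (P x) k)" "\<And>x. f (x ()) = poly (P x) (x ())"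
    using polyfun_insert_poly[of "()" "{}" "\<lambda>x. f (x ())"] by blast
  define q where "q = P (\<lambda>_. 0)"
  have "P x = q" for x
    unfolding q_def by (rule poly_eqI) (rule polyfun_cong_on[OF P(1)], simp)
  then have fq: "f \<sigma> = poly q \<sigma>" for \<sigma> using P(2)[of "\<lambda>_. \<sigma>"] by simp
  then have "q \<noteq> 0" using fm1 by auto
  then have "finite {\<sigma>. poly q \<sigma> = 0}" by (rule poly_roots_finite)
  moreover have "infinite {0<..<1::real}" by simp
  ultimately obtain \<sigma> where \<sigma>: "0 < \<sigma>" "\<sigma> < 1" "f \<sigma> \<noteq> 0"
    unfolding fq by (metis (mono_tags, lifting) finite_subset greaterThanLessThan_iff mem_Collect_eq subsetI)
  \<comment> \<open>For rows u outside S the diagonal entry of a column k in S does not occur, so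
    scaling the weights into k scales that column of I - A uniformly, and each product of two of its
    entries gains the factor \<sigma>.\<close>
  define a' where "a' = (\<lambda>(u, k). (if k \<in> S then sqrt \<sigma> else 1) * a (u, k))"
  have "prec_mat p E S 1 a' = prec_mat p E S \<sigma> a"
  proof -
    have L: "L_entry E a' u k = (if k \<in> S then sqrt \<sigma> else 1) * L_entry E a u k" if "u \<notin> S" for u k
      using that by (auto simp: L_entry_def edge_coeff_def a'_def)
    have entry: "1 * L_entry E a' u k * L_entry E a' v k
        = (if k \<in> S then \<sigma> else 1) * L_entry E a u k * L_entry E a v k" if "u \<notin> S" "v \<notin> S" for u v k
      using \<sigma>(1) that by (simp add: L)
    then show ?thesis unfolding prec_mat_def
      by (intro cong_mat) auto
  qed
  then have "cov_num p E i j S a' = f \<sigma>" by (simp add: cov_num_def f_def)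
  then show ?thesis using \<sigma>(3) by metis
qed

section \<open>Volume bounds\<close>

lemma finite_edges: "ordered_dag p E \<Longrightarrow> finite E"
  by (rule finite_subset[of _ "{..<p} \<times> {..<p}"]) (force simp: ordered_dag_def)+

lemma finite_triples: "finite (triples p)"
  by (rule finite_subset[of _ "{..<p} \<times> {..<p} \<times> Pow {..<p}"]) (auto simp: triples_def)

lemma cube_bounded: "a \<in> cube E \<Longrightarrow> e \<in> E \<Longrightarrow> \<bar>a e\<bar> \<le> 1"
  by (force simp: cube_def PiE_iff)

lemma sem_var_bound:
  assumes a: "\<And>e. e \<in> E \<Longrightarrow> \<bar>a e\<bar> \<le> 1" and x: "\<And>k. k \<le> j \<Longrightarrow> \<bar>x k\<bar> \<le> M" and M: "0 \<le> M"
  shows "\<bar>sem_var E a j x\<bar> \<le> 2 ^ j * M"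
  using x
proof (induction j rule: less_induct)
  case (less j)
  have coef: "\<bar>edge_coeff E a i j\<bar> \<le> 1" for i using a by (simp add: edge_coeff_def)
  have geo: "(\<Sum>i<n. (2::real) ^ i) + 1 = 2 ^ n" for n by (induction n) auto
  have "\<bar>sem_var E a j x\<bar> \<le> \<bar>\<Sum>i<j. edge_coeff E a i j * sem_var E a i x\<bar> + \<bar>x j\<bar>"
    unfolding sem_var.simps[of E a j] by (rule abs_triangle_ineq)
  also have "\<bar>\<Sum>i<j. edge_coeff E a i j * sem_var E a i x\<bar> \<le> (\<Sum>i<j. \<bar>edge_coeff E a i j * sem_var E a i x\<bar>)"
    by (rule sum_abs)
  also have "\<dots> \<le> (\<Sum>i<j. 1 * (2 ^ i * M))"
    unfolding abs_mult using less coef M by (intro sum_mono mult_mono) auto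
  also have "\<dots> + \<bar>x j\<bar> \<le> (\<Sum>i<j. 1 * (2 ^ i * M)) + M" using less.prems by simp
  also have "\<dots> = ((\<Sum>i<j. 2 ^ i) + 1) * M" by (simp add: sum_distrib_right distrib_right)
  also have "\<dots> = 2 ^ j * M" by (simp only: geo)
  finally show ?case by simp
qed

locale sem_cube =
  fixes p :: nat and E :: "(nat \<times> nat) set"
  assumes dag: "ordered_dag p E"
begin

text \<open>A self-improving estimate: y_i is the squared norm Q of (I - A)^T y, while solving the
  structural equations gives |y_l| \<le> 2^p * sqrt Q for every l. Taking l = i yields sqrt Q \<le>
  2^p, and hence the bound 4^p.\<close>

lemma prec_solution_bound:
  assumes S: "S \<subseteq> {..<p}" and i: "i < p" "i \<notin> S" and y: "prec_solution p E S a i y" and a: "a \<in> cube E"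
    and j: "j < p"
  shows "0 < y i" "\<bar>y j\<bar> \<le> 4 ^ p"
proof -
  define Q where "Q = (\<Sum>k<p. (resid p E a y k)\<^sup>2)"
  have yi: "y i = Q"
    using prec_solution_inner[OF S i y y] by (simp add: Q_def power2_eq_square)
  have Q0: "0 \<le> Q" unfolding Q_def by (intro sum_nonneg) auto
  have "Q \<noteq> 0"
  proof
    assume "Q = 0"
    then have "\<forall>k<p. resid p E a y k = 0" by (simp add: Q_def sum_nonneg_eq_0_iff)
    then have "(\<Sum>k<p. L_entry E a i k * resid p E a y k) = 0" by simp
    then show False using y i by (auto simp: prec_solution_def)
  qed
  then show "0 < y i" using Q0 yi by simp
  have rk: "\<bar>resid p E a y k\<bar> \<le> sqrt Q" if "k < p" for k
  proof -
    have "(resid p E a y k)\<^sup>2 \<le> Q" unfolding Q_def using that by (intro member_le_sum) auto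
    then show ?thesis by (metis real_sqrt_abs real_sqrt_le_mono)
  qed
  have ybound: "\<bar>y l\<bar> \<le> 2 ^ p * sqrt Q" if "l < p" for l
  proof -
    have "\<bar>y l\<bar> = \<bar>sem_var E a l (resid p E a y)\<bar>" using sem_var_resid[OF dag that] by simp
    also have "\<dots> \<le> 2 ^ l * sqrt Q"
      using cube_bounded[OF a] rk that Q0 by (intro sem_var_bound) auto
    also have "\<dots> \<le> 2 ^ p * sqrt Q" using that Q0 by (intro mult_right_mono power_increasing) auto
    finally show ?thesis .
  qed
  have "sqrt Q * sqrt Q \<le> 2 ^ p * sqrt Q" using ybound[OF i(1)] Q0 yi by simp
  then have "sqrt Q \<le> 2 ^ p" by (rule mult_right_le_imp_le) (use Q0 \<open>Q \<noteq> 0\<close> in simp)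
  then have "2 ^ p * sqrt Q \<le> 2 ^ p * 2 ^ p" by (intro mult_left_mono) auto
  also have "\<dots> = (4::real) ^ p" by (simp add: power_mult_distrib[symmetric])
  finally show "\<bar>y j\<bar> \<le> 4 ^ p" using ybound[OF j] by simp
qed

lemma cond_cov_bound:
  assumes "S \<subseteq> {..<p}" "i < p" "i \<notin> S" "j < p" "j \<notin> S" "a \<in> cube E"
  shows "\<bar>cond_cov p E i j S a\<bar> \<le> 4 ^ p"
proof -
  obtain y y' where y: "prec_solution p E S a i y" "prec_solution p E S a j y'"
    using prec_solution_adj[OF dag assms(1)] assms(2-5) by blast
  have "cond_cov p E i j S a = y j"
    by (rule cond_cov_eq_prec_solution[OF dag assms(1-3) y(1) assms(4,5) y(2)])
  then show ?thesis using prec_solution_bound(2)[OF assms(1-3) y(1) assms(6,4)] by simp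
qed

lemma cond_var_bounds:
  assumes "S \<subseteq> {..<p}" "i < p" "i \<notin> S" "a \<in> cube E"
  shows "0 < cond_var p E i S a" "cond_var p E i S a \<le> 4 ^ p"
proof -
  obtain y where y: "prec_solution p E S a i y"
    using prec_solution_adj[OF dag assms(1-3)] by blast
  have "cond_var p E i S a = y i"
    unfolding cond_var_def
    by (rule cond_cov_eq_prec_solution[OF dag assms(1-3) y assms(2,3) y])
  then show "0 < cond_var p E i S a" using prec_solution_bound(1)[OF assms(1-3) y assms(4,2)] by simp
  show "cond_var p E i S a \<le> 4 ^ p"
    using cond_cov_bound[OF assms(1-3) assms(2,3,4)] by (simp add: cond_var_def)
qed

lemma cube_measurable: "cube E \<in> sets (lborel_on E)"
  unfolding cube_def by (rule cube_in_sets[OF finite_edges[OF dag]])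

lemma emeasure_cube: "emeasure (lborel_on E) (cube E) < top_class.top"
proof -
  interpret product_sigma_finite "\<lambda>_ :: nat \<times> nat. lborel :: real measure" by standard
  have "emeasure (lborel_on E) (cube E) = (\<Prod>e\<in>E. emeasure lborel {-1..1::real})"
    unfolding cube_def by (rule emeasure_PiM[OF finite_edges[OF dag]]) auto
  also have "\<dots> < top_class.top" by (simp add: ennreal_prod_eq_top less_top[symmetric] power_eq_top_ennreal)
  finally show ?thesis .
qed

lemma measurable_cond_cov:
  assumes "S \<subseteq> {..<p}" "i < p" "i \<notin> S" "j < p" "j \<notin> S"
  shows "cond_cov p E i j S \<in> borel_measurable (lborel_on E)"
  unfolding cond_cov_eq_quotient[OF dag assms, abs_def]
  by (intro borel_measurable_divide polyfun_measurable polyfun_cov_num polyfun_cov_den assms)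

lemma P_set_in_sets:
  assumes "(i, j, S) \<in> triples p"
  shows "P_set p E l i j S \<in> sets (lborel_on E)"
proof -
  have t: "S \<subseteq> {..<p}" "i < p" "i \<notin> S" "j < p" "j \<notin> S" using assms by (auto simp: triples_def)
  note [measurable] = measurable_cond_cov[OF t] measurable_cond_cov[OF t(1-3) t(2,3)]
    measurable_cond_cov[OF t(1,4,5) t(4,5)]
  show ?thesis
    unfolding P_set_def cond_var_def cube_def
    by (rule cube_Collect_in_sets[OF finite_edges[OF dag]]) measurable
qed

lemma P_set_subset_cube: "P_set p E l i j S \<subseteq> cube E"
  by (auto simp: P_set_def)

lemma fmeasurable_Union_P_set:
  assumes "T \<subseteq> triples p"
  shows "(\<Union>(i, j, S)\<in>T. P_set p E l i j S) \<in> fmeasurable (lborel_on E)"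
proof (rule fmeasurableI2)
  show "cube E \<in> fmeasurable (lborel_on E)"
    using cube_measurable emeasure_cube by (auto simp: fmeasurable_def)
  show "(\<Union>(i, j, S)\<in>T. P_set p E l i j S) \<subseteq> cube E" using P_set_subset_cube by fast
  show "(\<Union>(i, j, S)\<in>T. P_set p E l i j S) \<in> sets (lborel_on E)"
    using assms P_set_in_sets finite_subset[OF assms finite_triples]
    by (intro sets.finite_UN) auto
qed

text \<open>At zero weights K is the identity and the unit vector e_i solves the system. So the
  origin is a zero common to all numerators, the reference zero that the Lojasiewicz argument
  needs.\<close>

lemma cov_num_origin:
  assumes "S \<subseteq> {..<p}" "i < p" "i \<notin> S" "j < p" "i \<noteq> j" and a: "\<And>e. e \<in> E \<Longrightarrow> a e = 0"
  shows "cov_num p E i j S a = 0"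
proof -
  have L: "L_entry E a u k = (if u = k then 1 else 0)" for u k
    using a by (simp add: L_entry_def edge_coeff_def)
  have "(\<Sum>v<p. prec_mat p E S 1 a $$ (u, v) * (if v = i then 1 else 0)) = (if u = i then 1 else 0)"
    if "u < p" for u
  proof -
    have "(\<Sum>v\<in>{..<p} - S. L_entry E a v k * (if v = i then 1 else 0)) = (if k = i then 1 else 0)" for k
    proof -
      have "(\<Sum>v\<in>{..<p} - S. L_entry E a v k * (if v = i then 1 else 0))
          = (\<Sum>v\<in>{..<p} - S. if v = i then (if k = i then 1 else 0) else 0)"
        by (intro sum.cong) (auto simp: L)
      then show ?thesis using assms by simp
    qed
    moreover have "(\<Sum>k<p. L_entry E a u k * (if k = i then 1 else 0)) = (if u = i then 1 else 0)"
    proof -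
      have "(\<Sum>k<p. L_entry E a u k * (if k = i then 1 else 0)) = (\<Sum>k<p. if k = i then (if u = i then 1 else 0) else 0)"
        by (intro sum.cong) (auto simp: L)
      then show ?thesis using assms by simp
    qed
    ultimately show ?thesis using assms(3) unfolding prec_mat_mult[OF that] by auto
  qed
  from adj_mat_of_solution[OF prec_mat_carrier assms(2,4) this] assms(5)
  show ?thesis by (simp add: cov_num_def)
qed

text \<open>Dividing by the bound \<open>4 ^ p\<close> puts the base of the power into \<open>[0, 1]\<close>, so that the
  condition is preserved when \<open>k\<close> decreases.\<close>

definition triple_bounds :: "nat \<Rightarrow> nat \<Rightarrow> nat set \<Rightarrow> real \<Rightarrow> real \<Rightarrow> bool" where
  "triple_bounds i j S c k \<longleftrightarrow> 0 < c \<and> 0 < k \<and>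
     (\<forall>a\<in>cube E. euclid_infdist E a (V_set p E i j S) \<le> c * (\<bar>cond_cov p E i j S a\<bar> / 4 ^ p) powr k) \<and>
     (\<not> d_separated E i j S \<longrightarrow> (\<forall>l. 0 < l \<and> l < 1 \<longrightarrow> vol E (P_set p E l i j S) \<le> c * l powr k))"

lemma powr_bound_mono:
  fixes c x k :: real
  assumes "b \<le> c * x powr k" "0 < c" "c \<le> c'" "k' \<le> k" "0 \<le> x" "x \<le> 1"
  shows "b \<le> c' * x powr k'"
proof -
  have "x powr k \<le> x powr k'" using assms by (cases "x = 0") (auto intro!: powr_mono')
  then have "c * x powr k \<le> c' * x powr k'" using assms by (intro mult_mono) auto
  then show ?thesis using assms(1) by linarith
qed

lemma triple_boundsI:
  assumes t: "(i, j, S) \<in> triples p"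
    and 1: "0 < c" "0 < k" "c \<le> c''" "k'' \<le> k"
      "\<And>a. a \<in> cube E \<Longrightarrow> euclid_infdist E a (V_set p E i j S) \<le> c * (\<bar>cond_cov p E i j S a\<bar> / 4 ^ p) powr k"
    and 2: "0 < c'" "0 < k'" "c' \<le> c''" "k'' \<le> k'"
      "\<And>l. \<not> d_separated E i j S \<Longrightarrow> 0 < l \<Longrightarrow> l < 1 \<Longrightarrow> vol E (P_set p E l i j S) \<le> c' * l powr k'"
    and k: "0 < k''"
  shows "triple_bounds i j S c'' k''"
proof -
  have t': "S \<subseteq> {..<p}" "i < p" "i \<notin> S" "j < p" "j \<notin> S" using t by (auto simp: triples_def)
  have "\<bar>cond_cov p E i j S a\<bar> / 4 ^ p \<le> 1" if "a \<in> cube E" for a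
    using cond_cov_bound[OF t' that] by simp
  then show ?thesis unfolding triple_bounds_def
    using 1(1,3) k by (auto intro!: powr_bound_mono[OF 1(5) 1(1,3,4)] powr_bound_mono[OF 2(5) 2(1,3,4)])
qed

lemma triple_bounds_mono:
  assumes b: "triple_bounds i j S c k" and "c \<le> c'" "0 < k'" "k' \<le> k"
    and t: "(i, j, S) \<in> triples p"
  shows "triple_bounds i j S c' k'"
  by (rule triple_boundsI[OF t, of c k c' k' c k]) (use b assms in \<open>auto simp: triple_bounds_def\<close>)

text \<open>The denominator is bounded on the cube, so one factor transfers both the volume bound
  and the distance bound from the numerator to the normalised covariance.\<close>

lemma cov_num_le:
  assumes t: "(i, j, S) \<in> triples p"
  obtains s where "0 < s"
    "\<And>a. a \<in> cube E \<Longrightarrow> \<bar>cov_num p E i j S a\<bar> \<le> s * (\<bar>cond_cov p E i j S a\<bar> / 4 ^ p)"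
proof -
  have t': "S \<subseteq> {..<p}" "i < p" "i \<notin> S" "j < p" "j \<notin> S" using t by (auto simp: triples_def)
  obtain B where B: "1 \<le> B" "\<And>x. (\<forall>e\<in>E. \<bar>x e\<bar> \<le> 1) \<Longrightarrow> \<bar>cov_den p E S x\<bar> \<le> B"
    using polyfun_cube_bounded[OF polyfun_cov_den] by blast
  have "\<bar>cov_num p E i j S a\<bar> \<le> (B * 4 ^ p) * (\<bar>cond_cov p E i j S a\<bar> / 4 ^ p)" if a: "a \<in> cube E" for a
  proof -
    have "\<bar>cov_num p E i j S a\<bar> = \<bar>cov_den p E S a\<bar> * \<bar>cond_cov p E i j S a\<bar>"
      using cov_den_nonzero[OF dag t'(1)] by (simp add: cond_cov_eq_quotient[OF dag t'] abs_divide)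
    also have "\<dots> \<le> B * \<bar>cond_cov p E i j S a\<bar>"
      using B(2)[of a] cube_bounded[OF a] by (intro mult_right_mono) auto
    finally show ?thesis by simp
  qed
  then show ?thesis using that[of "B * 4 ^ p"] B(1) by simp
qed

lemma vol_bound:
  assumes t: "(i, j, S) \<in> triples p" and nd: "\<not> d_separated E i j S"
  shows "\<exists>c k. 0 < c \<and> 0 < k \<and> (\<forall>l. 0 < l \<and> l < 1 \<longrightarrow> vol E (P_set p E l i j S) \<le> c * l powr k)"
proof -
  have t': "S \<subseteq> {..<p}" "i < p" "i \<notin> S" "j < p" "j \<notin> S" using t by (auto simp: triples_def)
  obtain s where s: "0 < s"
    "\<And>a. a \<in> cube E \<Longrightarrow> \<bar>cov_num p E i j S a\<bar> \<le> s * (\<bar>cond_cov p E i j S a\<bar> / 4 ^ p)"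
    using cov_num_le[OF t] by blast
  define f where "f a = (1 / s) * cov_num p E i j S a" for a
  have pf: "polyfun E f"
    unfolding f_def[abs_def] by (intro polyfun_mult polyfun_const polyfun_cov_num t')
  obtain x0 where "cov_num p E i j S x0 \<noteq> 0" using cov_num_nonzero[OF dag t' nd] by blast
  then have f0: "f x0 \<noteq> 0" using s(1) by (simp add: f_def)
  from polyfun_sublevel[OF finite_edges[OF dag] pf f0] obtain c k where ck:
    "c > 0 \<and> k > 0 \<and> (\<forall>\<delta>. 0 < \<delta> \<and> \<delta> \<le> 1 \<longrightarrow>
      emeasure (lborel_on E) {x \<in> E \<rightarrow>\<^sub>E {-1..1}. \<bar>f x\<bar> \<le> \<delta>} \<le> ennreal (c * \<delta> powr k))"
    by (elim exE)
  have "vol E (P_set p E l i j S) \<le> c * l powr k" if l: "0 < l" "l < 1" for l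
  proof -
    have "P_set p E l i j S \<subseteq> {x \<in> E \<rightarrow>\<^sub>E {-1..1}. \<bar>f x\<bar> \<le> l}" (is "_ \<subseteq> ?A")
    proof
      fix a assume a: "a \<in> P_set p E l i j S"
      then have ac: "a \<in> cube E" by (simp add: P_set_def)
      have "\<bar>cond_cov p E i j S a\<bar> \<le> l * sqrt (cond_var p E i S a * cond_var p E j S a)"
        using a by (simp add: P_set_def)
      also have "sqrt (cond_var p E i S a * cond_var p E j S a) \<le> sqrt (4 ^ p * 4 ^ p)"
        using cond_var_bounds[OF t'(1-3) ac] cond_var_bounds[OF t'(1,4,5) ac]
        by (intro real_sqrt_le_mono mult_mono) auto
      also have "\<dots> = 4 ^ p" by simp
      finally have "\<bar>cond_cov p E i j S a\<bar> \<le> l * 4 ^ p" using l by simp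
      then have "\<bar>cond_cov p E i j S a\<bar> / 4 ^ p \<le> l" by (simp add: pos_divide_le_eq)
      then have "s * (\<bar>cond_cov p E i j S a\<bar> / 4 ^ p) \<le> s * l" using s(1) by (intro mult_left_mono) auto
      then have "\<bar>cov_num p E i j S a\<bar> \<le> l * s" using s(2)[OF ac] by (simp add: mult.commute)
      then have "\<bar>f a\<bar> \<le> l"
        using s(1) by (simp add: f_def abs_mult pos_divide_le_eq)
      then show "a \<in> ?A" using ac by (simp add: cube_def)
    qed
    moreover have "?A \<in> sets (lborel_on E)"
      using polyfun_measurable[OF pf] by (intro cube_Collect_in_sets finite_edges[OF dag]) auto
    ultimately have "emeasure (lborel_on E) (P_set p E l i j S) \<le> emeasure (lborel_on E) ?A"
      by (intro emeasure_mono)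
    also have "\<dots> \<le> ennreal (c * l powr k)" using ck l by simp
    finally show ?thesis
      unfolding vol_def measure_def using ck by (intro enn2real_leI) auto
  qed
  then show ?thesis using ck by blast
qed

text \<open>As the denominator has no zeros, the covariance and its numerator vanish at the same
  points of the cube. The factor relating their sizes goes into the constant.\<close>

lemma lojasiewicz_cond_cov:
  assumes t: "(i, j, S) \<in> triples p"
  shows "\<exists>c k. 0 < c \<and> 0 < k \<and>
    (\<forall>a\<in>cube E. euclid_infdist E a (V_set p E i j S) \<le> c * (\<bar>cond_cov p E i j S a\<bar> / 4 ^ p) powr k)"
proof -
  have t': "S \<subseteq> {..<p}" "i < p" "i \<notin> S" "j < p" "j \<notin> S" and ij: "i \<noteq> j"
    using t by (auto simp: triples_def)
  obtain s where s: "0 < s"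
    "\<And>a. a \<in> cube E \<Longrightarrow> \<bar>cov_num p E i j S a\<bar> \<le> s * (\<bar>cond_cov p E i j S a\<bar> / 4 ^ p)"
    using cov_num_le[OF t] by blast
  define a0 :: "nat \<times> nat \<Rightarrow> real" where "a0 = (\<lambda>e\<in>E. 0)"
  have a0: "a0 \<in> E \<rightarrow>\<^sub>E {-1..1}" by (auto simp: a0_def)
  have num0: "cov_num p E i j S a0 = 0"
    by (rule cov_num_origin[OF t'(1-4) ij]) (simp add: a0_def)
  obtain m where m: "1 \<le> m" and near: "\<forall>x\<in>E \<rightarrow>\<^sub>E {-1..1}. \<exists>z\<in>E \<rightarrow>\<^sub>E {-1..1}. cov_num p E i j S z = 0 \<and>
    L2_set (\<lambda>v. x v - z v) E \<le> real m * \<bar>cov_num p E i j S x\<bar> powr (1 / real m)"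
    using lojasiewicz_cube[OF finite_edges[OF dag] polyfun_cov_num[OF t'(2,4)] a0 num0] by blast
  have "euclid_infdist E a (V_set p E i j S)
      \<le> (real m * s powr (1 / real m)) * (\<bar>cond_cov p E i j S a\<bar> / 4 ^ p) powr (1 / real m)"
    if a: "a \<in> cube E" for a
  proof -
    obtain z where z: "z \<in> E \<rightarrow>\<^sub>E {-1..1}" "cov_num p E i j S z = 0"
      "L2_set (\<lambda>v. a v - z v) E \<le> real m * \<bar>cov_num p E i j S a\<bar> powr (1 / real m)"
      using near a unfolding cube_def by blast
    have zV: "z \<in> V_set p E i j S"
      using z by (simp add: V_set_def cube_def cond_cov_eq_quotient[OF dag t'])
    have "euclid_infdist E a (V_set p E i j S) \<le> euclid_dist E a z"
      unfolding euclid_infdist_def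
      by (rule cINF_lower[OF _ zV]) (auto intro!: bdd_belowI[of _ 0] simp: euclid_dist_def L2_set_nonneg)
    also have "\<dots> \<le> real m * \<bar>cov_num p E i j S a\<bar> powr (1 / real m)"
      using z(3) by (simp add: euclid_dist_def)
    also have "\<dots> \<le> real m * (s * (\<bar>cond_cov p E i j S a\<bar> / 4 ^ p)) powr (1 / real m)"
      using s(2)[OF a] by (intro mult_left_mono powr_mono2) auto
    also have "\<dots> = (real m * s powr (1 / real m)) * (\<bar>cond_cov p E i j S a\<bar> / 4 ^ p) powr (1 / real m)"
      by (subst powr_mult) (use s(1) in auto)
    finally show ?thesis .
  qed
  moreover have "0 < real m * s powr (1 / real m)" "0 < 1 / real m" using m s(1) by auto
  ultimately show ?thesis by blast
qed

lemma triple_bounds_exist: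
  assumes t: "(i, j, S) \<in> triples p"
  shows "\<exists>c k. triple_bounds i j S c k"
proof -
  obtain c k where 1: "0 < c" "0 < k"
    "\<And>a. a \<in> cube E \<Longrightarrow> euclid_infdist E a (V_set p E i j S) \<le> c * (\<bar>cond_cov p E i j S a\<bar> / 4 ^ p) powr k"
    using lojasiewicz_cond_cov[OF t] by blast
  obtain c' k' where 2: "0 < c'" "0 < k'"
    "\<And>l. \<not> d_separated E i j S \<Longrightarrow> 0 < l \<Longrightarrow> l < 1 \<Longrightarrow> vol E (P_set p E l i j S) \<le> c' * l powr k'"
  proof (cases "d_separated E i j S")
    case True
    then show ?thesis using that[of 1 1] by simp
  next
    case False
    then show ?thesis using vol_bound[OF t False] that by blast
  qed
  have "triple_bounds i j S (max c c') (min k k')"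
    by (rule triple_boundsI[OF t 1(1,2) _ _ 1(3) 2(1,2) _ _ 2(3)]) (use 1 2 in auto)
  then show ?thesis by blast
qed

lemma uniform_triple_bounds:
  "\<exists>c k. 0 < c \<and> 0 < k \<and> (\<forall>(i, j, S)\<in>triples p. triple_bounds i j S c k)"
proof -
  have "\<exists>c k. 0 < c \<and> 0 < k \<and> (\<forall>(i, j, S)\<in>T. triple_bounds i j S c k)"
    if "finite T" "T \<subseteq> triples p" for T
    using that
  proof (induction T rule: finite_induct)
    case empty
    then show ?case by (intro exI[of _ 1]) simp
  next
    case (insert x T)
    obtain i j S where x: "x = (i, j, S)" by (cases x) auto
    then have t: "(i, j, S) \<in> triples p" using insert.prems by simp
    from insert.IH insert.prems obtain c k where
      "0 < c \<and> 0 < k \<and> (\<forall>(i, j, S)\<in>T. triple_bounds i j S c k)" by blast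
    then have IH: "0 < c" "0 < k" "\<And>i j S. (i, j, S) \<in> T \<Longrightarrow> triple_bounds i j S c k" by auto
    obtain c' k' where new: "triple_bounds i j S c' k'" using triple_bounds_exist[OF t] by blast
    then have pos: "0 < k'" by (simp add: triple_bounds_def)
    have "triple_bounds i j S (max c c') (min k k')"
      using IH pos by (intro triple_bounds_mono[OF new _ _ _ t]) auto
    moreover have "triple_bounds i' j' S' (max c c') (min k k')" if "(i', j', S') \<in> T" for i' j' S'
      using IH pos insert.prems that by (intro triple_bounds_mono[OF IH(3)[OF that]]) auto
    ultimately show ?case
      using IH pos by (intro exI[of _ "max c c'"] exI[of _ "min k k'"]) (auto simp: x)
  qed
  from this[OF finite_triples order_refl] show ?thesis .
qed

text \<open>Positivity is what allows the factor kappa^k of the right hand side to be absorbed into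
  the constant.\<close>

lemma kappa_pos:
  assumes "2 \<le> p"
  shows "0 < kappa p E"
proof -
  have t: "(0, 1, {}) \<in> triples p" using assms by (auto simp: triples_def)
  define a0 :: "nat \<times> nat \<Rightarrow> real" where "a0 = (\<lambda>e\<in>E. 0)"
  have a0: "a0 \<in> cube E" by (auto simp: a0_def cube_def)
  have "0 < cond_var p E 0 {} a0" using assms a0 by (intro cond_var_bounds) auto
  also have "\<dots> \<le> (SUP a\<in>cube E. cond_var p E 0 {} a)"
    using assms by (intro cSUP_upper a0 bdd_aboveI2[of _ _ "4 ^ p"] cond_var_bounds) auto
  also have "\<dots> \<le> kappa p E"
    unfolding kappa_def using finite_triples t by (intro Max_ge) (auto intro!: rev_image_eqI[of "(0, 1, {})"])
  finally show ?thesis .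
qed

section \<open>Lower bound for the degree sum\<close>

lemma d_connected_imp_edge:
  assumes "\<not> d_separated E i j S" "i \<noteq> j"
  shows "E \<noteq> {}"
proof -
  obtain xs where xs: "skeleton_path E i j xs" using assms(1) unfolding d_separated_def by blast
  have "Suc 0 < length xs"
  proof (rule ccontr)
    assume "\<not> ?thesis"
    then obtain x where "xs = [x]" using xs by (cases xs) (auto simp: skeleton_path_def)
    then show False using xs assms(2) by (simp add: skeleton_path_def)
  qed
  then have "adjacent E (xs ! 0) (xs ! Suc 0)" using xs by (simp add: skeleton_path_def)
  then show ?thesis by (auto simp: adjacent_def)
qed

text \<open>Conditioning on all other nodes leaves nothing to marginalise, so the polynomial is a
  bare entry of K, whose monomials can be inspected directly.\<close>

lemma cov_poly_full_conditioning:
  assumes "i < p" "j < p"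
  shows "cov_poly p E i j ({..<p} - {i, j}) = K_mat p E mvar $$ (i, j)"
proof -
  define K where "K = K_mat p E mvar"
  have Qc: "{..<p} - (({..<p} - {i, j}) \<union> {i, j}) = {}" by auto
  have K: "dim_row K = p" "dim_col K = p"
    unfolding K_def K_mat_def A_mat_def by simp_all
  have empty: "submatrix K {} {} \<in> carrier_mat 0 0"
    by (rule carrier_matI) (simp_all add: dim_submatrix)
  have det: "Determinant.det (submatrix K {} {}) = 1" by (rule det_dim_zero[OF empty])
  have row: "submatrix K {i} {} \<in> carrier_mat 1 0"
  proof (rule carrier_matI)
    have "{a. a < dim_row K \<and> a \<in> {i}} = {i}" using assms K by auto
    then show "dim_row (submatrix K {i} {}) = 1" by (simp only: dim_submatrix) simp
  qed (simp add: dim_submatrix)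
  have col: "submatrix K {} {j} \<in> carrier_mat 0 1"
  proof (rule carrier_matI)
    have "{a. a < dim_col K \<and> a \<in> {j}} = {j}" using assms K by auto
    then show "dim_col (submatrix K {} {j}) = 1" by (simp only: dim_submatrix) simp
  qed (simp add: dim_submatrix)
  have cof: "cofactor_mat (submatrix K {} {}) \<in> carrier_mat 0 0"
    using empty by (auto simp: cofactor_mat_def)
  have "(submatrix K {i} {} * cofactor_mat (submatrix K {} {}) * submatrix K {} {j}) $$ (0, 0) = 0"
    using row col cof by (simp add: scalar_prod_def)
  then show ?thesis
    unfolding cov_poly_def Let_def Qc K_def[symmetric] det by simp
qed

text \<open>Expand K_st over the common index k. By the topological order the terms with k < t
  vanish, k = t gives -a_st, and any term with k > t is zero or a product of two different
  variables.\<close>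

lemma lookup_K_mat_edge:
  assumes "(s, t) \<in> E"
  shows "Poly_Mapping.lookup (K_mat p E mvar $$ (s, t)) (Poly_Mapping.single (s, t) 1) = - 1"
proof -
  have st: "s < t" "t < p" "s < p" using dag assms unfolding ordered_dag_def by force+
  define x :: "nat \<times> nat \<Rightarrow>\<^sub>0 nat" where "x = Poly_Mapping.single (s, t) 1"
  define c :: "nat \<Rightarrow> nat \<Rightarrow> (nat \<times> nat) mpoly_real" where
    "c u k = (if u = k then 1 else 0) - edge_coeff E mvar u k" for u k
  have K: "K_mat p E mvar $$ (s, t) = (\<Sum>k<p. c s k * c t k)"
    using st by (auto simp: K_mat_def A_mat_def c_def scalar_prod_def lessThan_atLeast0 intro!: sum.cong)
  have lt: "u < k" if "edge_coeff E mvar u k \<noteq> (0 :: (nat \<times> nat) mpoly_real)" for u k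
    using that dag by (auto simp: edge_coeff_def ordered_dag_def split: if_splits)
  have summand: "Poly_Mapping.lookup (c s k * c t k) x = (if k = t then - 1 else 0)" if "k < p" for k
  proof -
    consider "k = t" | "k < t" | "t < k" by linarith
    then show ?thesis
    proof cases
      case 1
      have "edge_coeff E mvar t t = (0 :: (nat \<times> nat) mpoly_real)" using lt by blast
      then have "c s k * c t k = - mvar (s, t)" using 1 st assms by (simp add: c_def edge_coeff_def)
      then show ?thesis using 1 by (simp add: mvar_def x_def)
    next
      case 2
      have "edge_coeff E mvar t k = (0 :: (nat \<times> nat) mpoly_real)" using lt[of t k] 2 by force
      then have "c t k = 0" using 2 by (simp add: c_def)
      then show ?thesis using 2 by simp
    next
      case 3
      show ?thesis
      proof (cases "(s, k) \<in> E \<and> (t, k) \<in> E")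
        case True
        then have "c s k * c t k = mvar (s, k) * mvar (t, k)" using 3 st by (simp add: c_def edge_coeff_def)
        also have "\<dots> = Poly_Mapping.single (Poly_Mapping.single (s, k) 1 + Poly_Mapping.single (t, k) 1) 1"
          by (simp add: mvar_def mult_single)
        finally have eq: "c s k * c t k = Poly_Mapping.single (Poly_Mapping.single (s, k) 1 + Poly_Mapping.single (t, k) 1) 1" .
        have "Poly_Mapping.single (s, k) 1 + Poly_Mapping.single (t, k) 1 \<noteq> x"
        proof
          assume "Poly_Mapping.single (s, k) 1 + Poly_Mapping.single (t, k) 1 = x"
          then have "Poly_Mapping.lookup (Poly_Mapping.single (s, k) 1 + Poly_Mapping.single (t, k) 1) (t, k)
            = Poly_Mapping.lookup x (t, k)" by simp
          then show False using st by (simp add: x_def lookup_add lookup_single when_def split: if_splits)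
        qed
        then show ?thesis unfolding eq using 3 by (simp add: lookup_single when_def)
      next
        case False
        then have "c s k * c t k = 0" using 3 st by (auto simp: c_def edge_coeff_def)
        then show ?thesis using 3 by simp
      qed
    qed
  qed
  have "Poly_Mapping.lookup (\<Sum>k<p. c s k * c t k) x = (\<Sum>k<p. Poly_Mapping.lookup (c s k * c t k) x)"
    by (simp add: lookup_sum)
  also have "\<dots> = (\<Sum>k<p. if k = t then - 1 else 0)" using summand by (intro sum.cong) auto
  also have "\<dots> = - 1" using st by simp
  finally show ?thesis by (simp add: K x_def)
qed

lemma sum_degrees_ge_1:
  assumes "E \<noteq> {}"
  shows "1 \<le> (\<Sum>i<p. \<Sum>j\<in>{..<p} - {i}. \<Sum>S\<in>Pow ({..<p} - {i, j}). real (total_degree (cov_poly p E i j S)))"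
proof -
  obtain s t where st: "(s, t) \<in> E" using assms by auto
  have lt: "s < t" "t < p" "s < p" using dag st unfolding ordered_dag_def by force+
  define f where "f = cov_poly p E s t ({..<p} - {s, t})"
  define x :: "nat \<times> nat \<Rightarrow>\<^sub>0 nat" where "x = Poly_Mapping.single (s, t) 1"
  have "Poly_Mapping.lookup f x = - 1"
    unfolding f_def x_def cov_poly_full_conditioning[OF lt(3,2)] by (rule lookup_K_mat_edge[OF st])
  then have x: "x \<in> Poly_Mapping.keys f" by (simp add: in_keys_iff)
  then have "f \<noteq> 0" by auto
  have "monom_degree x = 1" by (simp add: monom_degree_def x_def)
  moreover have "monom_degree x \<le> total_degree f"
    using x \<open>f \<noteq> 0\<close> by (simp add: total_degree_def)
  ultimately have "1 \<le> real (total_degree f)" by simp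
  also have "\<dots> \<le> (\<Sum>S\<in>Pow ({..<p} - {s, t}). real (total_degree (cov_poly p E s t S)))"
    unfolding f_def by (rule member_le_sum) auto
  also have "\<dots> \<le> (\<Sum>j\<in>{..<p} - {s}. \<Sum>S\<in>Pow ({..<p} - {s, j}). real (total_degree (cov_poly p E s j S)))"
    by (rule member_le_sum) (use lt in \<open>auto intro: sum_nonneg\<close>)
  also have "\<dots> \<le> (\<Sum>i<p. \<Sum>j\<in>{..<p} - {i}. \<Sum>S\<in>Pow ({..<p} - {i, j}). real (total_degree (cov_poly p E i j S)))"
    by (rule member_le_sum[of s "{..<p}"]) (use lt in \<open>auto intro!: sum_nonneg\<close>)
  finally show ?thesis .
qed

section \<open>Inclusions between the unfaithful sets and the union bound\<close>

lemma adjacent_not_d_separated: "(i, j) \<in> E \<Longrightarrow> \<not> d_separated E i j S"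
proof -
  assume e: "(i, j) \<in> E"
  then have "i \<noteq> j" using dag by (auto simp: ordered_dag_def)
  then have "skeleton_path E i j [i, j]" using e by (auto simp: skeleton_path_def adjacent_def less_Suc_eq)
  then show ?thesis unfolding d_separated_def by fastforce
qed

lemma N2_subset_N1: "N2_set p E l \<subseteq> N1_set p E l"
  unfolding N2_set_def N1_set_def by (rule UN_mono) auto

lemma N1_subset_M: "N1_set p E l \<subseteq> M_set p E l"
  unfolding N1_set_def M_set_def using adjacent_not_d_separated by (intro UN_mono) auto

lemma fmeasurable_sets:
  "N2_set p E l \<in> fmeasurable (lborel_on E)"
  "N1_set p E l \<in> fmeasurable (lborel_on E)"
  "M_set p E l \<in> fmeasurable (lborel_on E)"
  unfolding N2_set_def N1_set_def M_set_def by (rule fmeasurable_Union_P_set; force)+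

lemma vol_M_set_le:
  assumes b: "\<And>i j S. (i, j, S) \<in> triples p \<Longrightarrow> \<not> d_separated E i j S \<Longrightarrow> vol E (P_set p E l i j S) \<le> b"
    and b0: "0 \<le> b"
  shows "vol E (M_set p E l) \<le> real (card (triples p)) * b"
proof -
  define T where "T = {(i, j, S) \<in> triples p. \<not> d_separated E i j S}"
  have T: "T \<subseteq> triples p" by (auto simp: T_def)
  then have finT: "finite T" by (rule finite_subset[OF _ finite_triples])
  have "vol E (M_set p E l) \<le> (\<Sum>t\<in>T. vol E (case t of (i, j, S) \<Rightarrow> P_set p E l i j S))"
    unfolding vol_def M_set_def T_def[symmetric]
  proof (rule measure_UNION_le[OF finT])
    show "(case t of (i, j, S) \<Rightarrow> P_set p E l i j S) \<in> sets (lborel_on E)" if "t \<in> T" for t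
      using that T P_set_in_sets by (cases t) auto
  qed
  also have "\<dots> \<le> (\<Sum>t\<in>T. b)" using b by (intro sum_mono) (auto simp: T_def)
  also have "\<dots> \<le> real (card (triples p)) * b"
    using card_mono[OF finite_triples T] b0 by (simp add: mult_right_mono)
  finally show ?thesis .
qed

end

theorem theorem5p1:
  fixes p :: nat and E :: "(nat \<times> nat) set" and C :: real
  assumes "p \<ge> 2"
    and "ordered_dag p E"
    and "crofton_constant (card E) C"
  shows "\<exists>cc kk :: nat \<Rightarrow> nat \<Rightarrow> nat set \<Rightarrow> real.
    (\<forall>(i, j, S) \<in> triples p.
       cc i j S > 0 \<and> kk i j S > 0 \<and>
       (\<forall>a \<in> cube E. euclid_infdist E a (V_set p E i j S)
            \<le> cc i j S * \<bar>cond_cov p E i j S a\<bar> powr kk i j S)) \<and>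
    (let c = Max ((\<lambda>(i, j, S). cc i j S) ` triples p);
         k = Min ((\<lambda>(i, j, S). kk i j S) ` triples p)
     in \<forall>l :: real. 0 < l \<and> l < 1 \<longrightarrow>
          vol E (N2_set p E l) / 2 ^ card E \<le> vol E (N1_set p E l) / 2 ^ card E \<and>
          vol E (N1_set p E l) / 2 ^ card E \<le> vol E (M_set p E l) / 2 ^ card E \<and>
          vol E (M_set p E l) / 2 ^ card E
            \<le> C * c * kappa p E powr k * l powr k / 2 powr (real (card E) / 2) *
              (\<Sum>i<p. \<Sum>j\<in>{..<p} - {i}. \<Sum>S\<in>Pow ({..<p} - {i, j}).
                  real (total_degree (cov_poly p E i j S))))"
proof -
  interpret sem_cube p E by standard (rule assms(2))
  obtain c0 k where "0 < c0 \<and> 0 < k \<and> (\<forall>(i, j, S)\<in>triples p. triple_bounds i j S c0 k)"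
    using uniform_triple_bounds by blast
  then have ck: "0 < c0" "0 < k"
    "\<And>i j S. (i, j, S) \<in> triples p \<Longrightarrow> triple_bounds i j S c0 k"
    by auto
  define N where "N = real (card (triples p))"
  define D where "D = (\<Sum>i<p. \<Sum>j\<in>{..<p} - {i}. \<Sum>S\<in>Pow ({..<p} - {i, j}).
    real (total_degree (cov_poly p E i j S)))"
  \<comment> \<open>The factors of the right hand side that are already fixed when \<open>c\<close>
    is chosen. They depend on \<open>k\<close> but not on \<open>l\<close>.\<close>
  define q where "q = C * kappa p E powr k / 2 powr (real (card E) / 2)"
  have C: "0 < C" using assms(3) by (simp add: crofton_constant_def)
  have q: "0 < q" using C kappa_pos[OF assms(1)] by (simp add: q_def)
  \<comment> \<open>Large enough for the Lojasiewicz inequality through \<open>c0\<close>, and for c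
    * q to dominate the N * c0 produced by the union bound.\<close>
  define c where "c = c0 + N * c0 / q"
  have c: "c0 \<le> c" "N * c0 \<le> c * q" "0 < c"
    using ck q by (auto simp: c_def N_def field_simps add_pos_nonneg)
  have ne: "triples p \<noteq> {}"
  proof -
    have "(0, 1, {}) \<in> triples p" using assms(1) by (auto simp: triples_def)
    then show ?thesis by blast
  qed
  have img: "(\<lambda>(i, j, S). r) ` triples p = {r}" for r :: real using ne by auto
  have loj: "euclid_infdist E a (V_set p E i j S) \<le> c * \<bar>cond_cov p E i j S a\<bar> powr k"
    if t: "(i, j, S) \<in> triples p" and a: "a \<in> cube E" for i j S a
  proof -
    have "euclid_infdist E a (V_set p E i j S) \<le> c0 * (\<bar>cond_cov p E i j S a\<bar> / 4 ^ p) powr k"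
      using ck(3)[OF t] a by (simp add: triple_bounds_def)
    also have "\<dots> \<le> c * \<bar>cond_cov p E i j S a\<bar> powr k"
    proof (intro mult_mono powr_mono2)
      have "(1::real) \<le> 4 ^ p" by simp
      then show "\<bar>cond_cov p E i j S a\<bar> / 4 ^ p \<le> \<bar>cond_cov p E i j S a\<bar>"
        by (simp add: pos_divide_le_eq mult_le_cancel_left1)
    qed (use c ck in auto)
    finally show ?thesis .
  qed
  have main: "vol E (M_set p E l) / 2 ^ card E
      \<le> C * c * kappa p E powr k * l powr k / 2 powr (real (card E) / 2) * D"
    if l: "0 < l" "l < 1" for l
  proof (cases "\<exists>i j S. (i, j, S) \<in> triples p \<and> \<not> d_separated E i j S")
    case True
    then have "E \<noteq> {}" using d_connected_imp_edge by (auto simp: triples_def)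
    then have D: "1 \<le> D" unfolding D_def by (rule sum_degrees_ge_1)
    have "vol E (M_set p E l) \<le> N * (c0 * l powr k)"
      unfolding N_def using ck l by (intro vol_M_set_le) (auto simp: triple_bounds_def)
    also have "\<dots> \<le> c * q * l powr k"
      using mult_right_mono[OF c(2), of "l powr k"] by (simp add: mult_ac)
    also have "\<dots> \<le> c * q * l powr k * D"
      using mult_left_mono[OF D, of "c * q * l powr k"] c q by simp
    finally have "vol E (M_set p E l) \<le> c * q * l powr k * D" .
    \<comment> \<open>The normalisation divides by at least 1, so the bound on the unnormalised
      volume suffices.\<close>
    moreover have "vol E (M_set p E l) / 2 ^ card E \<le> vol E (M_set p E l)"
      using measure_nonneg[of "lborel_on E" "M_set p E l"]
      by (simp add: vol_def pos_divide_le_eq mult_le_cancel_left1)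
    ultimately show ?thesis by (simp add: q_def mult_ac)
  next
    case False
    \<comment> \<open>Without d-connected triples the degree sum may be 0, but then the union
      defining M is empty.\<close>
    then have "M_set p E l = {}" unfolding M_set_def by auto
    moreover have "0 \<le> D" unfolding D_def by (intro sum_nonneg) auto
    ultimately show ?thesis using C c by (simp add: vol_def)
  qed
  have "vol E (N2_set p E l) \<le> vol E (N1_set p E l)" "vol E (N1_set p E l) \<le> vol E (M_set p E l)" for l
    unfolding vol_def using fmeasurable_sets[of l] N2_subset_N1 N1_subset_M
    by (auto intro!: measure_mono_fmeasurable)
  then have "\<forall>l. 0 < l \<and> l < 1 \<longrightarrow>
      vol E (N2_set p E l) / 2 ^ card E \<le> vol E (N1_set p E l) / 2 ^ card E \<and>
      vol E (N1_set p E l) / 2 ^ card E \<le> vol E (M_set p E l) / 2 ^ card E \<and>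
      vol E (M_set p E l) / 2 ^ card E
        \<le> C * c * kappa p E powr k * l powr k / 2 powr (real (card E) / 2) * D"
    using main by (intro allI impI conjI divide_right_mono) auto
  moreover have "\<forall>(i, j, S)\<in>triples p. 0 < c \<and> 0 < k \<and>
      (\<forall>a\<in>cube E. euclid_infdist E a (V_set p E i j S) \<le> c * \<bar>cond_cov p E i j S a\<bar> powr k)"
    using loj ck(2) c(3) by blast
  moreover have "Max ((\<lambda>(i, j, S). c) ` triples p) = c" "Min ((\<lambda>(i, j, S). k) ` triples p) = k"
    by (simp_all only: img Max_singleton Min_singleton)
  ultimately show ?thesis
    unfolding D_def[symmetric] Let_def
    by (intro exI[where P = "\<lambda>cc. \<exists>kk. _ cc kk" and x = "\<lambda>_ _ _. c"] exI[where x = "\<lambda>_ _ _. k"]) simp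
qed

end
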